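(* Let $T=\begin{pmatrix}T_0&S\\0&T_1\end{pmatrix}\in\mathcal{FB}_2(\Omega)\cap\mathcal{L}(\mathcal{H})$ and $\widetilde T=\begin{pmatrix}\widetilde T_0&\widetilde S\\0&\widetilde T_1\end{pmatrix}\in\mathcal{FB}_2(\Omega)\cap\mathcal{L}(\widetilde{\mathcal{H}})$. Let $t_1$ and $\widetilde t_1$ be non-zero holomorphic cross-sections of the line bundles $E_{T_1}$ and $E_{\widetilde T_1}$, respectively, and put $t_0=-St_1$, $\widetilde t_0=-\widetilde S\widetilde t_1$. Then the following statements are equivalent: (1) The orthogonal projections $P_T(\lambda)$ and $P_{\widetilde T}(\lambda)$ are unitarily equivalent, i.e. there is a unitary $U:\mathcal{H}\to\widetilde{\mathcal{H}}$ with $UP_T(\lambda)=P_{\widetilde T}(\lambda)U$ for all $\lambda\in\Omega$. (2) The operators $T$ and $\widetilde T$ are unitarily equivalent. (3) $\mathcal{K}_{T_0}=\mathcal{K}_{\widetilde T_0}$ (or $\mathcal{K}_{T_1}=\mathcal{K}_{\widetilde T_1}$) and $\dfrac{\|St_1\|^2}{\|t_1\|^2}=\dfrac{\|\widetilde S\widetilde t_1\|^2}{\|\widetilde t_1\|^2}$ on $\Omega$. (4) There exists a unitary $U=\operatorname{diag}\{U_{00},U_{11}\}$ (with $U_{ii}:\mathcal{H}_i\to\widetilde{\mathcal{H}}_i$) such that for all $\lambda\in\Omega$ $$\begin{pmatrix}F_{P_T}(\lambda)&S_{P_T}(\lambda)\\S_{P_T}^*(\lambda)&0\end{pmatrix}=U^*\begin{pmatrix}F_{P_{\widetilde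 T}}(\lambda)&S_{P_{\widetilde T}}(\lambda)\\S_{P_{\widetilde T}}^*(\lambda)&0\end{pmatrix}U.$$
   Context: $\Omega\subset\mathbb{C}$ is a bounded domain. $\mathcal{B}_n(\Omega)$ (Cowen–Douglas class) is the set of bounded operators $T$ on a complex separable Hilbert space $\mathcal{H}$ such that for all $\lambda\in\Omega$, $\operatorname{ran}(T-\lambda)$ is closed and $\dim\ker(T-\lambda)=n$, and the closed span of $\bigcup_{\lambda\in\Omega}\ker(T-\lambda)$ is $\mathcal{H}$. (As is standard for this class, $T-\lambda$ is surjective.) $E_T$ is the Hermitian holomorphic vector bundle over $\Omega$ with fibres $\ker(T-\lambda)$; $P_T(\lambda)$ is the orthogonal projection onto $\ker(T-\lambda)$. For $T\in\mathcal{B}_1(\Omega)$ with nowhere-vanishing holomorphic section $\gamma$ of $E_T$, $\mathcal{K}_T=-\frac{\partial^2}{\partial\lambda\partial\overline\lambda}\log\|\gamma\|^2$. $\mathcal{FB}_2(\Omega)$ is the set of bounded operators $T=\begin{pmatrix}T_0&S\\0&T_1\end{pmatrix}$ on $\mathcal{H}=\mathcal{H}_0\oplus\mathcal{H}_1$ with $T_i\in\mathcal{B}_1(\Omega)\cap\mathcal{L}(\mathcal{H}_i)$ and $S:\mathcal{H}_1\to\mathcal{H}_0$ a non-zero bounded operator with $T_0S=ST_1$; similarly $\widetilde{\mathcal{H}}=\widetilde{\mathcal{H}}_0\oplus\widetilde{\mathcal{H}}_1$ for $\widetilde T$. With $h_0=\|t_0\|^2$, identifying a vector $t$ with the map $\mathbb{C}\ni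 c\mapsto ct$ (so $ts^*$ denotes the rank-one operator $x\mapsto\langle x,s\rangle t$), define $$F_{P_T}=\frac{1}{\mathcal{K}_{T_0}h_0^2}\Big(-(\partial\overline\partial h_0)\,t_0t_0^*+(\partial h_0)\,t_0t_0'^*+(\overline\partial h_0)\,t_0't_0^*-h_0\,t_0't_0'^*\Big)\in\mathcal{L}(\mathcal{H}_0),$$ $$S_{P_T}=\frac{1}{\mathcal{K}_{T_0}h_0^2}\Big((\partial h_0)\,t_0t_1^*-h_0\,t_0't_1^*\Big)\in\mathcal{L}(\mathcal{H}_1,\mathcal{H}_0),$$ with $\partial=\partial/\partial\lambda$, $\overline\partial=\partial/\partial\overline\lambda$, and analogously for $\widetilde T$ using $\widetilde t_0,\widetilde t_1$. It is assumed that $t_1,\widetilde t_1$ are nowhere vanishing and that $t_0,t_0'$ (respectively $\widetilde t_0,\widetilde t_0'$) are linearly independent at every point of $\Omega$ (the assumption under which the $1$-jet bundle of $t_0$ is defined). *)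

theory Defs
  imports "HOL-Analysis.Analysis"
begin

section \<open>Complex Hilbert spaces\<close>

text \<open>
  The real structure (norm, topology, \<^const>\<open>bounded_linear\<close>, \<^const>\<open>has_derivative\<close>) is that of
  \<^class>\<open>real_inner\<close>, the real inner product being the real part of the complex one.
  \<open>cinner\<close> is linear in its first and conjugate-linear in its second argument.
\<close>

class complex_inner = real_inner +
  fixes scaleC :: "complex \<Rightarrow> 'a \<Rightarrow> 'a" (infixr "*\<^sub>C" 75)
    and cinner :: "'a \<Rightarrow> 'a \<Rightarrow> complex"
  assumes scaleC_add_right: "c *\<^sub>C (x + y) = c *\<^sub>C x + c *\<^sub>C y"
    and scaleC_add_left: "(c + d) *\<^sub>C x = c *\<^sub>C x + d *\<^sub>C x"
    and scaleC_scaleC: "c *\<^sub>C (d *\<^sub>C x) = (c * d) *\<^sub>C x"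
    and scaleC_of_real: "complex_of_real r *\<^sub>C x = r *\<^sub>R x"
    and cinner_commute: "cinner x y = cnj (cinner y x)"
    and cinner_add_left: "cinner (x + y) z = cinner x z + cinner y z"
    and cinner_scaleC_left: "cinner (c *\<^sub>C x) y = c * cinner x y"
    and Re_cinner: "Re (cinner x y) = inner x y"

class separable_chilbert_space = complex_inner + complete_space + second_countable_topology

instantiation prod :: (complex_inner, complex_inner) complex_inner
begin

definition scaleC_prod :: "complex \<Rightarrow> 'a \<times> 'b \<Rightarrow> 'a \<times> 'b"
  where "scaleC_prod c p = (c *\<^sub>C fst p, c *\<^sub>C snd p)"

definition cinner_prod :: "'a \<times> 'b \<Rightarrow> 'a \<times> 'b \<Rightarrow> complex"
  where "cinner_prod p q = cinner (fst p) (fst q) + cinner (snd p) (snd q)"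

instance
proof
  fix p q :: "'a \<times> 'b"
  show "cinner p q = cnj (cinner q p)"
    by (metis cinner_prod_def cinner_commute complex_cnj_add)
qed (simp_all add: scaleC_prod_def cinner_prod_def inner_prod_def plus_prod_def scaleR_prod_def
      scaleC_add_right scaleC_add_left scaleC_scaleC scaleC_of_real
      cinner_add_left cinner_scaleC_left Re_cinner algebra_simps)

end

instance prod :: (separable_chilbert_space, separable_chilbert_space) separable_chilbert_space ..

interpretation complex_vector: vector_space "scaleC :: complex \<Rightarrow> 'a::complex_inner \<Rightarrow> 'a"
proof
  fix x :: 'a
  show "1 *\<^sub>C x = x"
    using scaleC_of_real[of 1 x] by simp
qed (simp_all add: scaleC_add_right scaleC_add_left scaleC_scaleC)


section \<open>Operators\<close>

definition bounded_clinear :: "('a::complex_inner \<Rightarrow> 'b::complex_inner) \<Rightarrow> bool"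
  where "bounded_clinear A \<longleftrightarrow> bounded_linear A \<and> (\<forall>c x. A (c *\<^sub>C x) = c *\<^sub>C A x)"

definition unitary :: "('a::complex_inner \<Rightarrow> 'b::complex_inner) \<Rightarrow> bool"
  where "unitary U \<longleftrightarrow>
    bounded_clinear U \<and> surj U \<and> (\<forall>x y. cinner (U x) (U y) = cinner x y)"

definition cadjoint :: "('a::complex_inner \<Rightarrow> 'b::complex_inner) \<Rightarrow> 'b \<Rightarrow> 'a"
  where "cadjoint A = (THE B. \<forall>x y. cinner (A x) y = cinner x (B y))"

definition orth_proj :: "'a::complex_inner set \<Rightarrow> 'a \<Rightarrow> 'a"
  where "orth_proj M x = (THE y. y \<in> M \<and> (\<forall>z\<in>M. cinner (x - y) z = 0))"

text \<open>The operator \<open>t s\<^sup>*\<close>.\<close>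

definition rank_one :: "'a::complex_inner \<Rightarrow> 'b::complex_inner \<Rightarrow> 'b \<Rightarrow> 'a"
  where "rank_one t s x = cinner x s *\<^sub>C t"

text \<open>The operator with matrix \<open>(A, B; C, D)\<close>, rows separated by the semicolon.\<close>

definition block_op ::
    "('a \<Rightarrow> 'c) \<Rightarrow> ('b \<Rightarrow> 'c) \<Rightarrow> ('a \<Rightarrow> 'd) \<Rightarrow> ('b \<Rightarrow> 'd) \<Rightarrow> 'a \<times> 'b \<Rightarrow> 'c::plus \<times> 'd::plus"
  where "block_op A B C D p = (A (fst p) + B (snd p), C (fst p) + D (snd p))"


section \<open>The classes \<open>B\<^sub>n(\<Omega>)\<close> and \<open>FB\<^sub>2(\<Omega>)\<close>\<close>

definition eigenspace :: "('a::complex_inner \<Rightarrow> 'a) \<Rightarrow> complex \<Rightarrow> 'a set"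
  where "eigenspace T \<mu> = {x. T x - \<mu> *\<^sub>C x = 0}"

text \<open>
  \<open>complex_vector.dim\<close> is \<open>0\<close> on infinite-dimensional subspaces, so \<open>0 < n\<close> makes the
  dimension condition mean what it says.
\<close>

definition cowen_douglas :: "nat \<Rightarrow> complex set \<Rightarrow> ('a::separable_chilbert_space \<Rightarrow> 'a) set"
  where "cowen_douglas n \<Omega> = {T. 0 < n \<and> bounded_clinear T \<and>
    (\<forall>\<mu>\<in>\<Omega>. closed (range (\<lambda>x. T x - \<mu> *\<^sub>C x)) \<and>
          complex_vector.dim (eigenspace T \<mu>) = n) \<and>
    closure (complex_vector.span (\<Union>\<mu>\<in>\<Omega>. eigenspace T \<mu>)) = UNIV}"

text \<open>The triple \<open>(T\<^sub>0, S, T\<^sub>1)\<close> stands for the operator \<open>block_op T\<^sub>0 S 0 T\<^sub>1\<close>.\<close>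

definition FB2 :: "complex set \<Rightarrow> (('a::separable_chilbert_space \<Rightarrow> 'a) \<times> ('b \<Rightarrow> 'a) \<times>
    ('b::separable_chilbert_space \<Rightarrow> 'b)) set"
  where "FB2 \<Omega> = {(T0, S, T1). T0 \<in> cowen_douglas 1 \<Omega> \<and> T1 \<in> cowen_douglas 1 \<Omega> \<and>
    bounded_clinear S \<and> S \<noteq> (\<lambda>y. 0) \<and> T0 \<circ> S = S \<circ> T1}"

definition eigen_proj :: "('a::complex_inner \<Rightarrow> 'a) \<Rightarrow> complex \<Rightarrow> 'a \<Rightarrow> 'a"
  where "eigen_proj T \<mu> = orth_proj (eigenspace T \<mu>)"


section \<open>Holomorphic sections and curvature\<close>

definition has_cderiv :: "(complex \<Rightarrow> 'a::complex_inner) \<Rightarrow> 'a \<Rightarrow> complex \<Rightarrow> bool"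
  where "has_cderiv f D z \<longleftrightarrow> (f has_derivative (\<lambda>h. h *\<^sub>C D)) (at z)"

definition cderiv :: "(complex \<Rightarrow> 'a::complex_inner) \<Rightarrow> complex \<Rightarrow> 'a"
  where "cderiv f z = (THE D. has_cderiv f D z)"

definition nonvanishing_section ::
    "complex set \<Rightarrow> ('a::complex_inner \<Rightarrow> 'a) \<Rightarrow> (complex \<Rightarrow> 'a) \<Rightarrow> bool"
  where "nonvanishing_section \<Omega> T \<gamma> \<longleftrightarrow>
    (\<forall>\<mu>\<in>\<Omega>. (\<exists>D. has_cderiv \<gamma> D \<mu>) \<and> \<gamma> \<mu> \<in> eigenspace T \<mu> \<and> \<gamma> \<mu> \<noteq> 0)"

text \<open>
  The Wirtinger derivatives \<open>(\<partial>\<^sub>x - \<i> \<partial>\<^sub>y) / 2\<close> and \<open>(\<partial>\<^sub>x + \<i> \<partial>\<^sub>y) / 2\<close>;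
  \<^const>\<open>frechet_derivative\<close> is the derivative over the reals.
\<close>

definition wirtinger :: "(complex \<Rightarrow> complex) \<Rightarrow> complex \<Rightarrow> complex"
  where "wirtinger f z =
    (frechet_derivative f (at z) 1 - \<i> * frechet_derivative f (at z) \<i>) / 2"

definition wirtinger_bar :: "(complex \<Rightarrow> complex) \<Rightarrow> complex \<Rightarrow> complex"
  where "wirtinger_bar f z =
    (frechet_derivative f (at z) 1 + \<i> * frechet_derivative f (at z) \<i>) / 2"

text \<open>
  The value does not depend on the section chosen: two nowhere-vanishing holomorphic sections of
  a line bundle differ by a nowhere-vanishing holomorphic factor \<open>f\<close>, and \<open>ln \<bar>f\<bar>\<^sup>2\<close> is harmonic.
\<close>

definition curvature :: "complex set \<Rightarrow> ('a::complex_inner \<Rightarrow> 'a) \<Rightarrow> complex \<Rightarrow> complex"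
  where "curvature \<Omega> T \<mu> =
    (let \<gamma> = (SOME \<gamma>. nonvanishing_section \<Omega> T \<gamma>)
     in - wirtinger (wirtinger_bar (\<lambda>z. complex_of_real (ln ((norm (\<gamma> z))\<^sup>2)))) \<mu>)"

text \<open>Linear independence of a pair; unlike independence of the set \<open>{x, y}\<close> it fails for \<open>x = y\<close>.\<close>

definition cindependent_pair :: "'a::complex_inner \<Rightarrow> 'a \<Rightarrow> bool"
  where "cindependent_pair x y \<longleftrightarrow> (\<forall>a b. a *\<^sub>C x + b *\<^sub>C y = 0 \<longrightarrow> a = 0 \<and> b = 0)"

definition normsq :: "(complex \<Rightarrow> 'a::complex_inner) \<Rightarrow> complex \<Rightarrow> complex"
  where "normsq t z = complex_of_real ((norm (t z))\<^sup>2)"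

definition F_P :: "complex set \<Rightarrow> ('a::complex_inner \<Rightarrow> 'a) \<Rightarrow> (complex \<Rightarrow> 'a) \<Rightarrow>
    complex \<Rightarrow> 'a \<Rightarrow> 'a"
  where "F_P \<Omega> T0 t0 \<mu> x =
    (let h0 = normsq t0; t = t0 \<mu>; t' = cderiv t0 \<mu>
     in (1 / (curvature \<Omega> T0 \<mu> * (h0 \<mu>)\<^sup>2)) *\<^sub>C
        (- (wirtinger (wirtinger_bar h0) \<mu> *\<^sub>C rank_one t t x)
         + wirtinger h0 \<mu> *\<^sub>C rank_one t t' x
         + wirtinger_bar h0 \<mu> *\<^sub>C rank_one t' t x
         - h0 \<mu> *\<^sub>C rank_one t' t' x))"

definition S_P :: "complex set \<Rightarrow> ('a::complex_inner \<Rightarrow> 'a) \<Rightarrow> (complex \<Rightarrow> 'a) \<Rightarrow>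
    (complex \<Rightarrow> 'b::complex_inner) \<Rightarrow> complex \<Rightarrow> 'b \<Rightarrow> 'a"
  where "S_P \<Omega> T0 t0 t1 \<mu> y =
    (let h0 = normsq t0
     in (1 / (curvature \<Omega> T0 \<mu> * (h0 \<mu>)\<^sup>2)) *\<^sub>C
        (wirtinger h0 \<mu> *\<^sub>C rank_one (t0 \<mu>) (t1 \<mu>) y
         - h0 \<mu> *\<^sub>C rank_one (cderiv t0 \<mu>) (t1 \<mu>) y))"

end

theory Submission
  imports Defs "HOL-Complex_Analysis.Complex_Analysis"
begin

text \<open>
  Write \<open>s\<^sub>0, s\<^sub>1\<close> for the sections belonging to the second operator; a prime marks the derivative of
  a section and the second one of a pair of operators. All statements are shown equivalent
  to the existence of unitaries \<open>U\<^sub>0, U\<^sub>1\<close> on the summands with \<open>U\<^sub>0 T\<^sub>0 = T\<^sub>0' U\<^sub>0\<close>, \<open>U\<^sub>1 T\<^sub>1 = T\<^sub>1' U\<^sub>1\<close> and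
  \<open>U\<^sub>0 S = S' U\<^sub>1\<close> (\<open>diagonally_equivalent\<close>).

  The eigenspace of \<open>T\<close> at \<open>\<mu>\<close> contains \<open>(t\<^sub>0, 0)\<close> and \<open>(t\<^sub>0', t\<^sub>1)\<close>, and these vectors are total. Hence a
  unitary that intertwines the projections onto the eigenspaces intertwines the operators, and
  conversely (\<open>eigen_projections_intertwined_iff\<close>).

  A unitary intertwiner \<open>U\<close> of the operators is block diagonal. Let \<open>X\<close> and \<open>Y\<close> be the lower left blocks
  of \<open>U\<close> and of its inverse. The operator \<open>X S Y S'\<close> commutes with \<open>T\<^sub>1'\<close> and is at the same time a
  commutator with \<open>T\<^sub>1'\<close>, so by the argument of Kleinecke and Shirokov it has no nonzero eigenvalue; but
  the vectors \<open>s\<^sub>1\<close> are eigenvectors of it. Thus at each point \<open>X t\<^sub>0 = 0\<close> or \<open>Y s\<^sub>0 = 0\<close>, and one of \<open>X\<close>, \<open>Y\<close>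
  vanishes by the identity theorem (\<open>some_block_vanishes\<close>). A triangular unitary intertwiner maps the
  first summand onto the first summand, so both blocks vanish (\<open>inverse_upper_triangular\<close>).

  Such \<open>U\<^sub>0\<close> and \<open>U\<^sub>1\<close> multiply the sections by one and the same holomorphic function \<open>c\<close>, that is
  \<open>U\<^sub>0 t\<^sub>0 = c s\<^sub>0\<close> and \<open>U\<^sub>1 t\<^sub>1 = c s\<^sub>1\<close>, so the curvatures and the ratios of norms agree. Conversely, equal
  curvature makes \<open>ln (\<parallel>t\<^sub>i\<parallel>\<^sup>2 / \<parallel>s\<^sub>i\<parallel>\<^sup>2)\<close> harmonic, so on a disc \<open>\<parallel>t\<^sub>i\<parallel> = |f| \<parallel>s\<^sub>i\<parallel>\<close> with \<open>f\<close> holomorphic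
  (\<open>local_norm_quotient\<close>), and the ratio yields this for the other index with the same \<open>f\<close>. By
  polarization the families \<open>t\<^sub>i\<close> and \<open>f s\<^sub>i\<close> have equal Gram matrices; being total already on the disc,
  they are related by a unitary (\<open>local_unitary\<close>).

  For the last statement, \<open>F\<^sub>P\<close> is the orthogonal projection onto the plane spanned by \<open>t\<^sub>0\<close> and \<open>t\<^sub>0'\<close>,
  and \<open>S\<^sub>P\<close> is \<open>d t\<^sub>1\<^sup>*\<close>, where \<open>d\<close> is the vector of this plane with \<open>\<langle>d, t\<^sub>0\<rangle> = 0\<close> and \<open>\<langle>d, t\<^sub>0'\<rangle> = 1\<close>. These data
  are covariant under \<open>U\<^sub>0\<close>, \<open>U\<^sub>1\<close>, and they recover the sections up to a common holomorphic factor
  (\<open>diagonal_equivalence_from_projection_data\<close>).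
\<close>

section \<open>Complex inner product spaces\<close>

lemma cinner_add_right:
  fixes x :: "'a::complex_inner"
  shows "cinner x (y + z) = cinner x y + cinner x z"
  by (metis cinner_commute cinner_add_left complex_cnj_add)

lemma cinner_scaleC_right:
  fixes x :: "'a::complex_inner"
  shows "cinner x (c *\<^sub>C y) = cnj c * cinner x y"
  by (metis cinner_commute cinner_scaleC_left complex_cnj_mult)

lemma cinner_minus_left: "cinner (- x) y = - cinner x y" for x :: "'a::complex_inner"
  by (metis add.right_inverse add_cancel_right_left cinner_add_left minus_unique)

lemma cinner_minus_right: "cinner x (- y) = - cinner x y" for x :: "'a::complex_inner"
  by (metis cinner_commute cinner_minus_left complex_cnj_minus)

lemma cinner_diff_left: "cinner (x - y) z = cinner x z - cinner y z" for x :: "'a::complex_inner"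
  using cinner_add_left[of x "- y" z] by (simp add: cinner_minus_left)

lemma cinner_diff_right: "cinner x (y - z) = cinner x y - cinner x z" for x :: "'a::complex_inner"
  using cinner_add_right[of x y "- z"] by (simp add: cinner_minus_right)

lemma cinner_zero [simp]: "cinner 0 x = 0" "cinner x 0 = 0" for x :: "'a::complex_inner"
  using cinner_diff_left[of x x x] cinner_diff_right[of x x x] by simp_all

lemmas cinner_simps = cinner_add_left cinner_add_right cinner_diff_left cinner_diff_right
  cinner_minus_left cinner_minus_right cinner_scaleC_left cinner_scaleC_right

lemma cinner_self: "cinner x x = complex_of_real ((norm x)\<^sup>2)" for x :: "'a::complex_inner"
proof (rule complex_eqI)
  show "Re (cinner x x) = Re (complex_of_real ((norm x)\<^sup>2))"
    by (simp add: Re_cinner power2_norm_eq_inner)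
  have "Im (cinner x x) = - Im (cinner x x)"
    by (metis cinner_commute cnj.simps(2))
  then show "Im (cinner x x) = Im (complex_of_real ((norm x)\<^sup>2))" by simp
qed

lemma cinner_self_eq_0_iff [simp]: "cinner x x = 0 \<longleftrightarrow> x = 0" for x :: "'a::complex_inner"
  by (simp add: cinner_self)

lemma norm_eq_iff_cinner_self:
  fixes x :: "'a::complex_inner" and y :: "'b::complex_inner"
  shows "norm x = norm y \<longleftrightarrow> cinner x x = cinner y y"
  unfolding cinner_self of_real_eq_iff by simp

lemma norm_scaleC: "norm (c *\<^sub>C x) = cmod c * norm x" for x :: "'a::complex_inner"
proof -
  have "complex_of_real ((norm (c *\<^sub>C x))\<^sup>2) = complex_of_real ((cmod c * norm x)\<^sup>2)"
    unfolding cinner_self[symmetric]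
    by (simp add: cinner_simps cinner_self[of x] power_mult_distrib
        complex_norm_square[of c, symmetric] ac_simps)
  then show ?thesis unfolding of_real_eq_iff by simp
qed

lemma norm_cinner_le: "cmod (cinner x y) \<le> norm x * norm y" for x :: "'a::complex_inner"
proof (cases "cinner x y = 0")
  case False
  define c where "c = cnj (cinner x y) / cmod (cinner x y)"
  have c: "cmod c = 1" using False by (simp add: c_def norm_divide)
  have "cinner (c *\<^sub>C x) y = complex_of_real (cmod (cinner x y))"
    using False complex_norm_square[of "cinner x y"]
    by (simp add: cinner_simps c_def power2_eq_square field_simps)
  then have "cmod (cinner x y) = inner (c *\<^sub>C x) y" by (metis Re_complex_of_real Re_cinner)
  also have "\<dots> \<le> norm (c *\<^sub>C x) * norm y" by (rule norm_cauchy_schwarz)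
  finally show ?thesis by (simp add: norm_scaleC c)
qed simp

lemma scaleC_one [simp]: "1 *\<^sub>C x = x" for x :: "'a::complex_inner"
  by simp

lemma scaleC_scaleR: "c *\<^sub>C (r *\<^sub>R x) = r *\<^sub>R (c *\<^sub>C x)" "(r *\<^sub>R c) *\<^sub>C x = r *\<^sub>R (c *\<^sub>C x)"
  for x :: "'a::complex_inner"
  by (simp_all add: scaleC_of_real[symmetric] scaleC_scaleC scaleR_conv_of_real mult.commute)

lemma bounded_bilinear_scaleC:
  "bounded_bilinear ((*\<^sub>C) :: complex \<Rightarrow> 'a \<Rightarrow> 'a::complex_inner)"
proof (unfold_locales, goal_cases)
  case 5
  then show ?case by (intro exI[of _ 1]) (simp add: norm_scaleC)
qed (simp_all add: scaleC_add_left scaleC_add_right scaleC_scaleR)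

lemma bounded_bilinear_cinner:
  "bounded_bilinear (cinner :: 'a \<Rightarrow> 'a \<Rightarrow> complex)" for dummy :: "'a::complex_inner itself"
proof (unfold_locales, goal_cases)
  case 5
  then show ?case by (intro exI[of _ 1]) (simp add: norm_cinner_le)
qed (simp_all add: cinner_simps scaleC_of_real[symmetric] scaleR_conv_of_real)

interpretation scaleC: bounded_bilinear "(*\<^sub>C) :: complex \<Rightarrow> 'a \<Rightarrow> 'a::complex_inner"
  by (rule bounded_bilinear_scaleC)

interpretation cinner: bounded_bilinear "cinner :: 'a \<Rightarrow> 'a \<Rightarrow> complex"
  for dummy :: "'a::complex_inner itself"
  by (rule bounded_bilinear_cinner)

lemma closed_orthogonal: "closed {v. cinner v x = 0}" for x :: "'a::complex_inner"
  by (intro closed_Collect_eq continuous_intros cinner.continuous_on)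

lemma subspace_orthogonal: "complex_vector.subspace {v. cinner v x = 0}" for x :: "'a::complex_inner"
  by (simp add: complex_vector.subspace_def cinner_simps)

lemma bounded_clinearD:
  assumes "bounded_clinear A"
  shows "bounded_linear A" "A (x + y) = A x + A y" "A (x - y) = A x - A y" "A (- x) = - A x"
    "A 0 = 0" "A (c *\<^sub>C x) = c *\<^sub>C A x"
  using assms unfolding bounded_clinear_def
  by (auto simp: linear_simps real_vector.linear_neg[OF bounded_linear.linear]
      linear_0[OF bounded_linear.linear])

lemma bounded_clinear_comp:
  "bounded_clinear A \<Longrightarrow> bounded_clinear B \<Longrightarrow> bounded_clinear (\<lambda>x. A (B x))"
  unfolding bounded_clinear_def by (auto intro: bounded_linear_compose)

lemma bounded_clinear_isometryI:
  fixes U :: "'a::complex_inner \<Rightarrow> 'b::complex_inner"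
  assumes "\<And>x y. U (x + y) = U x + U y" "\<And>c x. U (c *\<^sub>C x) = c *\<^sub>C U x" "\<And>x. norm (U x) = norm x"
  shows "bounded_clinear U"
  unfolding bounded_clinear_def
proof (intro conjI allI)
  show "bounded_linear U"
    by (rule bounded_linear_intro[where K = 1])
      (simp_all add: assms scaleC_of_real[symmetric])
qed (rule assms)

lemma cadjoint_eqI:
  fixes A :: "'a::complex_inner \<Rightarrow> 'b::complex_inner"
  assumes "\<And>x y. cinner (A x) y = cinner x (B y)"
  shows "cadjoint A = B"
  unfolding cadjoint_def
proof (rule the_equality)
  fix C assume C: "\<forall>x y. cinner (A x) y = cinner x (C y)"
  have "cinner (C y - B y) (C y - B y) = 0" for y
    using C assms by (simp add: cinner_simps)
  then show "C = B" by (simp add: fun_eq_iff)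
qed (simp add: assms)

lemma
  assumes "unitary U"
  shows unitary_bounded_clinear: "bounded_clinear U"
    and unitary_cinner: "cinner (U x) (U y) = cinner x y"
    and unitary_norm: "norm (U x) = norm x"
    and unitary_bij: "bij U"
    and unitary_f_inv: "U (inv U z) = z"
    and unitary_inv_f: "inv U (U x) = x"
proof -
  show cl: "bounded_clinear U" and ci: "cinner (U x) (U y) = cinner x y" for x y
    using assms by (simp_all add: unitary_def)
  show nm: "norm (U x) = norm x" for x by (simp add: norm_eq_iff_cinner_self ci)
  have "inj U"
  proof (rule injI)
    fix x y assume "U x = U y"
    then have "norm (U (x - y)) = 0" by (simp add: bounded_clinearD[OF cl])
    then show "x = y" by (simp add: nm)
  qed
  then show "bij U" "U (inv U z) = z" "inv U (U x) = x"
    using assms by (simp_all add: unitary_def bij_def surj_f_inv_f)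
qed

lemma unitary_inv: "unitary (inv U)" if U: "unitary U"
proof -
  note b = unitary_bounded_clinear[OF U]
  have ci: "cinner (inv U x) (inv U y) = cinner x y" for x y
    by (metis unitary_cinner unitary_f_inv U)
  show ?thesis
    unfolding unitary_def
  proof (intro conjI allI ci)
    show "surj (inv U)" by (metis surj_def unitary_inv_f U)
    show "bounded_clinear (inv U)"
    proof (rule bounded_clinear_isometryI)
      show "inv U (x + y) = inv U x + inv U y" for x y
        by (metis bounded_clinearD(2)[OF b] unitary_f_inv unitary_inv_f U)
      show "inv U (c *\<^sub>C x) = c *\<^sub>C inv U x" for c x
        by (metis bounded_clinearD(6)[OF b] unitary_f_inv unitary_inv_f U)
      show "norm (inv U x) = norm x" for x by (simp add: norm_eq_iff_cinner_self ci)
    qed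
  qed
qed

lemma cadjoint_unitary: "cadjoint U = inv U" if U: "unitary U"
  by (rule cadjoint_eqI) (metis unitary_cinner unitary_f_inv U)

section \<open>Orthogonal projections\<close>

text \<open>
  The nearest point of \<open>M\<close> exists by the parallelogram law, which makes every minimising sequence
  a Cauchy sequence.
\<close>

lemma closed_subspace_projection_exists:
  fixes M :: "'a::{complex_inner, complete_space} set"
  assumes M: "complex_vector.subspace M" "closed M"
  shows "\<exists>y\<in>M. \<forall>z\<in>M. cinner (x - y) z = 0"
proof -
  have add: "a + b \<in> M" and scale: "c *\<^sub>C a \<in> M" if "a \<in> M" "b \<in> M" for a b c
    using M(1) that by (auto simp: complex_vector.subspace_def)
  have scaleR: "r *\<^sub>R a \<in> M" if "a \<in> M" for r a
    using scale[OF that that, of "complex_of_real r"] by (simp add: scaleC_of_real)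
  have "M \<noteq> {}" using M(1) by (auto simp: complex_vector.subspace_def)
  define d where "d = (INF y\<in>M. (norm (x - y))\<^sup>2)"
  have bdd: "bdd_below ((\<lambda>y. (norm (x - y))\<^sup>2) ` M)" by (rule bdd_belowI[of _ 0]) auto
  have d_le: "d \<le> (norm (x - y))\<^sup>2" if "y \<in> M" for y
    unfolding d_def by (rule cINF_lower[OF bdd that])
  have "\<exists>y\<in>M. (norm (x - y))\<^sup>2 < d + inverse (real (Suc n))" for n
  proof (rule ccontr)
    assume "\<not> ?thesis"
    then have "d + inverse (real (Suc n)) \<le> d"
      unfolding d_def by (intro cINF_greatest[OF \<open>M \<noteq> {}\<close>]) (auto simp: not_less d_def)
    moreover have "inverse (real (Suc n)) > 0" by simp
    ultimately show False by linarith
  qed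
  then obtain y where yM: "\<And>n. y n \<in> M"
    and y: "\<And>n. (norm (x - y n))\<^sup>2 < d + inverse (real (Suc n))" by metis
  have par: "(norm (y m - y n))\<^sup>2 \<le> 2 * inverse (real (Suc m)) + 2 * inverse (real (Suc n))" for m n
  proof -
    have "(norm (y m - y n))\<^sup>2 + 4 * (norm (x - (1/2) *\<^sub>R (y m + y n)))\<^sup>2
        = 2 * (norm (x - y m))\<^sup>2 + 2 * (norm (x - y n))\<^sup>2"
      by (simp add: power2_norm_eq_inner inner_simps inner_commute algebra_simps)
    moreover have "d \<le> (norm (x - (1/2) *\<^sub>R (y m + y n)))\<^sup>2"
      by (intro d_le scaleR add yM)
    ultimately show ?thesis using y[of m] y[of n] by linarith
  qed
  have "Cauchy y"
  proof (rule CauchyI)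
    fix e :: real assume "0 < e"
    then have "0 < e\<^sup>2 / 4" by simp
    then obtain N where N: "inverse (real (Suc N)) < e\<^sup>2 / 4"
      using reals_Archimedean by blast
    have small: "inverse (real (Suc k)) < e\<^sup>2 / 4" if "N \<le> k" for k
      using N that by (meson le_imp_inverse_le le_less_trans of_nat_0_less_iff of_nat_mono
          Suc_le_mono zero_less_Suc)
    have "norm (y m - y n) < e" if "N \<le> m" "N \<le> n" for m n
    proof -
      have "(norm (y m - y n))\<^sup>2 < e\<^sup>2" using par[of m n] small[OF that(1)] small[OF that(2)] by linarith
      then show ?thesis using \<open>0 < e\<close> by (simp add: power_less_imp_less_base)
    qed
    then show "\<exists>N. \<forall>m\<ge>N. \<forall>n\<ge>N. norm (y m - y n) < e" by blast
  qed
  then obtain p where p: "y \<longlonglongrightarrow> p" using Cauchy_convergent_iff convergent_def by blast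
  have pM: "p \<in> M" using M(2) p yM closed_sequentially by blast
  have "(norm (x - p))\<^sup>2 \<le> d"
  proof (rule LIMSEQ_le)
    show "(\<lambda>n. (norm (x - y n))\<^sup>2) \<longlonglongrightarrow> (norm (x - p))\<^sup>2" by (intro tendsto_intros p)
    show "(\<lambda>n. d + inverse (real (Suc n))) \<longlonglongrightarrow> d"
      using tendsto_add[OF tendsto_const LIMSEQ_inverse_real_of_nat, of d] by simp
    show "\<exists>N. \<forall>n\<ge>N. (norm (x - y n))\<^sup>2 \<le> d + inverse (real (Suc n))" using y less_imp_le by blast
  qed
  have orth: "inner (x - p) z = 0" if "z \<in> M" for z
  proof (cases "z = 0")
    case False
    define r where "r = inner (x - p) z / inner z z"
    have "(norm (x - p))\<^sup>2 \<le> (norm (x - (p + r *\<^sub>R z)))\<^sup>2"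
      using \<open>(norm (x - p))\<^sup>2 \<le> d\<close> d_le[OF add[OF pM scaleR[OF that]]] by (rule order_trans)
    also have "\<dots> = (norm (x - p))\<^sup>2 - 2 * r * inner (x - p) z + r\<^sup>2 * inner z z"
      unfolding power2_norm_eq_inner
      by (simp add: inner_simps inner_commute power2_eq_square algebra_simps)
    also have "\<dots> = (norm (x - p))\<^sup>2 - (inner (x - p) z)\<^sup>2 / inner z z"
      using False by (simp add: r_def power2_eq_square field_simps)
    finally have "(inner (x - p) z)\<^sup>2 / inner z z \<le> 0" by simp
    then show ?thesis using False inner_gt_zero_iff[of z]
      by (auto simp: divide_le_0_iff not_le[symmetric] simp del: inner_gt_zero_iff)
  qed simp
  have "cinner (x - p) z = 0" if "z \<in> M" for z
  proof (rule complex_eqI)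
    show "Re (cinner (x - p) z) = Re 0" using orth[OF that] by (simp add: Re_cinner)
    have "Re (cinner (x - p) (\<i> *\<^sub>C z)) = 0" using orth[OF scale[OF that that]] by (simp add: Re_cinner)
    then show "Im (cinner (x - p) z) = Im 0" by (simp add: cinner_scaleC_right)
  qed
  then show ?thesis using pM by blast
qed

lemma orth_proj_eqI:
  fixes M :: "'a::complex_inner set"
  assumes M: "complex_vector.subspace M" and y: "y \<in> M" "\<And>z. z \<in> M \<Longrightarrow> cinner (x - y) z = 0"
  shows "orth_proj M x = y"
  unfolding orth_proj_def
proof (rule the_equality)
  fix w assume w: "w \<in> M \<and> (\<forall>z\<in>M. cinner (x - w) z = 0)"
  have "y - w \<in> M" using M w y(1) complex_vector.subspace_diff by blast
  then have "cinner (x - w) (y - w) - cinner (x - y) (y - w) = 0" using w y(2) by simp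
  then have "cinner (y - w) (y - w) = 0"
    by (metis add_diff_cancel_left' cinner_diff_left diff_add_cancel diff_diff_eq2)
  then show "w = y" by simp
qed (use y in blast)

lemma
  fixes M :: "'a::{complex_inner, complete_space} set"
  assumes M: "complex_vector.subspace M" "closed M"
  shows orth_proj_in: "orth_proj M x \<in> M"
    and orth_proj_orthogonal: "z \<in> M \<Longrightarrow> cinner (x - orth_proj M x) z = 0"
  using closed_subspace_projection_exists[OF M, of x] orth_proj_eqI[OF M(1)] by metis+

lemma orth_proj_unitary:
  fixes M :: "'a::complex_inner set" and M' :: "'b::complex_inner set"
  assumes U: "unitary U" and M': "complex_vector.subspace M'" "U ` M = M'"
    and y: "y \<in> M" "\<And>z. z \<in> M \<Longrightarrow> cinner (x - y) z = 0"
  shows "orth_proj M' (U x) = U y"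
proof (rule orth_proj_eqI[OF M'(1)])
  show "U y \<in> M'" using M'(2) y(1) by blast
  fix z assume "z \<in> M'"
  then obtain w where w: "w \<in> M" "z = U w" using M'(2) by blast
  have "U x - U y = U (x - y)"
    by (simp add: bounded_clinearD[OF unitary_bounded_clinear[OF U]])
  then show "cinner (U x - U y) z = 0"
    by (simp add: w unitary_cinner[OF U] y(2))
qed

lemma closed_subspace_eq_UNIV:
  fixes M :: "'a::{complex_inner, complete_space} set"
  assumes M: "complex_vector.subspace M" "closed M"
    and triv: "\<And>x. (\<And>z. z \<in> M \<Longrightarrow> cinner z x = 0) \<Longrightarrow> x = 0"
  shows "M = UNIV"
proof -
  have "x \<in> M" for x
  proof -
    have "x - orth_proj M x = 0"
      by (rule triv) (metis cinner_commute complex_cnj_zero orth_proj_orthogonal[OF M])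
    then show ?thesis using orth_proj_in[OF M, of x] by simp
  qed
  then show ?thesis by blast
qed

section \<open>Isometries given on a total set\<close>

lemma linear_image_subspace:
  fixes A :: "'a::complex_inner \<Rightarrow> 'b::complex_inner"
  assumes "complex_vector.subspace M" "\<And>x y. A (x + y) = A x + A y" "\<And>c x. A (c *\<^sub>C x) = c *\<^sub>C A x"
  shows "complex_vector.subspace (A ` M)"
proof -
  have "A 0 = 0" using assms(3)[of 0 0] by simp
  then show ?thesis
    using assms(1) unfolding complex_vector.subspace_def
    by (auto simp: assms(2,3)[symmetric] image_iff intro: bexI[of _ 0])
qed

lemma subspace_closure:
  fixes M :: "'a::complex_inner set"
  assumes M: "complex_vector.subspace M"
  shows "complex_vector.subspace (closure M)"
  unfolding complex_vector.subspace_def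
proof (intro conjI ballI allI)
  show "0 \<in> closure M" using M complex_vector.subspace_0 closure_subset by blast
next
  fix x y assume "x \<in> closure M" "y \<in> closure M"
  then obtain f g where f: "\<And>n. f n \<in> M" "f \<longlonglongrightarrow> x" and g: "\<And>n. g n \<in> M" "g \<longlonglongrightarrow> y"
    unfolding closure_sequential by blast
  have "(\<lambda>n. f n + g n) \<longlonglongrightarrow> x + y" by (intro tendsto_add f g)
  moreover have "\<And>n. f n + g n \<in> M" using f g complex_vector.subspace_add[OF M] by blast
  ultimately show "x + y \<in> closure M"
    unfolding closure_sequential by (intro exI[of _ "\<lambda>n. f n + g n"]) simp
next
  fix c x assume "x \<in> closure M"
  then obtain f where f: "\<And>n. f n \<in> M" "f \<longlonglongrightarrow> x" unfolding closure_sequential by blast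
  have "(\<lambda>n. c *\<^sub>C f n) \<longlonglongrightarrow> c *\<^sub>C x" by (intro scaleC.tendsto tendsto_const f)
  moreover have "\<And>n. c *\<^sub>C f n \<in> M" using f complex_vector.subspace_scale[OF M] by blast
  ultimately show "c *\<^sub>C x \<in> closure M"
    unfolding closure_sequential by (intro exI[of _ "\<lambda>n. c *\<^sub>C f n"]) simp
qed

text \<open>
  Since the components of a pair in \<open>G\<close> have the same norm, a Cauchy sequence of first components
  carries a Cauchy sequence of second components along with it.
\<close>

lemma isometric_graph_total:
  fixes G :: "('a::separable_chilbert_space \<times> 'b::separable_chilbert_space) set"
  assumes G: "complex_vector.subspace G" "closed G"
    and iso: "\<And>p. p \<in> G \<Longrightarrow> norm (fst p) = norm (snd p)"
    and dense: "closure (fst ` G) = UNIV"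
  shows "\<exists>y. (x, y) \<in> G"
proof -
  have "x \<in> closure (fst ` G)" using dense by simp
  then obtain f where "\<And>n. f n \<in> fst ` G" and f: "f \<longlonglongrightarrow> x" unfolding closure_sequential by blast
  then have "\<forall>n. \<exists>y. (f n, y) \<in> G" by force
  then obtain g where g: "\<And>n. (f n, g n) \<in> G" by metis
  have nm: "norm (g m - g n) = norm (f m - f n)" for m n
    using iso[OF complex_vector.subspace_diff[OF G(1) g g, of m n]] by simp
  have "Cauchy f" using f by (rule LIMSEQ_imp_Cauchy)
  then have "Cauchy g" by (simp add: Cauchy_iff nm)
  then obtain y where "g \<longlonglongrightarrow> y" using Cauchy_convergent_iff convergent_def by blast
  then have "(\<lambda>n. (f n, g n)) \<longlonglongrightarrow> (x, y)" by (intro tendsto_Pair f)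
  then have "(x, y) \<in> G" using closed_sequentially[OF G(2), of "\<lambda>n. (f n, g n)"] g by blast
  then show ?thesis ..
qed

text \<open>
  The closed linear span of the pairs \<open>(v i, w i)\<close> in the product space is the graph of the unitary:
  equality of the Gram matrices makes the components of its elements equal in norm, so that the
  relation is single-valued in both directions.
\<close>

lemma unitary_from_gram:
  fixes v :: "'i \<Rightarrow> 'a::separable_chilbert_space" and w :: "'i \<Rightarrow> 'b::separable_chilbert_space"
  assumes gram: "\<And>i j. i \<in> I \<Longrightarrow> j \<in> I \<Longrightarrow> cinner (v i) (v j) = cinner (w i) (w j)"
    and v: "closure (complex_vector.span (v ` I)) = UNIV"
    and w: "closure (complex_vector.span (w ` I)) = UNIV"
  obtains U where "unitary U" "\<And>i. i \<in> I \<Longrightarrow> U (v i) = w i"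
proof -
  define G0 where "G0 = complex_vector.span ((\<lambda>i. (v i, w i)) ` I)"
  define G where "G = closure G0"
  have G: "complex_vector.subspace G" "closed G"
    unfolding G_def G0_def by (simp_all add: subspace_closure)
  have vwG: "(v i, w i) \<in> G" if "i \<in> I" for i
    unfolding G_def G0_def using that
    by (intro subsetD[OF closure_subset] complex_vector.span_base imageI)
  \<comment> \<open>equality of inner products passes from the generators to \<open>G\<close> in one argument at a time\<close>
  have step: "\<forall>p\<in>G. cinner (fst p) (fst q) = cinner (snd p) (snd q)"
    if q: "\<And>i. i \<in> I \<Longrightarrow> cinner (v i) (fst q) = cinner (w i) (snd q)" for q :: "'a \<times> 'b"
  proof -
    let ?E = "{p::'a \<times> 'b. cinner (fst p) (fst q) = cinner (snd p) (snd q)}"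
    have "complex_vector.subspace ?E"
      by (simp add: complex_vector.subspace_def cinner_simps scaleC_prod_def)
    then have "G0 \<subseteq> ?E" unfolding G0_def by (intro complex_vector.span_minimal) (auto simp: q)
    moreover have "closed ?E"
      by (intro closed_Collect_eq cinner.continuous_on continuous_intros)
    ultimately show ?thesis unfolding G_def using closure_minimal by blast
  qed
  have "cinner (fst p) (v i) = cinner (snd p) (w i)" if "p \<in> G" "i \<in> I" for p i
    using step[of "(v i, w i)"] gram that by simp
  then have "cinner (v i) (fst p) = cinner (w i) (snd p)" if "p \<in> G" "i \<in> I" for p i
    using that by (metis cinner_commute)
  then have GG: "cinner (fst p) (fst q) = cinner (snd p) (snd q)" if "p \<in> G" "q \<in> G" for p q
    using step[of q] that by blast
  have iso: "norm (fst p) = norm (snd p)" if "p \<in> G" for p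
    using GG[OF that that] by (simp add: norm_eq_iff_cinner_self)
  have lin_fst: "complex_vector.subspace (fst ` G)" and lin_snd: "complex_vector.subspace (snd ` G)"
    by (rule linear_image_subspace[OF G(1)]; simp add: scaleC_prod_def)+
  have "complex_vector.span (v ` I) \<subseteq> fst ` G" "complex_vector.span (w ` I) \<subseteq> snd ` G"
    using vwG by (intro complex_vector.span_minimal lin_fst lin_snd; force)+
  then have dense: "closure (fst ` G) = UNIV" "closure (snd ` G) = UNIV"
    using v w closure_mono by blast+
  have ex1: "\<exists>y. (x, y) \<in> G" for x
    by (rule isometric_graph_total[OF G iso dense(1)])
  define G' where "G' = {p. (snd p, fst p) \<in> G}"
  have "closed G'"
    using closed_vimage[OF G(2), of "\<lambda>p. (snd p, fst p)"]
    by (simp add: G'_def vimage_def continuous_on_Pair continuous_on_fst continuous_on_snd)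
  moreover have "complex_vector.subspace G'"
  proof -
    have "(0, 0) \<in> G" using complex_vector.subspace_0[OF G(1)] by (simp add: zero_prod_def)
    moreover have "(snd (x + y), fst (x + y)) \<in> G" if "(snd x, fst x) \<in> G" "(snd y, fst y) \<in> G"
      for x y :: "'b \<times> 'a"
      using complex_vector.subspace_add[OF G(1) that] by simp
    moreover have "(snd (c *\<^sub>C x), fst (c *\<^sub>C x)) \<in> G" if "(snd x, fst x) \<in> G" for c and x :: "'b \<times> 'a"
      using complex_vector.subspace_scale[OF G(1) that, of c] by (simp add: scaleC_prod_def)
    ultimately show ?thesis by (simp add: complex_vector.subspace_def G'_def)
  qed
  moreover have "fst ` G' = snd ` G" unfolding G'_def by (force simp: image_iff)
  ultimately have "\<exists>x. (y, x) \<in> G'" for y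
    using dense(2) iso by (intro isometric_graph_total) (auto simp: G'_def)
  then have ex2: "\<exists>x. (x, y) \<in> G" for y by (simp add: G'_def)
  obtain U where U: "\<And>x. (x, U x) \<in> G" using ex1 by metis
  have uniq: "U x = y" if "(x, y) \<in> G" for x y
    using iso[OF complex_vector.subspace_diff[OF G(1) that U[of x]]] by simp
  have "unitary U"
    unfolding unitary_def
  proof (intro conjI allI)
    show ci: "cinner (U x) (U y) = cinner x y" for x y using GG[OF U U, of x y] by simp
    show "surj U" unfolding surj_def using ex2 uniq by metis
    show "bounded_clinear U"
    proof (rule bounded_clinear_isometryI)
      show "U (x + y) = U x + U y" for x y
        using complex_vector.subspace_add[OF G(1) U U, of x y] by (intro uniq) simp
      show "U (c *\<^sub>C x) = c *\<^sub>C U x" for c x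
        using complex_vector.subspace_scale[OF G(1) U, of c x]
        by (intro uniq) (simp add: scaleC_prod_def)
      show "norm (U x) = norm x" for x by (simp add: norm_eq_iff_cinner_self ci)
    qed
  qed
  then show ?thesis using that uniq vwG by blast
qed

section \<open>Holomorphic vector-valued functions\<close>

lemma has_cderiv_unique: "has_cderiv f D z \<Longrightarrow> has_cderiv f E z \<Longrightarrow> D = E"
  for f :: "complex \<Rightarrow> 'a::complex_inner"
  unfolding has_cderiv_def using has_derivative_unique[of f _ z "\<lambda>h. h *\<^sub>C E"]
  by (metis scaleC_one)

lemma cderiv_eqI: "has_cderiv f D z \<Longrightarrow> cderiv f z = D"
  for f :: "complex \<Rightarrow> 'a::complex_inner"
  unfolding cderiv_def using has_cderiv_unique by blast

lemma has_cderiv_cderiv: "\<exists>D. has_cderiv f D z \<Longrightarrow> has_cderiv f (cderiv f z) z"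
  for f :: "complex \<Rightarrow> 'a::complex_inner"
  using cderiv_eqI by metis

lemma has_cderiv_transform:
  fixes f :: "complex \<Rightarrow> 'a::complex_inner"
  assumes "has_cderiv f D z" "open X" "z \<in> X" "\<And>w. w \<in> X \<Longrightarrow> f w = g w"
  shows "has_cderiv g D z"
  using assms has_derivative_transform_within_open unfolding has_cderiv_def by blast

lemma has_cderiv_bounded_clinear:
  fixes A :: "'a::complex_inner \<Rightarrow> 'b::complex_inner"
  assumes "bounded_clinear A" "has_cderiv f D z"
  shows "has_cderiv (\<lambda>z. A (f z)) (A D) z"
  using bounded_linear.has_derivative[OF bounded_clinearD(1)[OF assms(1)] assms(2)[unfolded has_cderiv_def]]
  by (simp add: has_cderiv_def bounded_clinearD(6)[OF assms(1)])

lemma has_cderiv_scaleC: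
  fixes f :: "complex \<Rightarrow> 'a::complex_inner"
  assumes "(c has_field_derivative c') (at z)" "has_cderiv f D z"
  shows "has_cderiv (\<lambda>z. c z *\<^sub>C f z) (c' *\<^sub>C f z + c z *\<^sub>C D) z"
  using scaleC.FDERIV[OF assms(1)[unfolded has_field_derivative_def] assms(2)[unfolded has_cderiv_def]]
  by (simp add: has_cderiv_def scaleC_add_right scaleC_scaleC algebra_simps)

lemma has_cderiv_chain:
  fixes f :: "complex \<Rightarrow> 'a::complex_inner"
  assumes "has_cderiv f D (g z)" "(g has_field_derivative g') (at z)"
  shows "has_cderiv (\<lambda>z. f (g z)) (g' *\<^sub>C D) z"
  using has_derivative_compose[OF assms(2)[unfolded has_field_derivative_def] assms(1)[unfolded has_cderiv_def]]
  by (simp add: has_cderiv_def scaleC_scaleC mult.commute)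

lemma has_cderiv_isCont: "has_cderiv f D z \<Longrightarrow> isCont f z"
  for f :: "complex \<Rightarrow> 'a::complex_inner"
  unfolding has_cderiv_def by (rule has_derivative_continuous)

lemma has_field_derivative_cinner_left:
  fixes f :: "complex \<Rightarrow> 'a::complex_inner"
  assumes "has_cderiv f D z"
  shows "((\<lambda>z. cinner (f z) x) has_field_derivative cinner D x) (at z)"
  using bounded_linear.has_derivative[OF cinner.bounded_linear_left assms[unfolded has_cderiv_def], of x]
  unfolding has_field_derivative_def cinner_scaleC_left by (simp add: mult_commute_abs)

lemma holomorphic_on_cinner_left:
  fixes f :: "complex \<Rightarrow> 'a::complex_inner"
  assumes "open X" "\<And>z. z \<in> X \<Longrightarrow> \<exists>D. has_cderiv f D z"
  shows "(\<lambda>z. cinner (f z) x) holomorphic_on X"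
  unfolding holomorphic_on_open[OF assms(1)]
  using assms(2) has_field_derivative_cinner_left by blast

text \<open>Cauchy's inequality on the discs of radius \<open>r / 2\<close> around the points of \<open>ball z (r / 2)\<close> bounds the
  third derivative in the Taylor remainder.\<close>

lemma scalar_second_order_bound:
  fixes g :: "complex \<Rightarrow> complex"
  assumes r: "0 < r" and hol: "g holomorphic_on ball z r" and bound: "\<And>w. w \<in> ball z r \<Longrightarrow> cmod (g w) \<le> M"
    and h: "cmod h < r / 2"
  shows "cmod (deriv g (z + h) - deriv g z - h * deriv (deriv g) z) \<le> 6 * M / (r / 2) ^ 3 * (cmod h)\<^sup>2"
proof -
  let ?B = "6 * M / (r / 2) ^ 3"
  have third: "cmod ((deriv ^^ 3) g w) \<le> ?B" if "w \<in> ball z (r / 2)" for w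
  proof -
    have sub: "cball w (r / 2) \<subseteq> ball z r"
    proof
      fix u assume "u \<in> cball w (r / 2)"
      then show "u \<in> ball z r" using that dist_triangle[of z u w] by simp
    qed
    have "cmod ((deriv ^^ 3) g w) \<le> fact 3 * M / (r / 2) ^ 3"
    proof (rule Cauchy_inequality)
      show "g holomorphic_on ball w (r / 2)"
        using hol sub ball_subset_cball holomorphic_on_subset by blast
      show "continuous_on (cball w (r / 2)) g"
        using hol sub holomorphic_on_subset holomorphic_on_imp_continuous_on by blast
      show "cmod (g u) \<le> M" if "norm (w - u) = r / 2" for u
        using sub that by (intro bound) (auto simp: dist_norm)
    qed (use r in auto)
    then show ?thesis by (simp add: fact_numeral)
  qed
  have "cmod ((deriv ^^ Suc 0) g (z + h) - (\<Sum>i\<le>1. (deriv ^^ Suc i) g z * (z + h - z) ^ i / fact i))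
      \<le> ?B * cmod (z + h - z) ^ Suc 1 / fact 1"
  proof (rule complex_Taylor[where S = "ball z (r / 2)" and f = "\<lambda>i. (deriv ^^ Suc i) g" and n = 1])
    show "((deriv ^^ Suc i) g has_field_derivative (deriv ^^ Suc (Suc i)) g w) (at w within ball z (r / 2))"
      if "w \<in> ball z (r / 2)" for i w
    proof -
      have "(deriv ^^ Suc i) g holomorphic_on ball z r"
        by (rule holomorphic_higher_deriv[OF hol]) simp
      then have "((deriv ^^ Suc i) g has_field_derivative deriv ((deriv ^^ Suc i) g) w) (at w)"
        by (rule holomorphic_derivI) (use that r in auto)
      then show ?thesis by (simp add: has_field_derivative_at_within)
    qed
    show "cmod ((deriv ^^ Suc (Suc 1)) g w) \<le> ?B" if "w \<in> ball z (r / 2)" for w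
      using third[OF that] by (simp add: numeral_eq_Suc)
  qed (use r h in \<open>auto simp: dist_norm\<close>)
  then show ?thesis by (simp add: numeral_eq_Suc algebra_simps)
qed

text \<open>
  Tested against a vector, the difference quotients of the derivative satisfy a second-order Taylor
  estimate whose constant is proportional to the norm of the vector. Testing with the difference of
  two quotients makes them a Cauchy family in norm, and completeness provides the second derivative.
\<close>

lemma cderiv_differentiable:
  fixes f :: "complex \<Rightarrow> 'a::{complex_inner, complete_space}"
  assumes X: "open X" and f: "\<And>z. z \<in> X \<Longrightarrow> \<exists>D. has_cderiv f D z" and z: "z \<in> X"
  shows "\<exists>D. has_cderiv (cderiv f) D z"
proof -
  obtain r where r: "0 < r" "cball z r \<subseteq> X" using X z open_contains_cball by blast
  have "continuous_on (cball z r) f"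
    using f r(2) has_cderiv_isCont by (meson continuous_at_imp_continuous_on subsetD)
  then have "bounded (f ` cball z r)"
    by (intro compact_imp_bounded compact_continuous_image) auto
  then obtain M where M: "\<And>w. w \<in> cball z r \<Longrightarrow> norm (f w) \<le> M"
    unfolding bounded_iff by blast
  define B where "B = 6 * M / (r / 2) ^ 3"
  define q where "q h = (1 / h) *\<^sub>C (cderiv f (z + h) - cderiv f z)" for h
  have deriv_g: "deriv (\<lambda>w. cinner (f w) x) w = cinner (cderiv f w) x" if "w \<in> ball z r" for x w
    using that r(2) by (intro DERIV_imp_deriv has_field_derivative_cinner_left has_cderiv_cderiv f) auto
  have weak: "cmod (cinner (q h) x - deriv (deriv (\<lambda>w. cinner (f w) x)) z) \<le> B * norm x * cmod h"
    if h: "h \<noteq> 0" "cmod h < r / 2" for h x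
  proof -
    let ?g = "\<lambda>w. cinner (f w) x"
    have "cmod (deriv ?g (z + h) - deriv ?g z - h * deriv (deriv ?g) z)
        \<le> 6 * (M * norm x) / (r / 2) ^ 3 * (cmod h)\<^sup>2"
    proof (rule scalar_second_order_bound[OF r(1) _ _ h(2)])
      show "?g holomorphic_on ball z r"
        by (rule holomorphic_on_cinner_left[OF open_ball])
          (use r(2) f ball_subset_cball in blast)
      show "cmod (?g w) \<le> M * norm x" if "w \<in> ball z r" for w
        using norm_cinner_le[of "f w" x] M[of w] that mult_right_mono[of "norm (f w)" M "norm x"] by force
    qed
    also have "deriv ?g (z + h) - deriv ?g z - h * deriv (deriv ?g) z
        = h * (cinner (q h) x - deriv (deriv ?g) z)"
    proof -
      have "z + h \<in> ball z r" using h r(1) by (simp add: dist_norm)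
      then show ?thesis using r(1) h by (simp add: deriv_g q_def cinner_simps algebra_simps)
    qed
    also have "cmod \<dots> = cmod (cinner (q h) x - deriv (deriv ?g) z) * cmod h"
      by (simp add: norm_mult)
    finally have "cmod (cinner (q h) x - deriv (deriv ?g) z) * cmod h \<le> (B * norm x * cmod h) * cmod h"
      by (simp add: B_def power2_eq_square algebra_simps)
    then show ?thesis using h(1) by (simp add: mult_le_cancel_right)
  qed
  have qq: "norm (q h - q k) \<le> B * (cmod h + cmod k)"
    if h: "h \<noteq> 0" "cmod h < r / 2" and k: "k \<noteq> 0" "cmod k < r / 2" for h k
  proof (cases "q h = q k")
    case True
    have "0 \<le> M" using M[of z] norm_ge_zero[of "f z"] r(1) by (meson centre_in_cball less_imp_le order_trans)
    then show ?thesis using True r(1) by (simp add: B_def)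
  next
    case False
    let ?x = "q h - q k"
    have "cinner ?x ?x = (cinner (q h) ?x - deriv (deriv (\<lambda>w. cinner (f w) ?x)) z)
        - (cinner (q k) ?x - deriv (deriv (\<lambda>w. cinner (f w) ?x)) z)"
      by (simp add: cinner_diff_left)
    then have "cmod (cinner ?x ?x) \<le> cmod (cinner (q h) ?x - deriv (deriv (\<lambda>w. cinner (f w) ?x)) z)
        + cmod (cinner (q k) ?x - deriv (deriv (\<lambda>w. cinner (f w) ?x)) z)"
      using norm_triangle_ineq4 by (rule ord_eq_le_trans[OF arg_cong[where f = cmod]])
    also have "\<dots> \<le> B * norm ?x * cmod h + B * norm ?x * cmod k"
      by (intro add_mono weak h k)
    also have "cmod (cinner ?x ?x) = norm ?x * norm ?x"
      unfolding cinner_self norm_of_real by (simp add: power2_eq_square)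
    finally have "norm ?x * norm ?x \<le> (B * (cmod h + cmod k)) * norm ?x"
      by (simp add: algebra_simps)
    then show ?thesis using False by (simp add: mult_le_cancel_right)
  qed
  \<comment> \<open>a null sequence of nonzero increments of modulus less than \<open>r / 2\<close>\<close>
  define k where "k n = complex_of_real (r / real (n + 3))" for n
  have cmod_k: "cmod (k n) = r / real (n + 3)" for n
    using r(1) unfolding k_def norm_of_real by simp
  have k0: "k n \<noteq> 0" for n
    using r(1) cmod_k[of n] by auto
  have kr: "cmod (k n) < r / 2" for n
    unfolding cmod_k by (rule divide_strict_left_mono) (use r(1) in auto)
  have klim: "(\<lambda>n. cmod (k n)) \<longlonglongrightarrow> 0"
    unfolding cmod_k by (rule LIMSEQ_ignore_initial_segment[OF lim_const_over_n])
  have "Cauchy (\<lambda>n. q (k n))"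
  proof (rule CauchyI)
    fix e :: real assume "0 < e"
    have "(\<lambda>n. B * (cmod (k n) + 0)) \<longlonglongrightarrow> B * (0 + 0)"
      by (intro tendsto_intros klim)
    then have "\<forall>\<^sub>F n in sequentially. B * cmod (k n) < e / 2"
      using order_tendstoD(2)[of _ 0 sequentially "e / 2"] \<open>0 < e\<close> by simp
    then obtain N where N: "\<And>n. n \<ge> N \<Longrightarrow> B * cmod (k n) < e / 2"
      unfolding eventually_sequentially by blast
    have "norm (q (k m) - q (k n)) < e" if "N \<le> m" "N \<le> n" for m n
      using qq[OF k0 kr k0 kr, of m n] N[OF that(1)] N[OF that(2)] by (simp add: distrib_left)
    then show "\<exists>N. \<forall>m\<ge>N. \<forall>n\<ge>N. norm (q (k m) - q (k n)) < e" by blast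
  qed
  then obtain D where D: "(\<lambda>n. q (k n)) \<longlonglongrightarrow> D" using Cauchy_convergent_iff convergent_def by blast
  have qD: "norm (q h - D) \<le> B * cmod h" if h: "h \<noteq> 0" "cmod h < r / 2" for h
  proof (rule LIMSEQ_le)
    show "(\<lambda>n. norm (q h - q (k n))) \<longlonglongrightarrow> norm (q h - D)" by (intro tendsto_intros D)
    have "(\<lambda>n. B * (cmod h + cmod (k n))) \<longlonglongrightarrow> B * (cmod h + 0)" by (intro tendsto_intros klim)
    then show "(\<lambda>n. B * (cmod h + cmod (k n))) \<longlonglongrightarrow> B * cmod h" by simp
    show "\<exists>N. \<forall>n\<ge>N. norm (q h - q (k n)) \<le> B * (cmod h + cmod (k n))" using qq[OF h k0 kr] by blast
  qed
  have "has_cderiv (cderiv f) D z"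
    unfolding has_cderiv_def has_derivative_at
  proof (intro conjI scaleC.bounded_linear_left)
    show "(\<lambda>h. norm (cderiv f (z + h) - cderiv f z - h *\<^sub>C D) / norm h) \<midarrow>0\<rightarrow> 0"
    proof (rule Lim_transform_bound)
      show "((\<lambda>h. B * norm h) \<longlongrightarrow> 0) (at 0)" by (auto intro!: tendsto_eq_intros)
      have "norm (norm (cderiv f (z + h) - cderiv f z - h *\<^sub>C D) / norm h) \<le> norm (B * norm h)"
        if "h \<noteq> 0" "dist h 0 < r / 2" for h
      proof -
        have "cderiv f (z + h) - cderiv f z - h *\<^sub>C D = h *\<^sub>C (q h - D)"
          using that by (simp add: q_def complex_vector.scale_right_diff_distrib scaleC_scaleC)
        then show ?thesis using qD[of h] that by (simp add: norm_scaleC)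
      qed
      then show "\<forall>\<^sub>F h in at 0. norm (norm (cderiv f (z + h) - cderiv f z - h *\<^sub>C D) / norm h)
          \<le> norm (B * norm h)"
        unfolding eventually_at using r(1) by (intro exI[of _ "r / 2"]) auto
    qed
  qed
  then show ?thesis ..
qed

text \<open>Near a point \<open>a\<close> the coefficient is the quotient of the inner products of \<open>p\<close> and of \<open>s\<close> with
  \<open>s a\<close>.\<close>

lemma holomorphic_coefficient:
  fixes p s :: "complex \<Rightarrow> 'a::complex_inner"
  assumes X: "open X" and p: "\<And>z. z \<in> X \<Longrightarrow> \<exists>D. has_cderiv p D z"
    and s: "\<And>z. z \<in> X \<Longrightarrow> \<exists>D. has_cderiv s D z" "\<And>z. z \<in> X \<Longrightarrow> s z \<noteq> 0"
    and ps: "\<And>z. z \<in> X \<Longrightarrow> p z = c z *\<^sub>C s z"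
  shows "c holomorphic_on X"
  unfolding holomorphic_on_open[OF X]
proof
  fix a assume a: "a \<in> X"
  let ?n = "\<lambda>z. cinner (p z) (s a)" and ?d = "\<lambda>z. cinner (s z) (s a)"
  have n: "(?n has_field_derivative cinner (cderiv p a) (s a)) (at a)"
    and d: "(?d has_field_derivative cinner (cderiv s a) (s a)) (at a)"
    by (intro has_field_derivative_cinner_left has_cderiv_cderiv p s a)+
  have da: "?d a \<noteq> 0" using s(2)[OF a] by simp
  have "isCont ?d a" using d DERIV_isCont by blast
  then have "\<forall>\<^sub>F z in nhds a. ?d z \<noteq> 0"
    using da tendsto_imp_eventually_ne[OF isContD[OF \<open>isCont ?d a\<close>] da]
    unfolding eventually_nhds_conv_at by blast
  moreover have "\<forall>\<^sub>F z in nhds a. z \<in> X" using X a eventually_nhds_in_open by blast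
  ultimately have ev: "\<forall>\<^sub>F z in nhds a. ?n z / ?d z = c z"
    by eventually_elim (simp add: ps cinner_simps)
  have "\<exists>e. ((\<lambda>z. ?n z / ?d z) has_field_derivative e) (at a)"
    using DERIV_divide[OF n d da] by blast
  then show "\<exists>e. (c has_field_derivative e) (at a)"
    using DERIV_cong_ev[OF refl ev refl] by blast
qed

section \<open>Wirtinger derivatives of inner products\<close>

lemma wirtinger_eqI:
  assumes "(f has_derivative (\<lambda>h. a * h + b * cnj h)) (at z)"
  shows "wirtinger f z = a" "wirtinger_bar f z = b"
proof -
  have "frechet_derivative f (at z) = (\<lambda>h. a * h + b * cnj h)"
    using frechet_derivative_at[OF assms] by simp
  then show "wirtinger f z = a" "wirtinger_bar f z = b"
    by (simp_all add: wirtinger_def wirtinger_bar_def algebra_simps)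
qed

lemma has_derivative_cinner_holomorphic:
  fixes p q :: "complex \<Rightarrow> 'a::complex_inner"
  assumes "has_cderiv p P z" "has_cderiv q Q z"
  shows "((\<lambda>z. cinner (p z) (q z)) has_derivative (\<lambda>h. cinner P (q z) * h + cinner (p z) Q * cnj h)) (at z)"
  using cinner.FDERIV[OF assms[unfolded has_cderiv_def]]
  by (simp add: cinner_simps algebra_simps)

lemma has_derivative_ln_normsq:
  fixes p :: "complex \<Rightarrow> 'a::complex_inner"
  assumes "has_cderiv p P z" "p z \<noteq> 0"
  shows "((\<lambda>z. ln ((norm (p z))\<^sup>2)) has_derivative (\<lambda>h. 2 * Re (cinner P (p z) / cinner (p z) (p z) * h))) (at z)"
proof -
  have "((\<lambda>z. inner (p z) (p z)) has_derivative (\<lambda>h. 2 * inner (h *\<^sub>C P) (p z))) (at z)"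
    by (rule has_derivative_eq_rhs[OF has_derivative_inner[OF assms(1,1)[unfolded has_cderiv_def]]])
      (simp add: fun_eq_iff inner_commute)
  then have "((\<lambda>z. ln ((norm (p z))\<^sup>2)) has_derivative
      (\<lambda>h. 2 * inner (h *\<^sub>C P) (p z) * inverse ((norm (p z))\<^sup>2))) (at z)"
    unfolding power2_norm_eq_inner using assms(2) by (intro has_derivative_ln) auto
  moreover have "2 * inner (h *\<^sub>C P) (p z) * inverse ((norm (p z))\<^sup>2)
      = 2 * Re (cinner P (p z) / cinner (p z) (p z) * h)" for h
  proof -
    have "cinner P (p z) / cinner (p z) (p z) * h = cinner (h *\<^sub>C P) (p z) / complex_of_real ((norm (p z))\<^sup>2)"
      unfolding cinner_self by (simp add: cinner_simps)
    then show ?thesis by (simp only: Re_divide_of_real Re_cinner) (simp add: divide_inverse)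
  qed
  ultimately show ?thesis by simp
qed

definition gram_det :: "'a::complex_inner \<Rightarrow> 'a \<Rightarrow> complex"
  where "gram_det x y = cinner x x * cinner y y - cinner x y * cinner y x"

text \<open>The curvature \<open>- \<Delta> ln \<parallel>t\<parallel>\<^sup>2 / 4\<close> of the bundle spanned by a holomorphic section \<open>t\<close>, in a form free
  of second derivatives, whose invariance under unitaries and rescaling is elementary.\<close>

definition log_curvature :: "(complex \<Rightarrow> 'a::complex_inner) \<Rightarrow> complex \<Rightarrow> complex"
  where "log_curvature t z = - gram_det (t z) (cderiv t z) / (cinner (t z) (t z))\<^sup>2"

lemma gram_det_nonzero:
  assumes "cindependent_pair x y"
  shows "gram_det x y \<noteq> 0"
proof
  assume G: "gram_det x y = 0"
  define u where "u = cinner x x *\<^sub>C y - cinner y x *\<^sub>C x"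
  have "cinner u u = cnj (cinner x x) * gram_det x y"
    using cinner_commute[of x y] cinner_commute[of y x]
    by (simp add: u_def gram_det_def cinner_simps algebra_simps)
  then have "u = 0" using G by simp
  then have "(- cinner y x) *\<^sub>C x + cinner x x *\<^sub>C y = 0" by (simp add: u_def)
  then have "x = 0" using assms unfolding cindependent_pair_def by (metis cinner_self_eq_0_iff)
  then have "1 *\<^sub>C x + 0 *\<^sub>C y = 0" by simp
  then show False using assms unfolding cindependent_pair_def by (metis zero_neq_one)
qed

lemma gram_det_scale: "gram_det (c *\<^sub>C x) (d *\<^sub>C x + c *\<^sub>C y) = (c * cnj c)\<^sup>2 * gram_det x y"
  by (simp add: gram_det_def cinner_simps power2_eq_square algebra_simps)

lemma gram_det_unitary:
  "unitary U \<Longrightarrow> gram_det (U x) (U y) = gram_det x y"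
  by (simp add: gram_det_def unitary_cinner)

lemma
  fixes t :: "complex \<Rightarrow> 'a::{complex_inner, complete_space}"
  assumes X: "open X" and t: "\<And>z. z \<in> X \<Longrightarrow> \<exists>D. has_cderiv t D z" and z: "z \<in> X"
  shows wirtinger_normsq: "wirtinger (normsq t) z = cinner (cderiv t z) (t z)"
    and wirtinger_bar_normsq: "wirtinger_bar (normsq t) z = cinner (t z) (cderiv t z)"
    and wirtinger_wirtinger_bar_normsq:
      "wirtinger (wirtinger_bar (normsq t)) z = cinner (cderiv t z) (cderiv t z)"
    and wirtinger_wirtinger_bar_ln:
      "t z \<noteq> 0 \<Longrightarrow> wirtinger (wirtinger_bar (\<lambda>z. complex_of_real (ln ((norm (t z))\<^sup>2)))) z
        = - log_curvature t z"
proof -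
  have nsq: "normsq t = (\<lambda>z. cinner (t z) (t z))" by (simp add: fun_eq_iff normsq_def cinner_self)
  note dt = has_cderiv_cderiv[OF t]
  have dt2: "has_cderiv (cderiv t) (cderiv (cderiv t) w) w" if "w \<in> X" for w
    using that by (intro has_cderiv_cderiv cderiv_differentiable[OF X t])
  have d: "(normsq t has_derivative
      (\<lambda>h. cinner (cderiv t w) (t w) * h + cinner (t w) (cderiv t w) * cnj h)) (at w)" if "w \<in> X" for w
    unfolding nsq by (rule has_derivative_cinner_holomorphic[OF dt[OF that] dt[OF that]])
  show "wirtinger (normsq t) z = cinner (cderiv t z) (t z)" by (rule wirtinger_eqI[OF d[OF z]])
  have bar: "wirtinger_bar (normsq t) w = cinner (t w) (cderiv t w)" if "w \<in> X" for w
    by (rule wirtinger_eqI[OF d[OF that]])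
  then show "wirtinger_bar (normsq t) z = cinner (t z) (cderiv t z)" using z .
  note dtt' = has_derivative_cinner_holomorphic[OF dt[OF z] dt2[OF z]]
  show "wirtinger (wirtinger_bar (normsq t)) z = cinner (cderiv t z) (cderiv t z)"
    by (rule wirtinger_eqI[OF has_derivative_transform_within_open[OF dtt' X z]]) (simp add: bar)
  assume tz: "t z \<noteq> 0"
  define Y where "Y = X \<inter> t -` (- {0})"
  have Y: "open Y" 
    unfolding Y_def using t has_cderiv_isCont X
    by (intro continuous_open_preimage continuous_at_imp_continuous_on) blast+
  have zY: "z \<in> Y" using z tz by (simp add: Y_def)
  let ?L = "\<lambda>z. complex_of_real (ln ((norm (t z))\<^sup>2))"
  have Lbar: "wirtinger_bar ?L w = cinner (t w) (cderiv t w) / cinner (t w) (t w)" if w: "w \<in> Y" for w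
  proof -
    let ?a = "cinner (cderiv t w) (t w)" and ?b = "cinner (t w) (cderiv t w)"
    have wX: "w \<in> X" and nz: "t w \<noteq> 0" using w by (simp_all add: Y_def)
    have "(?L has_derivative
        (\<lambda>h. complex_of_real (2 * Re (?a / cinner (t w) (t w) * h)))) (at w)"
      by (rule bounded_linear.has_derivative[OF bounded_linear_of_real has_derivative_ln_normsq[OF dt[OF wX] nz]])
    moreover have "complex_of_real (2 * Re (?a / cinner (t w) (t w) * h))
        = ?a / cinner (t w) (t w) * h + ?b / cinner (t w) (t w) * cnj h" for h
    proof -
      have "?b / cinner (t w) (t w) * cnj h = cnj (?a / cinner (t w) (t w) * h)"
        by (simp add: cinner_commute[symmetric])
      then show ?thesis by (simp only: complex_add_cnj)
    qed
    ultimately have "(?L has_derivative (\<lambda>h. ?a / cinner (t w) (t w) * h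
        + ?b / cinner (t w) (t w) * cnj h)) (at w)" by simp
    then show ?thesis by (rule wirtinger_eqI)
  qed
  let ?N = "cinner (t z) (t z)"
  have N: "?N \<noteq> 0" using tz by simp
  have "((\<lambda>w. cinner (t w) (cderiv t w) / cinner (t w) (t w)) has_derivative
     (\<lambda>h. - log_curvature t z * h
        + (cinner (t z) (cderiv (cderiv t) z) * ?N - (cinner (t z) (cderiv t z))\<^sup>2) / ?N\<^sup>2 * cnj h)) (at z)"
    by (rule has_derivative_eq_rhs[OF has_derivative_divide'[OF dtt' d[OF z, unfolded nsq] N]])
      (use N in \<open>simp add: fun_eq_iff log_curvature_def gram_det_def field_simps power2_eq_square\<close>)
  then have "(wirtinger_bar ?L has_derivative (\<lambda>h. - log_curvature t z * h
        + (cinner (t z) (cderiv (cderiv t) z) * ?N - (cinner (t z) (cderiv t z))\<^sup>2) / ?N\<^sup>2 * cnj h)) (at z)"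
    by (rule has_derivative_transform_within_open[OF _ Y zY]) (simp add: Lbar)
  then show "wirtinger (wirtinger_bar ?L) z = - log_curvature t z" by (rule wirtinger_eqI(1))
qed

section \<open>Line bundles of eigenvectors\<close>

lemma
  fixes A B :: "'a::complex_inner \<Rightarrow> 'b::complex_inner"
  assumes "bounded_clinear A" "bounded_clinear B"
  shows subspace_equalizer: "complex_vector.subspace {x. A x = B x}"
    and closed_equalizer: "closed {x. A x = B x}"
proof -
  show "complex_vector.subspace {x. A x = B x}"
    by (simp add: complex_vector.subspace_def bounded_clinearD[OF assms(1)] bounded_clinearD[OF assms(2)])
  show "closed {x. A x = B x}"
    using assms by (intro closed_Collect_eq)
      (auto simp: bounded_clinear_def linear_continuous_on)
qed

lemma log_curvature_scale:
  fixes s :: "complex \<Rightarrow> 'a::complex_inner"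
  assumes X: "open X" "z \<in> X" and c: "c holomorphic_on X" "c z \<noteq> 0" and s: "\<exists>D. has_cderiv s D z"
    and p: "\<And>w. w \<in> X \<Longrightarrow> p w = c w *\<^sub>C s w"
  shows "log_curvature p z = log_curvature s z"
proof -
  have "has_cderiv (\<lambda>w. c w *\<^sub>C s w) (deriv c z *\<^sub>C s z + c z *\<^sub>C cderiv s z) z"
    by (rule has_cderiv_scaleC[OF holomorphic_derivI[OF c(1) X] has_cderiv_cderiv[OF s]])
  then have "has_cderiv p (deriv c z *\<^sub>C s z + c z *\<^sub>C cderiv s z) z"
    by (rule has_cderiv_transform[OF _ X]) (simp add: p)
  then have "cderiv p z = deriv c z *\<^sub>C s z + c z *\<^sub>C cderiv s z" by (rule cderiv_eqI)
  moreover have "cinner (c z *\<^sub>C s z) (c z *\<^sub>C s z) = (c z * cnj (c z)) * cinner (s z) (s z)"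
    by (simp add: cinner_simps)
  ultimately show ?thesis
    using c(2) unfolding log_curvature_def p[OF X(2)] by (simp only: gram_det_scale power_mult_distrib) simp
qed

locale eigen_line_bundle =
  fixes \<Omega> :: "complex set" and T :: "'a::separable_chilbert_space \<Rightarrow> 'a" and t :: "complex \<Rightarrow> 'a"
  assumes domain: "open \<Omega>" "connected \<Omega>" "\<Omega> \<noteq> {}"
    and cowen_douglas: "T \<in> cowen_douglas 1 \<Omega>"
    and nonvanishing: "nonvanishing_section \<Omega> T t"
begin

lemma clinear: "bounded_clinear T"
  using cowen_douglas by (simp add: cowen_douglas_def)

lemma holo: "\<mu> \<in> \<Omega> \<Longrightarrow> \<exists>D. has_cderiv t D \<mu>"
  and nonzero: "\<mu> \<in> \<Omega> \<Longrightarrow> t \<mu> \<noteq> 0"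
  and eigen: "\<mu> \<in> \<Omega> \<Longrightarrow> T (t \<mu>) = \<mu> *\<^sub>C t \<mu>"
  using nonvanishing by (auto simp: nonvanishing_section_def eigenspace_def)

lemmas deriv_section = has_cderiv_cderiv[OF holo]

lemma eigenvector_multiple:
  assumes \<mu>: "\<mu> \<in> \<Omega>" and x: "T x = \<mu> *\<^sub>C x"
  shows "\<exists>c. x = c *\<^sub>C t \<mu>"
proof -
  obtain B where B: "eigenspace T \<mu> \<subseteq> complex_vector.span B" "card B = complex_vector.dim (eigenspace T \<mu>)"
    using complex_vector.basis_exists by metis
  moreover have "complex_vector.dim (eigenspace T \<mu>) = 1"
    using cowen_douglas \<mu> by (simp add: cowen_douglas_def)
  ultimately obtain b where b: "B = {b}" by (metis card_1_singletonE)
  have "x \<in> complex_vector.span {b}" "t \<mu> \<in> complex_vector.span {b}"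
    using B(1) x eigen[OF \<mu>] by (auto simp: b eigenspace_def)
  then obtain k l where kl: "x = k *\<^sub>C b" "t \<mu> = l *\<^sub>C b"
    unfolding complex_vector.span_singleton by blast
  then have "x = (k / l) *\<^sub>C t \<mu>" using nonzero[OF \<mu>] by (auto simp: scaleC_scaleC)
  then show ?thesis by blast
qed

text \<open>The generalised eigenvector equation obtained by differentiating \<open>(T - \<mu>) t(\<mu>) = 0\<close>.\<close>

lemma deriv_eigen:
  assumes \<mu>: "\<mu> \<in> \<Omega>"
  shows "T (cderiv t \<mu>) = \<mu> *\<^sub>C cderiv t \<mu> + t \<mu>"
proof -
  have "has_cderiv (\<lambda>z. T (t z)) (T (cderiv t \<mu>)) \<mu>"
    by (rule has_cderiv_bounded_clinear[OF clinear deriv_section[OF \<mu>]])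
  moreover have "has_cderiv (\<lambda>z. z *\<^sub>C t z) (1 *\<^sub>C t \<mu> + \<mu> *\<^sub>C cderiv t \<mu>) \<mu>"
    by (rule has_cderiv_scaleC[OF DERIV_ident deriv_section[OF \<mu>]])
  then have "has_cderiv (\<lambda>z. T (t z)) (1 *\<^sub>C t \<mu> + \<mu> *\<^sub>C cderiv t \<mu>) \<mu>"
    by (rule has_cderiv_transform[OF _ domain(1) \<mu>]) (simp add: eigen)
  ultimately show ?thesis using has_cderiv_unique by fastforce
qed

lemma total:
  assumes M: "complex_vector.subspace M" "closed M" and t: "\<And>\<mu>. \<mu> \<in> \<Omega> \<Longrightarrow> t \<mu> \<in> M"
  shows "M = UNIV"
proof -
  have "eigenspace T \<mu> \<subseteq> M" if "\<mu> \<in> \<Omega>" for \<mu>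
  proof
    fix x assume "x \<in> eigenspace T \<mu>"
    then obtain c where "x = c *\<^sub>C t \<mu>"
      using eigenvector_multiple[OF \<open>\<mu> \<in> \<Omega>\<close>] by (auto simp: eigenspace_def)
    then show "x \<in> M" using t[OF that] M(1) complex_vector.subspace_scale by blast
  qed
  then have "complex_vector.span (\<Union>\<mu>\<in>\<Omega>. eigenspace T \<mu>) \<subseteq> M"
    by (intro complex_vector.span_minimal M) blast
  then have "closure (complex_vector.span (\<Union>\<mu>\<in>\<Omega>. eigenspace T \<mu>)) \<subseteq> M"
    by (rule closure_minimal[OF _ M(2)])
  then show ?thesis using cowen_douglas by (auto simp: cowen_douglas_def)
qed

text \<open>A vector orthogonal to the eigenvectors for the points of a nonempty open set is orthogonal to all
  eigenvectors, by the identity theorem.\<close>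

lemma total_open:
  assumes V: "open V" "V \<noteq> {}" "V \<subseteq> \<Omega>"
    and M: "complex_vector.subspace M" "closed M" and t: "\<And>\<mu>. \<mu> \<in> V \<Longrightarrow> t \<mu> \<in> M"
  shows "M = UNIV"
proof (rule closed_subspace_eq_UNIV[OF M])
  fix x assume x: "\<And>z. z \<in> M \<Longrightarrow> cinner z x = 0"
  have "cinner (t \<mu>) x = 0" if "\<mu> \<in> \<Omega>" for \<mu>
    by (rule analytic_continuation_open[OF V(1) domain(1) V(2) domain(2) V(3) _ _ _ that, of "\<lambda>\<mu>. cinner (t \<mu>) x" "\<lambda>_. 0"])
      (use x t holo in \<open>auto intro!: holomorphic_on_cinner_left domain\<close>)
  then have "{v. cinner v x = 0} = UNIV"
    by (intro total closed_orthogonal subspace_orthogonal) simp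
  then have "cinner x x = 0" by blast
  then show "x = 0" by simp
qed

lemma eq_if_eq_on_sections:
  fixes A B :: "'a \<Rightarrow> 'b::complex_inner"
  assumes "bounded_clinear A" "bounded_clinear B" "\<And>\<mu>. \<mu> \<in> \<Omega> \<Longrightarrow> A (t \<mu>) = B (t \<mu>)"
  shows "A = B"
  using total[OF subspace_equalizer closed_equalizer, OF assms(1,2,1,2)] assms(3)
  by (auto simp: fun_eq_iff)

text \<open>The curvature may be computed with any section: two sections differ by a nonvanishing
  holomorphic factor.\<close>

lemma curvature_eq:
  assumes \<mu>: "\<mu> \<in> \<Omega>"
  shows "curvature \<Omega> T \<mu> = log_curvature t \<mu>"
proof -
  define \<gamma> where "\<gamma> = (SOME \<gamma>. nonvanishing_section \<Omega> T \<gamma>)"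
  have "nonvanishing_section \<Omega> T \<gamma>"
    unfolding \<gamma>_def using nonvanishing by (rule someI[of "nonvanishing_section \<Omega> T"])
  then interpret \<gamma>: eigen_line_bundle \<Omega> T \<gamma>
    using domain cowen_douglas by unfold_locales
  have "\<forall>z\<in>\<Omega>. \<exists>c. \<gamma> z = c *\<^sub>C t z" using eigenvector_multiple \<gamma>.eigen by blast
  then obtain c where c: "\<And>z. z \<in> \<Omega> \<Longrightarrow> \<gamma> z = c z *\<^sub>C t z" by metis
  have "c \<mu> \<noteq> 0" using \<gamma>.nonzero[OF \<mu>] c[OF \<mu>] by auto
  then have "log_curvature \<gamma> \<mu> = log_curvature t \<mu>"
    by (intro log_curvature_scale[OF domain(1) \<mu> _ _ holo[OF \<mu>] c]
        holomorphic_coefficient[OF domain(1) \<gamma>.holo holo nonzero c])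
  then show ?thesis
    unfolding curvature_def \<gamma>_def[symmetric] Let_def
    by (subst wirtinger_wirtinger_bar_ln[OF domain(1) \<gamma>.holo \<mu> \<gamma>.nonzero[OF \<mu>]]) auto
qed

end

lemma log_curvature_unitary:
  fixes t :: "complex \<Rightarrow> 'a::complex_inner"
  assumes U: "unitary U" and t: "\<exists>D. has_cderiv t D z"
  shows "log_curvature (\<lambda>z. U (t z)) z = log_curvature t z"
proof -
  have "cderiv (\<lambda>z. U (t z)) z = U (cderiv t z)"
    by (rule cderiv_eqI, rule has_cderiv_bounded_clinear[OF unitary_bounded_clinear[OF U] has_cderiv_cderiv[OF t]])
  then show ?thesis by (simp add: log_curvature_def gram_det_unitary[OF U] unitary_cinner[OF U])
qed

lemma unitary_intertwiner_section:
  assumes t: "eigen_line_bundle \<Omega> T t" and s: "eigen_line_bundle \<Omega> T' s"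
    and U: "unitary U" and intertwine: "\<And>x. U (T x) = T' (U x)"
  obtains c where "c holomorphic_on \<Omega>" "\<And>\<mu>. \<mu> \<in> \<Omega> \<Longrightarrow> c \<mu> \<noteq> 0" "\<And>\<mu>. \<mu> \<in> \<Omega> \<Longrightarrow> U (t \<mu>) = c \<mu> *\<^sub>C s \<mu>"
proof -
  interpret t: eigen_line_bundle \<Omega> T t by (rule t)
  interpret s: eigen_line_bundle \<Omega> T' s by (rule s)
  note Ul = unitary_bounded_clinear[OF U]
  have "\<forall>\<mu>\<in>\<Omega>. \<exists>c. U (t \<mu>) = c *\<^sub>C s \<mu>"
    using s.eigenvector_multiple by (metis intertwine t.eigen bounded_clinearD(6)[OF Ul])
  then obtain c where c: "\<And>\<mu>. \<mu> \<in> \<Omega> \<Longrightarrow> U (t \<mu>) = c \<mu> *\<^sub>C s \<mu>" by metis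
  have "c holomorphic_on \<Omega>"
    using t.holo has_cderiv_bounded_clinear[OF Ul]
    by (intro holomorphic_coefficient[OF t.domain(1) _ s.holo s.nonzero c]) blast+
  moreover have "c \<mu> \<noteq> 0" if "\<mu> \<in> \<Omega>" for \<mu>
    using c[OF that] t.nonzero[OF that] unitary_norm[OF U, of "t \<mu>"] by auto
  ultimately show ?thesis using c that by blast
qed

lemma curvature_unitary_invariant:
  assumes t: "eigen_line_bundle \<Omega> T t" and s: "eigen_line_bundle \<Omega> T' s"
    and U: "unitary U" and intertwine: "\<And>x. U (T x) = T' (U x)" and \<mu>: "\<mu> \<in> \<Omega>"
  shows "curvature \<Omega> T \<mu> = curvature \<Omega> T' \<mu>"
proof -
  interpret t: eigen_line_bundle \<Omega> T t by (rule t)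
  interpret s: eigen_line_bundle \<Omega> T' s by (rule s)
  obtain c where "c holomorphic_on \<Omega>" "\<And>\<mu>. \<mu> \<in> \<Omega> \<Longrightarrow> c \<mu> \<noteq> 0" "\<And>\<mu>. \<mu> \<in> \<Omega> \<Longrightarrow> U (t \<mu>) = c \<mu> *\<^sub>C s \<mu>"
    using unitary_intertwiner_section[OF t s U intertwine] by blast
  then have "log_curvature (\<lambda>z. U (t z)) \<mu> = log_curvature s \<mu>"
    using \<mu> by (intro log_curvature_scale[OF t.domain(1)] s.holo) auto
  then show ?thesis
    by (simp add: t.curvature_eq[OF \<mu>] s.curvature_eq[OF \<mu>] log_curvature_unitary[OF U t.holo[OF \<mu>]])
qed

section \<open>Equal curvature gives local unitary equivalence\<close>

lemma has_derivative_log_quotient: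
  fixes t :: "complex \<Rightarrow> 'a::{complex_inner, complete_space}"
  assumes X: "open X" and t: "\<And>z. z \<in> X \<Longrightarrow> \<exists>D. has_cderiv t D z" and z: "z \<in> X" and nz: "t z \<noteq> 0"
  shows "\<exists>a. ((\<lambda>z. cinner (cderiv t z) (t z) / cinner (t z) (t z)) has_derivative
    (\<lambda>h. a * h + (- log_curvature t z) * cnj h)) (at z)"
proof
  let ?N = "cinner (t z) (t z)"
  note dt = has_cderiv_cderiv[OF t[OF z]]
  have dt2: "has_cderiv (cderiv t) (cderiv (cderiv t) z) z"
    by (intro has_cderiv_cderiv cderiv_differentiable[OF X t z])
  show "((\<lambda>z. cinner (cderiv t z) (t z) / cinner (t z) (t z)) has_derivative
    (\<lambda>h. (cinner (cderiv (cderiv t) z) (t z) * ?N - (cinner (cderiv t z) (t z))\<^sup>2) / ?N\<^sup>2 * h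
      + (- log_curvature t z) * cnj h)) (at z)"
    by (rule has_derivative_eq_rhs[OF has_derivative_divide'[OF has_derivative_cinner_holomorphic[OF dt2 dt]
        has_derivative_cinner_holomorphic[OF dt dt]]])
      (use nz in \<open>simp_all add: fun_eq_iff log_curvature_def gram_det_def field_simps power2_eq_square\<close>)
qed

text \<open>
  If the curvatures agree then \<open>ln (\<parallel>t\<parallel>\<^sup>2 / \<parallel>s\<parallel>\<^sup>2)\<close> is harmonic, so on a disc it is the real part of a
  holomorphic function: its \<open>\<partial>\<close>-derivative is holomorphic and has a primitive there.
\<close>

lemma local_norm_quotient:
  fixes t :: "complex \<Rightarrow> 'a::{complex_inner, complete_space}"
    and s :: "complex \<Rightarrow> 'b::{complex_inner, complete_space}"
  assumes t: "\<And>z. z \<in> ball a r \<Longrightarrow> \<exists>D. has_cderiv t D z" "\<And>z. z \<in> ball a r \<Longrightarrow> t z \<noteq> 0"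
    and s: "\<And>z. z \<in> ball a r \<Longrightarrow> \<exists>D. has_cderiv s D z" "\<And>z. z \<in> ball a r \<Longrightarrow> s z \<noteq> 0"
    and curv: "\<And>z. z \<in> ball a r \<Longrightarrow> log_curvature t z = log_curvature s z"
  obtains f where "f holomorphic_on ball a r" "\<And>z. f z \<noteq> 0"
    "\<And>z. z \<in> ball a r \<Longrightarrow> norm (t z) = cmod (f z) * norm (s z)"
proof -
  let ?D = "ball a r"
  let ?p = "\<lambda>z. cinner (cderiv t z) (t z) / cinner (t z) (t z)"
  let ?q = "\<lambda>z. cinner (cderiv s z) (s z) / cinner (s z) (s z)"
  have "\<exists>d. ((\<lambda>z. ?p z - ?q z) has_field_derivative d) (at z)" if z: "z \<in> ?D" for z
  proof -
    obtain b c where b: "(?p has_derivative (\<lambda>h. b * h + (- log_curvature t z) * cnj h)) (at z)"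
      and c: "(?q has_derivative (\<lambda>h. c * h + (- log_curvature s z) * cnj h)) (at z)"
      using has_derivative_log_quotient[OF open_ball t(1) z t(2)[OF z]]
        has_derivative_log_quotient[OF open_ball s(1) z s(2)[OF z]] by blast
    have "((\<lambda>z. ?p z - ?q z) has_field_derivative (b - c)) (at z)"
      unfolding has_field_derivative_def
      by (rule has_derivative_eq_rhs[OF has_derivative_diff[OF b c]])
        (simp add: fun_eq_iff curv[OF z] algebra_simps)
    then show ?thesis ..
  qed
  then have "(\<lambda>z. ?p z - ?q z) holomorphic_on ?D" by (simp add: holomorphic_on_open)
  then obtain Q where "\<And>z. z \<in> ?D \<Longrightarrow> (Q has_field_derivative (?p z - ?q z)) (at z within ?D)"
    using holomorphic_convex_primitive'[OF convex_ball open_ball] by blast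
  then have Q: "(Q has_field_derivative (?p z - ?q z)) (at z)" if "z \<in> ?D" for z
    using that by (metis at_within_open open_ball)
  define u where "u z = ln ((norm (t z))\<^sup>2) - ln ((norm (s z))\<^sup>2) - 2 * Re (Q z)" for z
  have "(u has_derivative (\<lambda>h. 0)) (at z within ?D)" if z: "z \<in> ?D" for z
  proof -
    have "((\<lambda>z. Re (Q z)) has_derivative (\<lambda>h. Re ((?p z - ?q z) * h))) (at z)"
      by (rule bounded_linear.has_derivative[OF bounded_linear_Re Q[OF z, unfolded has_field_derivative_def]])
    then have "(u has_derivative (\<lambda>h. 2 * Re (?p z * h) - 2 * Re (?q z * h) - 2 * Re ((?p z - ?q z) * h))) (at z)"
      unfolding u_def by (intro has_derivative_diff has_derivative_mult_right
          has_derivative_ln_normsq has_cderiv_cderiv t[OF z] s[OF z])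
    then have "(u has_derivative (\<lambda>h. 0)) (at z)"
      by (rule has_derivative_eq_rhs) (simp add: fun_eq_iff algebra_simps)
    then show ?thesis by (rule has_derivative_at_withinI)
  qed
  then obtain c where c: "\<And>z. z \<in> ?D \<Longrightarrow> u z = c"
    using has_derivative_zero_constant[OF convex_ball] by blast
  define f where "f z = exp (Q z + complex_of_real (c / 2))" for z
  show ?thesis
  proof
    have "Q holomorphic_on ?D" unfolding holomorphic_on_open[OF open_ball] using Q by blast
    then show "f holomorphic_on ?D" unfolding f_def by (intro holomorphic_intros)
    show "f z \<noteq> 0" for z by (simp add: f_def)
    fix z assume z: "z \<in> ?D"
    have "(cmod (f z))\<^sup>2 = exp (2 * Re (Q z) + c)"
      by (simp add: f_def power2_eq_square exp_add[symmetric])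
    also have "2 * Re (Q z) + c = ln ((norm (t z))\<^sup>2 / (norm (s z))\<^sup>2)"
      using c[OF z] t(2)[OF z] s(2)[OF z] by (simp add: u_def ln_div)
    also have "exp \<dots> = (norm (t z))\<^sup>2 / (norm (s z))\<^sup>2"
      using t(2)[OF z] s(2)[OF z] by simp
    finally have "(norm (t z))\<^sup>2 = (cmod (f z) * norm (s z))\<^sup>2"
      using s(2)[OF z] by (simp add: power_mult_distrib)
    then show "norm (t z) = cmod (f z) * norm (s z)" by simp
  qed
qed

lemma holomorphic_zero_if_zero_on_reals:
  assumes g: "g holomorphic_on ball 0 r" and z: "z \<in> ball 0 r"
    and real: "\<And>x. \<bar>x\<bar> < r \<Longrightarrow> g (complex_of_real x) = 0"
  shows "g z = 0"
proof (rule analytic_continuation[OF g open_ball connected_ball])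
  have r: "0 < r" using z by (metis ball_eq_empty empty_iff not_le)
  let ?U = "complex_of_real ` {-r<..<r}"
  show "?U \<subseteq> ball 0 r" by (auto simp: dist_norm)
  show "0 \<in> ball 0 r" using r by simp
  show "0 islimpt ?U"
    unfolding islimpt_approachable
  proof (intro allI impI)
    fix e :: real assume "0 < e"
    then show "\<exists>x'\<in>?U. x' \<noteq> 0 \<and> dist x' 0 < e"
      using r by (intro bexI[of _ "complex_of_real (min (e / 2) (r / 2))"]) auto
  qed
  show "g x = 0" if "x \<in> ?U" for x using that real by auto
qed (rule z)

lemma has_field_derivative_cinner_cnj:
  fixes p q :: "complex \<Rightarrow> 'a::complex_inner"
  assumes "has_cderiv p P z" "has_cderiv q Q (cnj z)"
  shows "((\<lambda>z. cinner (p z) (q (cnj z))) has_field_derivative (cinner P (q (cnj z)) + cinner (p z) Q)) (at z)"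
proof -
  have "((\<lambda>z. q (cnj z)) has_derivative (\<lambda>h. cnj h *\<^sub>C Q)) (at z)"
    using has_derivative_compose[OF bounded_linear_imp_has_derivative[OF bounded_linear_cnj]
        assms(2)[unfolded has_cderiv_def]] .
  from cinner.FDERIV[OF assms(1)[unfolded has_cderiv_def] this]
  show ?thesis unfolding has_field_derivative_def
    by (rule has_derivative_eq_rhs) (simp add: fun_eq_iff cinner_simps algebra_simps)
qed

lemma holomorphic_on_cinner_affine:
  fixes p :: "complex \<Rightarrow> 'a::complex_inner"
  assumes "open X"
    and p: "\<And>z. z \<in> X \<Longrightarrow> \<exists>D. has_cderiv p D (u + c * z)"
    and q: "\<And>z. z \<in> X \<Longrightarrow> \<exists>D. has_cderiv p D (v + d * cnj z)"
  shows "(\<lambda>z. cinner (p (u + c * z)) (p (v + d * cnj z))) holomorphic_on X"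
  unfolding holomorphic_on_open[OF \<open>open X\<close>]
proof
  fix z assume z: "z \<in> X"
  have affine: "((\<lambda>z. b + e * z) has_field_derivative e) (at x)" for b e x :: complex
    by (auto intro!: derivative_eq_intros)
  obtain D E where "has_cderiv p D (u + c * z)" "has_cderiv p E (v + d * cnj z)"
    using p[OF z] q[OF z] by blast
  then have "has_cderiv (\<lambda>z. p (u + c * z)) (c *\<^sub>C D) z" "has_cderiv (\<lambda>w. p (v + d * w)) (d *\<^sub>C E) (cnj z)"
    by (auto intro: has_cderiv_chain[OF _ affine])
  from has_field_derivative_cinner_cnj[OF this]
  show "\<exists>f'. ((\<lambda>z. cinner (p (u + c * z)) (p (v + d * cnj z))) has_field_derivative f') (at z)" by blast
qed

text \<open>
  In the coordinates \<open>z = a + \<xi> + \<i>\<eta>\<close>, \<open>w = a + cnj \<xi> + \<i> cnj \<eta>\<close> the function \<open>\<langle>t z, t w\<rangle>\<close> is holomorphic in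
  \<open>\<xi>\<close> and in \<open>\<eta>\<close>, and for real \<open>\<xi>\<close> and \<open>\<eta>\<close> the two points coincide. So it is determined by its values
  on the diagonal. The smaller disc keeps \<open>\<xi>\<close> and \<open>\<eta>\<close> in discs on which both arguments stay in \<open>ball a r\<close>.
\<close>

lemma polarization:
  fixes t :: "complex \<Rightarrow> 'a::complex_inner" and p :: "complex \<Rightarrow> 'b::complex_inner"
  assumes t: "\<And>z. z \<in> ball a r \<Longrightarrow> \<exists>D. has_cderiv t D z" and p: "\<And>z. z \<in> ball a r \<Longrightarrow> \<exists>D. has_cderiv p D z"
    and norm: "\<And>z. z \<in> ball a r \<Longrightarrow> norm (t z) = norm (p z)"
    and z: "z \<in> ball a (r / 2)" and w: "w \<in> ball a (r / 2)"
  shows "cinner (t z) (t w) = cinner (p z) (p w)"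
proof -
  define A where "A \<xi> \<eta> = a + \<xi> + \<i> * \<eta>" for \<xi> \<eta>
  define \<Phi> where "\<Phi> \<xi> \<eta> = cinner (t (A \<xi> \<eta>)) (t (A (cnj \<xi>) (cnj \<eta>)))
      - cinner (p (A \<xi> \<eta>)) (p (A (cnj \<xi>) (cnj \<eta>)))" for \<xi> \<eta>
  have A: "A \<xi> \<eta> \<in> ball a r" if "\<xi> \<in> ball 0 (r / 2)" "\<eta> \<in> ball 0 (r / 2)" for \<xi> \<eta>
  proof -
    have "cmod (\<xi> + \<i> * \<eta>) \<le> cmod \<xi> + cmod (\<i> * \<eta>)" by (rule norm_triangle_ineq)
    also have "\<dots> < r" using that by (simp add: norm_mult)
    finally have "dist (a + (\<xi> + \<i> * \<eta>)) a < r" unfolding dist_norm by simp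
    then show ?thesis by (simp add: A_def dist_commute add.assoc)
  qed
  have cnj_ball: "cnj \<xi> \<in> ball 0 (r / 2)" if "\<xi> \<in> ball 0 (r / 2)" for \<xi>
    using that by simp
  have hol1: "(\<lambda>\<xi>. \<Phi> \<xi> \<eta>) holomorphic_on ball 0 (r / 2)" if \<eta>: "\<eta> \<in> ball 0 (r / 2)" for \<eta>
  proof -
    have mem: "a + \<i> * \<eta> + 1 * \<xi> \<in> ball a r" "a + \<i> * cnj \<eta> + 1 * cnj \<xi> \<in> ball a r"
      if "\<xi> \<in> ball 0 (r / 2)" for \<xi>
      using A[OF that \<eta>] A[OF cnj_ball[OF that] cnj_ball[OF \<eta>]] by (simp_all add: A_def ac_simps)
    have "(\<lambda>\<xi>. cinner (t (a + \<i> * \<eta> + 1 * \<xi>)) (t (a + \<i> * cnj \<eta> + 1 * cnj \<xi>))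
        - cinner (p (a + \<i> * \<eta> + 1 * \<xi>)) (p (a + \<i> * cnj \<eta> + 1 * cnj \<xi>))) holomorphic_on ball 0 (r / 2)"
      by (intro holomorphic_on_diff holomorphic_on_cinner_affine open_ball t p mem)
    then show ?thesis by (simp add: \<Phi>_def A_def ac_simps)
  qed
  have hol2: "(\<lambda>\<eta>. \<Phi> \<xi> \<eta>) holomorphic_on ball 0 (r / 2)" if \<xi>: "\<xi> \<in> ball 0 (r / 2)" for \<xi>
  proof -
    have mem: "a + \<xi> + \<i> * \<eta> \<in> ball a r" "a + cnj \<xi> + \<i> * cnj \<eta> \<in> ball a r"
      if "\<eta> \<in> ball 0 (r / 2)" for \<eta>
      using A[OF \<xi> that] A[OF cnj_ball[OF \<xi>] cnj_ball[OF that]] by (simp_all add: A_def)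
    show ?thesis unfolding \<Phi>_def A_def
      by (intro holomorphic_on_diff holomorphic_on_cinner_affine open_ball t p mem)
  qed
  have real: "\<Phi> (complex_of_real x) (complex_of_real y) = 0" if "\<bar>x\<bar> < r / 2" "\<bar>y\<bar> < r / 2" for x y
    using norm[OF A, of "complex_of_real x" "complex_of_real y"] that
    by (simp add: \<Phi>_def norm_eq_iff_cinner_self)
  have half: "\<Phi> \<xi> (complex_of_real y) = 0" if "\<xi> \<in> ball 0 (r / 2)" "\<bar>y\<bar> < r / 2" for \<xi> y
    by (rule holomorphic_zero_if_zero_on_reals[OF hol1 that(1) real]) (use that in simp_all)
  have zero: "\<Phi> \<xi> \<eta> = 0" if "\<xi> \<in> ball 0 (r / 2)" "\<eta> \<in> ball 0 (r / 2)" for \<xi> \<eta>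
    by (rule holomorphic_zero_if_zero_on_reals[OF hol2 that(2) half]) (use that in simp_all)
  define \<xi> \<eta> where "\<xi> = ((z - a) + cnj (w - a)) / 2" and "\<eta> = ((z - a) - cnj (w - a)) / (2 * \<i>)"
  have lt: "cmod (z - a) < r / 2" "cmod (cnj (w - a)) < r / 2"
    using z w unfolding complex_mod_cnj by (simp_all add: dist_norm norm_minus_commute)
  have "\<xi> \<in> ball 0 (r / 2)" "\<eta> \<in> ball 0 (r / 2)"
    using lt norm_triangle_ineq[of "z - a" "cnj (w - a)"] norm_triangle_ineq4[of "z - a" "cnj (w - a)"]
    unfolding \<xi>_def \<eta>_def mem_ball_0 norm_divide norm_mult by simp_all
  moreover have "A \<xi> \<eta> = z" "A (cnj \<xi>) (cnj \<eta>) = w"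
    by (simp_all add: A_def \<xi>_def \<eta>_def field_simps)
  ultimately show ?thesis using zero[of \<xi> \<eta>] by (simp add: \<Phi>_def)
qed

text \<open>
  By polarization \<open>t\<close> and \<open>f s\<close> have the same Gram matrix on the smaller disc, which yields the unitary.
  It intertwines the operators on the vectors \<open>t z\<close> of this disc, and these are total.
\<close>

lemma local_unitary:
  assumes t: "eigen_line_bundle \<Omega> T t" and s: "eigen_line_bundle \<Omega> T' s"
    and r: "0 < r" "ball a r \<subseteq> \<Omega>" and f: "f holomorphic_on ball a r" "\<And>z. f z \<noteq> 0"
    and norm: "\<And>z. z \<in> ball a r \<Longrightarrow> norm (t z) = cmod (f z) * norm (s z)"
  obtains U where "unitary U" "\<And>x. U (T x) = T' (U x)" "\<And>z. z \<in> ball a (r / 2) \<Longrightarrow> U (t z) = f z *\<^sub>C s z"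
proof -
  interpret t: eigen_line_bundle \<Omega> T t by (rule t)
  interpret s: eigen_line_bundle \<Omega> T' s by (rule s)
  let ?D = "ball a (r / 2)" and ?p = "\<lambda>z. f z *\<^sub>C s z"
  have D: "open ?D" "?D \<noteq> {}" "?D \<subseteq> \<Omega>" using r by (auto simp: subset_iff)
  have ph: "\<exists>D. has_cderiv ?p D z" if "z \<in> ball a r" for z
    using has_cderiv_scaleC[OF holomorphic_derivI[OF f(1) open_ball that] s.deriv_section] r(2) that by blast
  have gram: "cinner (t z) (t w) = cinner (?p z) (?p w)" if "z \<in> ?D" "w \<in> ?D" for z w
    by (rule polarization[OF _ ph _ that]) (use t.holo r(2) norm in \<open>auto simp: norm_scaleC\<close>)
  have cls: "complex_vector.subspace (closure (complex_vector.span X))" for X :: "'v::complex_inner set"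
    by (intro subspace_closure complex_vector.subspace_span)
  have base: "x \<in> closure (complex_vector.span X)" if "x \<in> X" for x :: "'v::complex_inner" and X
    using that closure_subset complex_vector.span_base by blast
  have "closure (complex_vector.span (t ` ?D)) = UNIV"
    by (rule t.total_open[OF D cls]) (auto intro: base)
  moreover have "closure (complex_vector.span (?p ` ?D)) = UNIV"
  proof (rule s.total_open[OF D cls])
    fix z assume "z \<in> ?D"
    then have "?p z \<in> closure (complex_vector.span (?p ` ?D))" by (intro base) blast
    then have "(1 / f z) *\<^sub>C ?p z \<in> closure (complex_vector.span (?p ` ?D))"
      by (rule complex_vector.subspace_scale[OF cls])
    then show "s z \<in> closure (complex_vector.span (?p ` ?D))" by (simp add: scaleC_scaleC f(2))
  qed simp
  ultimately obtain U where U: "unitary U" and Ut: "\<And>z. z \<in> ?D \<Longrightarrow> U (t z) = ?p z"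
    using unitary_from_gram[of ?D t ?p] gram by blast
  note Ul = unitary_bounded_clinear[OF U]
  have "U (T (t z)) = T' (U (t z))" if "z \<in> ?D" for z
  proof -
    have "z \<in> \<Omega>" using that D by blast
    then show ?thesis
      by (simp add: Ut[OF that] t.eigen s.eigen bounded_clinearD(6)[OF Ul] bounded_clinearD(6)[OF s.clinear]
          scaleC_scaleC mult.commute)
  qed
  then have "{x. U (T x) = T' (U x)} = UNIV"
    by (intro t.total_open[OF D] subspace_equalizer closed_equalizer
        bounded_clinear_comp[OF Ul t.clinear] bounded_clinear_comp[OF s.clinear Ul]) simp
  then show ?thesis using that U Ut by blast
qed

section \<open>The Kleinecke-Shirokov theorem on an eigenvector\<close>

definition commutator :: "('a::complex_inner \<Rightarrow> 'a) \<Rightarrow> ('a \<Rightarrow> 'a) \<Rightarrow> 'a \<Rightarrow> 'a"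
  where "commutator T A x = T (A x) - A (T x)"

lemma bounded_clinear_commutator:
  assumes "bounded_clinear T" "bounded_clinear A"
  shows "bounded_clinear (commutator T A)"
  using bounded_clinear_comp[OF assms] bounded_clinear_comp[OF assms(2,1)]
  unfolding bounded_clinear_def commutator_def
  by (auto intro!: bounded_linear_sub simp: complex_vector.scale_right_diff_distrib)

lemma bounded_clinear_funpow_commutator:
  "bounded_clinear T \<Longrightarrow> bounded_clinear A \<Longrightarrow> bounded_clinear ((commutator T ^^ m) A)"
  by (induction m) (auto intro: bounded_clinear_commutator)

lemma bounded_clinear_funpow:
  fixes W :: "'a::complex_inner \<Rightarrow> 'a"
  shows "bounded_clinear W \<Longrightarrow> bounded_clinear (W ^^ n)"
proof (induction n)
  case 0
  show ?case by (simp add: bounded_clinear_def id_def)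
next
  case (Suc n)
  then show ?case using bounded_clinear_comp[of W "W ^^ n"] by (simp add: comp_def)
qed

text \<open>
  Commutation with \<open>T\<close> is a derivation \<open>\<delta>\<close>. Since \<open>\<delta> Z = 0\<close> for \<open>Z = \<delta> W\<close>, the Leibniz rule for
  \<open>\<delta>\<^sup>m (B W)\<close> has only two terms.
\<close>

lemma commutator_leibniz:
  assumes T: "bounded_clinear T" and B: "bounded_clinear B"
    and TZ: "\<And>x. T (commutator T W x) = commutator T W (T x)"
  shows "(commutator T ^^ Suc m) (B \<circ> W) x
    = (commutator T ^^ Suc m) B (W x) + real (Suc m) *\<^sub>R (commutator T ^^ m) B (commutator T W x)"
proof (induction m arbitrary: x)
  case 0
  show ?case by (simp add: commutator_def bounded_clinearD[OF B])
next
  case (Suc m)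
  let ?Z = "commutator T W"
  let ?d = "\<lambda>k. (commutator T ^^ k) B"
  note lin = bounded_clinearD[OF bounded_clinear_funpow_commutator[OF T B]]
  have dd: "?d (Suc k) y = T (?d k y) - ?d k (T y)" for k y by (simp add: commutator_def)
  have TsR: "T (r *\<^sub>R y) = r *\<^sub>R T y" for r y
    using bounded_clinearD(6)[OF T, of "complex_of_real r"] by (simp add: scaleC_of_real)
  have "(commutator T ^^ Suc (Suc m)) (B \<circ> W) x
      = T ((commutator T ^^ Suc m) (B \<circ> W) x) - (commutator T ^^ Suc m) (B \<circ> W) (T x)"
    by (simp add: commutator_def)
  also have "\<dots> = T (?d (Suc m) (W x)) - ?d (Suc m) (W (T x))
      + real (Suc m) *\<^sub>R (T (?d m (?Z x)) - ?d m (T (?Z x)))"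
    unfolding Suc.IH by (simp only: bounded_clinearD[OF T] TsR TZ) (simp only: scaleR_diff_right diff_add_eq add_diff_eq diff_diff_eq add.commute add.left_commute)
  also have "T (?d m (?Z x)) - ?d m (T (?Z x)) = ?d (Suc m) (?Z x)" by (rule dd[symmetric])
  also have "T (?d (Suc m) (W x)) - ?d (Suc m) (W (T x)) = ?d (Suc (Suc m)) (W x) + ?d (Suc m) (?Z x)"
    unfolding dd[of "Suc m"] commutator_def[of T W] lin(3) by simp
  finally show ?case by (simp only: of_nat_Suc[of "Suc m"] scaleR_left_distrib scaleR_one add.assoc)
qed

lemma commutator_power:
  assumes T: "bounded_clinear T" and W: "bounded_clinear W"
    and TZ: "\<And>x. T (commutator T W x) = commutator T W (T x)"
  shows "(commutator T ^^ n) (W ^^ n) x = fact n *\<^sub>R (commutator T W ^^ n) x"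
proof (induction n arbitrary: x)
  case (Suc n)
  let ?Z = "commutator T W"
  have TsR: "T (r *\<^sub>R y) = r *\<^sub>R T y" for r y
    using bounded_clinearD(6)[OF T, of "complex_of_real r"] by (simp add: scaleC_of_real)
  have TZn: "T ((?Z ^^ n) y) = (?Z ^^ n) (T y)" for y
    by (induction n) (simp_all add: TZ)
  have zero: "(commutator T ^^ Suc n) (W ^^ n) y = 0" for y
  proof -
    have "(commutator T ^^ Suc n) (W ^^ n) y = T ((commutator T ^^ n) (W ^^ n) y) - (commutator T ^^ n) (W ^^ n) (T y)"
      by (simp add: commutator_def[of T "(commutator T ^^ n) (W ^^ n)"])
    then show ?thesis unfolding Suc.IH TsR TZn by simp
  qed
  have "(commutator T ^^ Suc n) (W ^^ Suc n) x
      = (commutator T ^^ Suc n) (W ^^ n \<circ> W) x" by (simp only: funpow_Suc_right)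
  also have "\<dots> = real (Suc n) *\<^sub>R fact n *\<^sub>R (?Z ^^ n) (?Z x)"
    unfolding commutator_leibniz[OF T bounded_clinear_funpow[OF W] TZ] zero Suc.IH by simp
  also have "\<dots> = fact (Suc n) *\<^sub>R (?Z ^^ Suc n) x"
    by (simp only: funpow_Suc_right comp_apply scaleR_scaleR fact_Suc of_nat_mult of_nat_fact)
  finally show ?case .
qed simp

text \<open>
  If \<open>Z = T W - W T\<close> commutes with \<open>T\<close> then \<open>n! Z\<^sup>n = \<delta>\<^sup>n (W\<^sup>n)\<close> grows only geometrically, so \<open>0\<close> is the
  only possible eigenvalue of \<open>Z\<close>.
\<close>

lemma kleinecke_shirokov_eigenvalue:
  fixes T :: "'a::complex_inner \<Rightarrow> 'a"
  assumes T: "bounded_clinear T" and W: "bounded_clinear W"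
    and TZ: "\<And>x. T (commutator T W x) = commutator T W (T x)"
    and v: "commutator T W v = \<zeta> *\<^sub>C v" "v \<noteq> 0"
  shows "\<zeta> = 0"
proof (rule ccontr)
  assume \<zeta>: "\<zeta> \<noteq> 0"
  obtain K where K: "\<And>x. norm (T x) \<le> norm x * K" "0 \<le> K"
    using bounded_linear.nonneg_bounded[OF bounded_clinearD(1)[OF T]] by blast
  obtain C where C: "\<And>x. norm (W x) \<le> norm x * C" "0 \<le> C"
    using bounded_linear.nonneg_bounded[OF bounded_clinearD(1)[OF W]] by blast
  have Wn: "norm ((W ^^ n) x) \<le> C ^ n * norm x" for n x
  proof (induction n)
    case (Suc n)
    have "norm ((W ^^ Suc n) x) \<le> norm ((W ^^ n) x) * C" using C(1) by simp
    also have "\<dots> \<le> (C ^ n * norm x) * C" by (rule mult_right_mono[OF Suc C(2)])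
    finally show ?case by (simp add: ac_simps)
  qed simp
  have dn: "norm ((commutator T ^^ m) B x) \<le> (2 * K) ^ m * b * norm x"
    if B: "\<And>x. norm (B x) \<le> b * norm x" and b: "0 \<le> b" for m B b x
  proof (induction m arbitrary: x)
    case 0
    then show ?case using B by simp
  next
    case (Suc m)
    let ?d = "(commutator T ^^ m) B" and ?c = "(2 * K) ^ m * b"
    have c: "0 \<le> ?c" using K b by simp
    have "norm ((commutator T ^^ Suc m) B x) \<le> norm (T (?d x)) + norm (?d (T x))"
      by (simp add: commutator_def norm_triangle_ineq4)
    also have "\<dots> \<le> norm (?d x) * K + ?c * norm (T x)"
      by (intro add_mono K Suc.IH)
    also have "\<dots> \<le> (?c * norm x) * K + ?c * (norm x * K)"
      by (intro add_mono mult_right_mono mult_left_mono K Suc.IH c)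
    finally show ?case by (simp add: algebra_simps)
  qed
  have Zn: "(commutator T W ^^ n) v = (\<zeta> ^ n) *\<^sub>C v" for n
  proof (induction n)
    case (Suc n)
    show ?case using Suc bounded_clinearD(6)[OF bounded_clinear_commutator[OF T W]] by (simp add: v scaleC_scaleC mult.commute)
  qed simp
  have bound: "fact n \<le> (2 * K * C / cmod \<zeta>) ^ n" for n
  proof -
    have "fact n * (cmod \<zeta> ^ n * norm v) = norm ((commutator T ^^ n) (W ^^ n) v)"
      unfolding commutator_power[OF T W TZ] Zn by (simp add: norm_scaleC norm_power)
    also have "\<dots> \<le> (2 * K) ^ n * C ^ n * norm v"
      by (rule dn[OF Wn]) (use C(2) in simp)
    finally have "(fact n * cmod \<zeta> ^ n) * norm v \<le> ((2 * K) ^ n * C ^ n) * norm v" by (simp add: ac_simps)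
    then have "fact n * cmod \<zeta> ^ n \<le> (2 * K) ^ n * C ^ n" using v(2) by (simp add: mult_le_cancel_right)
    then show ?thesis using \<zeta> by (simp add: power_divide power_mult_distrib field_simps)
  qed
  let ?x = "2 * K * C / cmod \<zeta>"
  have "(\<lambda>n. inverse (fact n) * ?x ^ n) \<longlonglongrightarrow> 0" by (rule summable_LIMSEQ_zero[OF summable_exp])
  then have "\<forall>\<^sub>F n in sequentially. inverse (fact n) * ?x ^ n < 1" by (rule order_tendstoD) simp
  then obtain n where n: "inverse (fact n) * ?x ^ n < 1" unfolding eventually_sequentially by blast
  have "1 = inverse (fact n) * (fact n :: real)" by simp
  also have "\<dots> \<le> inverse (fact n) * ?x ^ n" by (rule mult_left_mono[OF bound]) simp
  finally show False using n by simp
qed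

section \<open>The plane of a one-jet\<close>

lemma mem_plane_iff: "u \<in> complex_vector.span {x, y} \<longleftrightarrow> (\<exists>a b. u = a *\<^sub>C x + b *\<^sub>C y)"
  for x :: "'a::complex_inner"
proof -
  have "u - a *\<^sub>C x = b *\<^sub>C y \<longleftrightarrow> u = a *\<^sub>C x + b *\<^sub>C y" for a b
    by (simp add: diff_eq_eq add.commute)
  then show ?thesis
    unfolding complex_vector.span_breakdown_eq[of u] complex_vector.span_singleton image_iff by simp
qed

lemma orthogonal_plane:
  fixes x :: "'a::complex_inner"
  assumes "cinner u x = 0" "cinner u y = 0" "z \<in> complex_vector.span {x, y}"
  shows "cinner u z = 0"
  using assms by (auto simp: mem_plane_iff cinner_simps)

lemma image_plane:
  fixes x :: "'a::complex_inner"
  assumes "bounded_clinear A"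
  shows "A ` complex_vector.span {x, y} = complex_vector.span {A x, A y}"
proof (intro set_eqI iffI)
  fix u assume "u \<in> complex_vector.span {A x, A y}"
  then obtain a b where "u = A (a *\<^sub>C x + b *\<^sub>C y)"
    by (auto simp: mem_plane_iff bounded_clinearD[OF assms])
  then show "u \<in> A ` complex_vector.span {x, y}" using mem_plane_iff by blast
next
  fix u assume "u \<in> A ` complex_vector.span {x, y}"
  then obtain a b where "u = A (a *\<^sub>C x + b *\<^sub>C y)" unfolding image_iff Bex_def mem_plane_iff by blast
  then have "u = a *\<^sub>C A x + b *\<^sub>C A y" by (simp add: bounded_clinearD[OF assms])
  then show "u \<in> complex_vector.span {A x, A y}" unfolding mem_plane_iff by blast
qed

lemma plane_scale:
  fixes x :: "'a::complex_inner"
  assumes c: "c \<noteq> 0"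
  shows "complex_vector.span {c *\<^sub>C x, d *\<^sub>C x + c *\<^sub>C y} = complex_vector.span {x, y}" (is "?P = ?Q")
proof
  show "?P \<subseteq> ?Q"
  proof (rule complex_vector.span_minimal)
    have "c *\<^sub>C x = c *\<^sub>C x + 0 *\<^sub>C y" by simp
    then show "{c *\<^sub>C x, d *\<^sub>C x + c *\<^sub>C y} \<subseteq> ?Q" unfolding insert_subset mem_plane_iff by blast
  qed (rule complex_vector.subspace_span)
  show "?Q \<subseteq> ?P"
  proof (rule complex_vector.span_minimal)
    have "x = (1 / c) *\<^sub>C (c *\<^sub>C x) + 0 *\<^sub>C (d *\<^sub>C x + c *\<^sub>C y)"
      using c by (simp add: scaleC_scaleC)
    moreover have "y = (- d / c\<^sup>2) *\<^sub>C (c *\<^sub>C x) + (1 / c) *\<^sub>C (d *\<^sub>C x + c *\<^sub>C y)"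
      using c by (simp add: scaleC_scaleC scaleC_add_right scaleC_add_left[symmetric] add.assoc[symmetric] power2_eq_square field_simps)
    ultimately show "{x, y} \<subseteq> ?P" unfolding insert_subset mem_plane_iff by blast
  qed (rule complex_vector.subspace_span)
qed

text \<open>For independent \<open>x\<close> and \<open>y\<close>, the vector of the plane spanned by them that is orthogonal to \<open>x\<close> and has product \<open>1\<close>
  with \<open>y\<close>.\<close>

definition dual_vec :: "'a::complex_inner \<Rightarrow> 'a \<Rightarrow> 'a"
  where "dual_vec x y = (1 / gram_det x y) *\<^sub>C (cinner x x *\<^sub>C y - cinner y x *\<^sub>C x)"

lemma cinner_dual_vec_left: "cinner (dual_vec x y) x = 0"
  by (simp add: dual_vec_def cinner_simps)

lemma cinner_dual_vec_right: "gram_det x y \<noteq> 0 \<Longrightarrow> cinner (dual_vec x y) y = 1"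
  by (simp add: dual_vec_def cinner_simps gram_det_def mult.commute)

lemma dual_vec_nonzero: "gram_det x y \<noteq> 0 \<Longrightarrow> dual_vec x y \<noteq> 0"
  using cinner_dual_vec_right[of x y] by auto

lemma dual_vec_unitary: "unitary U \<Longrightarrow> U (dual_vec x y) = dual_vec (U x) (U y)"
  by (simp add: dual_vec_def gram_det_unitary unitary_cinner
      bounded_clinearD[OF unitary_bounded_clinear])

lemma dual_vec_scale:
  assumes c: "c \<noteq> 0"
  shows "dual_vec (c *\<^sub>C x) (d *\<^sub>C x + c *\<^sub>C y) = (1 / cnj c) *\<^sub>C dual_vec x y"
proof -
  have "cinner (c *\<^sub>C x) (c *\<^sub>C x) *\<^sub>C (d *\<^sub>C x + c *\<^sub>C y) - cinner (d *\<^sub>C x + c *\<^sub>C y) (c *\<^sub>C x) *\<^sub>C (c *\<^sub>C x)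
      = (c * cnj c * c) *\<^sub>C (cinner x x *\<^sub>C y - cinner y x *\<^sub>C x)"
    by (simp add: cinner_simps scaleC_add_right scaleC_add_left scaleC_scaleC
        complex_vector.scale_right_diff_distrib algebra_simps)
  then show ?thesis
    unfolding dual_vec_def gram_det_scale
    using c by (simp add: scaleC_scaleC power2_eq_square)
qed

text \<open>
  Geometric meaning of the operators of the fourth statement: the first is the orthogonal projection
  onto the plane spanned by the section and its derivative, the second has rank one and is given by
  the dual vector of the derivative. Both follow from \<open>\<K> h\<^sup>2 = - gram_det t t'\<close>.
\<close>

context eigen_line_bundle
begin

lemma
  assumes "\<mu> \<in> \<Omega>"
  shows wirtinger_section: "wirtinger (normsq t) \<mu> = cinner (cderiv t \<mu>) (t \<mu>)"
    and wirtinger_bar_section: "wirtinger_bar (normsq t) \<mu> = cinner (t \<mu>) (cderiv t \<mu>)"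
    and wirtinger_wirtinger_bar_section:
      "wirtinger (wirtinger_bar (normsq t)) \<mu> = cinner (cderiv t \<mu>) (cderiv t \<mu>)"
  by (rule wirtinger_normsq[OF domain(1) holo assms] wirtinger_bar_normsq[OF domain(1) holo assms]
      wirtinger_wirtinger_bar_normsq[OF domain(1) holo assms]; assumption)+

lemma curvature_normsq:
  assumes "\<mu> \<in> \<Omega>"
  shows "curvature \<Omega> T \<mu> * (normsq t \<mu>)\<^sup>2 = - gram_det (t \<mu>) (cderiv t \<mu>)"
proof -
  have "normsq t \<mu> = cinner (t \<mu>) (t \<mu>)" by (simp add: normsq_def cinner_self)
  then show ?thesis using nonzero[OF assms] by (simp add: curvature_eq[OF assms] log_curvature_def)
qed

lemma
  assumes \<mu>: "\<mu> \<in> \<Omega>" and indep: "cindependent_pair (t \<mu>) (cderiv t \<mu>)"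
  shows F_P_in_plane: "F_P \<Omega> T t \<mu> x \<in> complex_vector.span {t \<mu>, cderiv t \<mu>}"
    and F_P_orthogonal: "z \<in> complex_vector.span {t \<mu>, cderiv t \<mu>} \<Longrightarrow> cinner (x - F_P \<Omega> T t \<mu> x) z = 0"
proof -
  let ?t = "t \<mu>" and ?t' = "cderiv t \<mu>"
  let ?G = "gram_det ?t ?t'"
  have G: "?G \<noteq> 0" by (rule gram_det_nonzero[OF indep])
  have nsq: "normsq t \<mu> = cinner ?t ?t" by (simp add: normsq_def cinner_self)
  define a where "a = (1 / - ?G) * (cinner ?t' ?t * cinner x ?t' - cinner ?t' ?t' * cinner x ?t)"
  define b where "b = (1 / - ?G) * (cinner ?t ?t' * cinner x ?t - cinner ?t ?t * cinner x ?t')"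
  have F: "F_P \<Omega> T t \<mu> x = a *\<^sub>C ?t + b *\<^sub>C ?t'"
    unfolding F_P_def Let_def curvature_normsq[OF \<mu>] wirtinger_section[OF \<mu>]
      wirtinger_bar_section[OF \<mu>] wirtinger_wirtinger_bar_section[OF \<mu>] rank_one_def a_def b_def
    unfolding nsq
    by (simp only: scaleC_scaleC scaleC_add_right scaleC_add_left left_diff_distrib right_diff_distrib
        complex_vector.scale_right_diff_distrib complex_vector.scale_left_diff_distrib
        complex_vector.scale_minus_right) (simp add: algebra_simps)
  then show "F_P \<Omega> T t \<mu> x \<in> complex_vector.span {?t, ?t'}" unfolding mem_plane_iff by blast
  have "cinner (x - F_P \<Omega> T t \<mu> x) ?t = 0" "cinner (x - F_P \<Omega> T t \<mu> x) ?t' = 0"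
    using G unfolding F a_def b_def
    by (simp_all add: cinner_simps field_simps) (simp_all add: gram_det_def algebra_simps)
  then show "cinner (x - F_P \<Omega> T t \<mu> x) z = 0" if "z \<in> complex_vector.span {?t, ?t'}" for z
    using that by (rule orthogonal_plane)
qed

lemma F_P_eq_orth_proj:
  assumes "\<mu> \<in> \<Omega>" "cindependent_pair (t \<mu>) (cderiv t \<mu>)"
  shows "F_P \<Omega> T t \<mu> x = orth_proj (complex_vector.span {t \<mu>, cderiv t \<mu>}) x"
  by (rule orth_proj_eqI[symmetric]) (auto intro: F_P_in_plane F_P_orthogonal assms)

lemma S_P_eq:
  assumes \<mu>: "\<mu> \<in> \<Omega>"
  shows "S_P \<Omega> T t t1 \<mu> y = cinner y (t1 \<mu>) *\<^sub>C dual_vec (t \<mu>) (cderiv t \<mu>)"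
proof -
  have nsq: "normsq t \<mu> = cinner (t \<mu>) (t \<mu>)" by (simp add: normsq_def cinner_self)
  show ?thesis
    unfolding S_P_def Let_def curvature_normsq[OF \<mu>] wirtinger_section[OF \<mu>] rank_one_def dual_vec_def
    unfolding nsq
    by (simp add: scaleC_scaleC complex_vector.scale_right_diff_distrib algebra_simps)
qed

lemma cadjoint_S_P:
  assumes \<mu>: "\<mu> \<in> \<Omega>"
  shows "cadjoint (S_P \<Omega> T t t1 \<mu>) x = cinner x (dual_vec (t \<mu>) (cderiv t \<mu>)) *\<^sub>C t1 \<mu>"
proof -
  have "cadjoint (S_P \<Omega> T t t1 \<mu>) = (\<lambda>x. cinner x (dual_vec (t \<mu>) (cderiv t \<mu>)) *\<^sub>C t1 \<mu>)"
    by (rule cadjoint_eqI) (simp add: S_P_eq[OF \<mu>] cinner_simps cinner_commute[symmetric] mult.commute)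
  then show ?thesis by simp
qed

end

section \<open>Operators with a flag structure\<close>

lemma subspace_eigenspace:
  assumes "bounded_clinear T"
  shows "complex_vector.subspace (eigenspace T \<mu>)" "closed (eigenspace T \<mu>)"
proof -
  have m: "bounded_clinear (\<lambda>x. \<mu> *\<^sub>C x)"
    by (simp add: bounded_clinear_def scaleC.bounded_linear_right scaleC_scaleC mult.commute)
  have "eigenspace T \<mu> = {x. T x = \<mu> *\<^sub>C x}" by (auto simp: eigenspace_def)
  then show "complex_vector.subspace (eigenspace T \<mu>)" "closed (eigenspace T \<mu>)"
    using subspace_equalizer[OF assms m] closed_equalizer[OF assms m] by simp_all
qed

lemma eigen_proj_unitary:
  fixes T :: "'a::{complex_inner, complete_space} \<Rightarrow> 'a" and T' :: "'b::complex_inner \<Rightarrow> 'b"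
  assumes T: "bounded_clinear T" and T': "bounded_clinear T'" and U: "unitary U" and UT: "\<And>x. U (T x) = T' (U x)"
  shows "U (eigen_proj T \<mu> x) = eigen_proj T' \<mu> (U x)"
proof -
  note Ul = bounded_clinearD[OF unitary_bounded_clinear[OF U]]
  have img: "U ` eigenspace T \<mu> = eigenspace T' \<mu>"
  proof (intro set_eqI iffI)
    fix y assume "y \<in> U ` eigenspace T \<mu>"
    then obtain x where x: "T x = \<mu> *\<^sub>C x" "y = U x" by (auto simp: eigenspace_def)
    then have "T' y = \<mu> *\<^sub>C y" by (metis UT Ul(6))
    then show "y \<in> eigenspace T' \<mu>" by (simp add: eigenspace_def)
  next
    fix y assume "y \<in> eigenspace T' \<mu>"
    then have "T' y = \<mu> *\<^sub>C y" by (simp add: eigenspace_def)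
    then have "U (T (inv U y)) = U (\<mu> *\<^sub>C inv U y)"
      by (simp add: UT unitary_f_inv[OF U] Ul(6))
    then have "T (inv U y) = \<mu> *\<^sub>C inv U y" by (metis unitary_inv_f[OF U])
    then show "y \<in> U ` eigenspace T \<mu>"
      by (intro image_eqI[of _ _ "inv U y"]) (simp_all add: eigenspace_def unitary_f_inv[OF U])
  qed
  show ?thesis
    unfolding eigen_proj_def
    by (rule orth_proj_unitary[OF U subspace_eigenspace(1)[OF T'] img, symmetric])
      (auto intro: orth_proj_in orth_proj_orthogonal subspace_eigenspace T)
qed

lemma unitary_block_diagonal_iff:
  fixes A :: "'a::complex_inner \<Rightarrow> 'c::complex_inner" and B :: "'b::complex_inner \<Rightarrow> 'd::complex_inner"
  shows "unitary (block_op A (\<lambda>y. 0) (\<lambda>x. 0) B) \<longleftrightarrow> unitary A \<and> unitary B"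
proof
  let ?U = "block_op A (\<lambda>y. 0) (\<lambda>x. 0) B"
  have U: "?U (x, y) = (A x, B y)" for x y by (simp add: block_op_def)
  {
    assume un: "unitary ?U"
    note l = bounded_clinearD[OF unitary_bounded_clinear[OF un]]
    have z: "A 0 = 0" "B 0 = 0" using l(5) by (simp_all add: zero_prod_def U)
    have ci: "cinner (A x) (A y) = cinner x y" for x y
      using unitary_cinner[OF un, of "(x, 0)" "(y, 0)"] by (simp add: U z cinner_prod_def)
    have ci': "cinner (B x) (B y) = cinner x y" for x y
      using unitary_cinner[OF un, of "(0, x)" "(0, y)"] by (simp add: U z cinner_prod_def)
    have "bounded_clinear A"
    proof (rule bounded_clinear_isometryI)
      show "A (x + y) = A x + A y" for x y using l(2)[of "(x, 0)" "(y, 0)"] by (simp add: U)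
      show "A (c *\<^sub>C x) = c *\<^sub>C A x" for c x using l(6)[of c "(x, 0)"] by (simp add: U scaleC_prod_def)
      show "norm (A x) = norm x" for x by (simp add: norm_eq_iff_cinner_self ci)
    qed
    moreover have "bounded_clinear B"
    proof (rule bounded_clinear_isometryI)
      show "B (x + y) = B x + B y" for x y using l(2)[of "(0, x)" "(0, y)"] by (simp add: U)
      show "B (c *\<^sub>C x) = c *\<^sub>C B x" for c x using l(6)[of c "(0, x)"] by (simp add: U scaleC_prod_def)
      show "norm (B x) = norm x" for x by (simp add: norm_eq_iff_cinner_self ci')
    qed
    moreover have "\<exists>x. A x = u" for u
      using unitary_f_inv[OF un, of "(u, 0)"] by (metis U fst_conv prod.collapse)
    moreover have "\<exists>y. B y = v" for v
      using unitary_f_inv[OF un, of "(0, v)"] by (metis U snd_conv prod.collapse)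
    ultimately show "unitary A \<and> unitary B" unfolding unitary_def surj_def by (metis ci ci')
  }
  assume AB: "unitary A \<and> unitary B"
  note A = bounded_clinearD[OF unitary_bounded_clinear[OF conjunct1[OF AB]]]
  note B = bounded_clinearD[OF unitary_bounded_clinear[OF conjunct2[OF AB]]]
  show "unitary ?U"
    unfolding unitary_def
  proof (intro conjI allI)
    show ci: "cinner (?U p) (?U q) = cinner p q" for p q
      using AB by (simp add: block_op_def cinner_prod_def unitary_cinner)
    show "surj ?U"
      unfolding surj_def
    proof
      fix q
      have "q = ?U (inv A (fst q), inv B (snd q))" using AB by (simp add: U unitary_f_inv)
      then show "\<exists>p. q = ?U p" ..
    qed
    show "bounded_clinear ?U"
    proof (rule bounded_clinear_isometryI)
      show "?U (p + q) = ?U p + ?U q" for p q by (simp add: block_op_def A B)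
      show "?U (c *\<^sub>C p) = c *\<^sub>C ?U p" for c p by (simp add: block_op_def A B scaleC_prod_def)
      show "norm (?U p) = norm p" for p by (simp add: norm_eq_iff_cinner_self ci)
    qed
  qed
qed

lemma
  shows bounded_clinear_fst: "bounded_clinear (fst :: 'a::complex_inner \<times> 'b::complex_inner \<Rightarrow> 'a)"
    and bounded_clinear_snd: "bounded_clinear (snd :: 'a \<times> 'b \<Rightarrow> 'b)"
    and bounded_clinear_Pair_left: "bounded_clinear (\<lambda>x::'a. (x, 0::'b))"
    and bounded_clinear_Pair_right: "bounded_clinear (\<lambda>y::'b. (0::'a, y))"
  unfolding bounded_clinear_def
  by (auto simp: scaleC_prod_def bounded_linear_fst bounded_linear_snd
      intro: bounded_linear_Pair[OF bounded_linear_ident bounded_linear_zero]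
        bounded_linear_Pair[OF bounded_linear_zero bounded_linear_ident])

locale flag_operator =
  fixes \<Omega> :: "complex set"
    and T0 :: "'a::separable_chilbert_space \<Rightarrow> 'a"
    and S :: "'b::separable_chilbert_space \<Rightarrow> 'a"
    and T1 :: "'b \<Rightarrow> 'b"
    and t0 :: "complex \<Rightarrow> 'a" and t1 :: "complex \<Rightarrow> 'b"
  assumes domain: "open \<Omega>" "connected \<Omega>" "\<Omega> \<noteq> {}"
    and FB2: "(T0, S, T1) \<in> FB2 \<Omega>"
    and section1: "nonvanishing_section \<Omega> T1 t1"
    and t0: "t0 = (\<lambda>\<mu>. - S (t1 \<mu>))"
    and independent: "\<forall>\<mu>\<in>\<Omega>. cindependent_pair (t0 \<mu>) (cderiv t0 \<mu>)"
begin

abbreviation "T \<equiv> block_op T0 S (\<lambda>x. 0) T1"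

lemma S_clinear: "bounded_clinear S" and S_intertwines: "T0 (S y) = S (T1 y)"
  using FB2 by (auto simp: FB2_def fun_eq_iff)

lemma T_Pair: "T (x, y) = (T0 x + S y, T1 y)"
  by (simp add: block_op_def)

end

sublocale flag_operator \<subseteq> E1: eigen_line_bundle \<Omega> T1 t1
  using domain FB2 section1 by unfold_locales (auto simp: FB2_def)

sublocale flag_operator \<subseteq> E0: eigen_line_bundle \<Omega> T0 t0
proof
  show "T0 \<in> cowen_douglas 1 \<Omega>" using FB2 by (simp add: FB2_def)
  then have l: "bounded_clinear T0" by (simp add: cowen_douglas_def)
  show "nonvanishing_section \<Omega> T0 t0"
    unfolding nonvanishing_section_def
  proof (intro ballI conjI)
    fix \<mu> assume \<mu>: "\<mu> \<in> \<Omega>"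
    have "bounded_clinear (\<lambda>y. - S y)"
      using S_clinear by (simp add: bounded_clinear_def bounded_linear_minus)
    then show "\<exists>D. has_cderiv t0 D \<mu>"
      unfolding t0 using has_cderiv_bounded_clinear[OF _ E1.deriv_section[OF \<mu>]] by blast
    show "t0 \<mu> \<in> eigenspace T0 \<mu>"
      by (simp add: t0 eigenspace_def bounded_clinearD[OF l] S_intertwines E1.eigen[OF \<mu>]
          bounded_clinearD[OF S_clinear])
    have "1 *\<^sub>C t0 \<mu> + 0 *\<^sub>C cderiv t0 \<mu> \<noteq> 0"
      using independent \<mu> unfolding cindependent_pair_def by (metis zero_neq_one)
    then show "t0 \<mu> \<noteq> 0" by simp
  qed
qed (use domain in auto)

context flag_operator
begin

lemma gram_nonzero: "\<mu> \<in> \<Omega> \<Longrightarrow> gram_det (t0 \<mu>) (cderiv t0 \<mu>) \<noteq> 0"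
  using independent gram_det_nonzero by blast

lemma T_clinear: "bounded_clinear T"
proof -
  have "bounded_linear (\<lambda>p. (T0 (fst p) + S (snd p), T1 (snd p)))"
    using E0.clinear E1.clinear S_clinear unfolding bounded_clinear_def
    by (intro bounded_linear_Pair bounded_linear_add)
      (auto intro: bounded_linear_compose bounded_linear_fst bounded_linear_snd)
  then show ?thesis
    unfolding bounded_clinear_def block_op_def
    by (simp add: scaleC_prod_def bounded_clinearD[OF E0.clinear] bounded_clinearD[OF E1.clinear]
        bounded_clinearD[OF S_clinear] scaleC_add_right)
qed

text \<open>
  The eigenvectors of \<open>T\<close>: since \<open>(T\<^sub>0 - \<mu>) t\<^sub>0' = t\<^sub>0 = - S t\<^sub>1\<close>, the one-jet of \<open>t\<^sub>0\<close> lifts to the pair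
  \<open>(t\<^sub>0, 0)\<close>, \<open>(t\<^sub>0', t\<^sub>1)\<close>. Modulo the first family the second one is \<open>(0, t\<^sub>1)\<close>, so the eigenvectors
  are total.
\<close>

lemma eigenvectors:
  assumes \<mu>: "\<mu> \<in> \<Omega>"
  shows "(t0 \<mu>, 0) \<in> eigenspace T \<mu>" "(cderiv t0 \<mu>, t1 \<mu>) \<in> eigenspace T \<mu>"
proof -
  show "(t0 \<mu>, 0) \<in> eigenspace T \<mu>"
    by (simp add: eigenspace_def T_Pair scaleC_prod_def E0.eigen[OF \<mu>] zero_prod_def
        bounded_clinearD(5)[OF S_clinear] bounded_clinearD(5)[OF E1.clinear])
  have "S (t1 \<mu>) = - t0 \<mu>" by (simp add: t0)
  then show "(cderiv t0 \<mu>, t1 \<mu>) \<in> eigenspace T \<mu>"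
    by (simp add: eigenspace_def T_Pair scaleC_prod_def E0.deriv_eigen[OF \<mu>] E1.eigen[OF \<mu>] zero_prod_def)
qed

lemma eigenvectors_total:
  assumes M: "complex_vector.subspace M" "closed M" and eig: "\<And>\<mu>. \<mu> \<in> \<Omega> \<Longrightarrow> eigenspace T \<mu> \<subseteq> M"
  shows "M = UNIV"
proof -
  have sub: "complex_vector.subspace {x. A x \<in> M}" if "bounded_clinear A"
    for A :: "'v::complex_inner \<Rightarrow> 'a \<times> 'b"
    using M(1) by (simp add: complex_vector.subspace_def bounded_clinearD[OF that])
  have cls: "closed {x. A x \<in> M}" if "bounded_clinear A" for A :: "'v::complex_inner \<Rightarrow> 'a \<times> 'b"
    using closed_vimage[OF M(2) linear_continuous_on[OF bounded_clinearD(1)[OF that]]]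
    by (simp add: vimage_def)
  have "{x. (x, 0) \<in> M} = UNIV"
    by (rule E0.total[OF sub cls]) (use bounded_clinear_Pair_left eigenvectors(1) eig in auto)
  then have left: "(x, 0) \<in> M" for x by blast
  have "{y. (0, y) \<in> M} = UNIV"
  proof (rule E1.total[OF sub cls])
    fix \<mu> assume \<mu>: "\<mu> \<in> \<Omega>"
    have "(cderiv t0 \<mu>, t1 \<mu>) - (cderiv t0 \<mu>, 0) \<in> M"
      using complex_vector.subspace_diff[OF M(1) _ left] eigenvectors(2)[OF \<mu>] eig[OF \<mu>] by blast
    then show "t1 \<mu> \<in> {y. (0, y) \<in> M}" by simp
  qed (rule bounded_clinear_Pair_right)+
  then have right: "(0, y) \<in> M" for y by blast
  have "(x, y) \<in> M" for x y
    using complex_vector.subspace_add[OF M(1) left right, of x y] by simp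
  then show ?thesis by auto
qed

end

section \<open>Unitary equivalence of flag operators\<close>

locale flag_pair =
  A: flag_operator \<Omega> T0 S T1 t0 t1 + B: flag_operator \<Omega> T0' S' T1' s0 s1
  for \<Omega> :: "complex set"
    and T0 :: "'a::separable_chilbert_space \<Rightarrow> 'a"
    and S :: "'b::separable_chilbert_space \<Rightarrow> 'a"
    and T1 :: "'b \<Rightarrow> 'b" and t0 t1
    and T0' :: "'c::separable_chilbert_space \<Rightarrow> 'c"
    and S' :: "'d::separable_chilbert_space \<Rightarrow> 'c"
    and T1' :: "'d \<Rightarrow> 'd" and s0 s1
begin

text \<open>Intertwining the projections means mapping eigenvectors to eigenvectors with the same eigenvalue;
  as the eigenvectors are total, this is the same as intertwining the operators.\<close>

lemma eigen_projections_intertwined_iff: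
  assumes U: "unitary U"
  shows "(\<forall>\<mu>\<in>\<Omega>. U \<circ> eigen_proj A.T \<mu> = eigen_proj B.T \<mu> \<circ> U) \<longleftrightarrow> U \<circ> A.T = B.T \<circ> U"
proof
  assume "U \<circ> A.T = B.T \<circ> U"
  then have "\<And>p. U (A.T p) = B.T (U p)" by (rule comp_eq_dest)
  then show "\<forall>\<mu>\<in>\<Omega>. U \<circ> eigen_proj A.T \<mu> = eigen_proj B.T \<mu> \<circ> U"
    using eigen_proj_unitary[OF A.T_clinear B.T_clinear U] by (simp add: fun_eq_iff)
next
  assume P: "\<forall>\<mu>\<in>\<Omega>. U \<circ> eigen_proj A.T \<mu> = eigen_proj B.T \<mu> \<circ> U"
  note Ul = unitary_bounded_clinear[OF U]
  have "{p. U (A.T p) = B.T (U p)} = UNIV"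
  proof (rule A.eigenvectors_total)
    show "complex_vector.subspace {p. U (A.T p) = B.T (U p)}" "closed {p. U (A.T p) = B.T (U p)}"
      by (rule subspace_equalizer closed_equalizer bounded_clinear_comp[OF Ul A.T_clinear]
          bounded_clinear_comp[OF B.T_clinear Ul])+
    fix \<mu> assume \<mu>: "\<mu> \<in> \<Omega>"
    show "eigenspace A.T \<mu> \<subseteq> {p. U (A.T p) = B.T (U p)}"
    proof
      fix p assume p: "p \<in> eigenspace A.T \<mu>"
      have "eigen_proj A.T \<mu> p = p"
        unfolding eigen_proj_def by (rule orth_proj_eqI) (simp_all add: p subspace_eigenspace A.T_clinear)
      then have "U p = eigen_proj B.T \<mu> (U p)" using P \<mu> by (metis comp_apply)
      then have "U p \<in> eigenspace B.T \<mu>"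
        unfolding eigen_proj_def by (metis orth_proj_in subspace_eigenspace[OF B.T_clinear])
      then show "p \<in> {p. U (A.T p) = B.T (U p)}"
        using p by (simp add: eigenspace_def bounded_clinearD[OF Ul])
    qed
  qed
  then show "U \<circ> A.T = B.T \<circ> U" by (auto simp: fun_eq_iff)
qed

text \<open>
  If \<open>U\<close> is upper triangular, its upper left block sends \<open>t\<^sub>0\<close> to nonzero multiples of \<open>s\<^sub>0\<close>, so it
  already maps onto the first summand and the inverse is upper triangular, too.
\<close>

lemma inverse_upper_triangular:
  assumes U: "unitary U" and UT: "\<And>p. U (A.T p) = B.T (U p)" and tri: "\<And>x. snd (U (x, 0)) = 0"
  shows "snd (inv U (x', 0)) = 0"
proof -
  note Ul = unitary_bounded_clinear[OF U] and Vl = unitary_bounded_clinear[OF unitary_inv[OF U]]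
  have "(\<lambda>x'. snd (inv U (x', 0))) = (\<lambda>x'. 0)"
  proof (rule B.E0.eq_if_eq_on_sections)
    show "bounded_clinear (\<lambda>x'. snd (inv U (x', 0)))"
      by (rule bounded_clinear_comp[OF bounded_clinear_snd bounded_clinear_comp[OF Vl bounded_clinear_Pair_left]])
    show "bounded_clinear (\<lambda>x'::'c. 0::'b)" by (simp add: bounded_clinear_def)
    fix \<mu> assume \<mu>: "\<mu> \<in> \<Omega>"
    define u where "u = fst (U (t0 \<mu>, 0))"
    have u: "U (t0 \<mu>, 0) = (u, 0)" using tri[of "t0 \<mu>"] by (metis u_def prod.collapse)
    have "A.T (t0 \<mu>, 0) = \<mu> *\<^sub>C (t0 \<mu>, 0)" using A.eigenvectors(1)[OF \<mu>] by (simp add: eigenspace_def)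
    then have "B.T (u, 0) = \<mu> *\<^sub>C (u, 0)" using UT[of "(t0 \<mu>, 0)"] by (simp add: u bounded_clinearD[OF Ul])
    then have "T0' u = \<mu> *\<^sub>C u"
      by (simp add: B.T_Pair scaleC_prod_def bounded_clinearD(5)[OF B.S_clinear])
    then obtain c where c: "u = c *\<^sub>C s0 \<mu>" using B.E0.eigenvector_multiple[OF \<mu>] by blast
    have "c \<noteq> 0"
      using unitary_norm[OF U, of "(t0 \<mu>, 0)"] A.E0.nonzero[OF \<mu>] by (auto simp: u c norm_Pair)
    then have "(s0 \<mu>, 0) = (1 / c) *\<^sub>C U (t0 \<mu>, 0)" by (simp add: u c scaleC_prod_def scaleC_scaleC)
    then have "inv U (s0 \<mu>, 0) = (1 / c) *\<^sub>C (t0 \<mu>, 0)"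
      by (simp add: bounded_clinearD(6)[OF Vl] unitary_inv_f[OF U])
    then show "snd (inv U (s0 \<mu>, 0)) = 0" by (simp add: scaleC_prod_def)
  qed
  then show ?thesis by (metis)
qed

text \<open>
  Let \<open>X\<close> and \<open>Y\<close> be the lower left blocks of \<open>U\<close> and its inverse. Then \<open>X S Y S'\<close> commutes with
  \<open>T\<^sub>1'\<close> and is the commutator of \<open>T\<^sub>1'\<close> with another operator; so it vanishes on the eigenvectors of
  \<open>T\<^sub>1'\<close>, which says that \<open>X t\<^sub>0 = 0\<close> or \<open>Y s\<^sub>0 = 0\<close> at each point. One of the alternatives holds on a
  nonempty open set, hence everywhere.
\<close>

lemma some_block_vanishes:
  assumes U: "unitary U" and UT: "\<And>p. U (A.T p) = B.T (U p)"
  shows "(\<forall>x. snd (U (x, 0)) = 0) \<or> (\<forall>x'. snd (inv U (x', 0)) = 0)"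
proof -
  define V where "V = inv U"
  define X where "X x = snd (U (x, 0))" for x
  define Y where "Y x' = snd (V (x', 0))" for x'
  define U11 where "U11 y = snd (U (0, y))" for y
  note Ul = unitary_bounded_clinear[OF U] and Vl = unitary_bounded_clinear[OF unitary_inv[OF U], folded V_def]
  have VT: "V (B.T q) = A.T (V q)" for q
    unfolding V_def by (metis UT unitary_f_inv[OF U] unitary_inv_f[OF U])
  have Xl: "bounded_clinear X"
    unfolding X_def by (rule bounded_clinear_comp[OF bounded_clinear_snd bounded_clinear_comp[OF Ul bounded_clinear_Pair_left]])
  have Yl: "bounded_clinear Y"
    unfolding Y_def by (rule bounded_clinear_comp[OF bounded_clinear_snd bounded_clinear_comp[OF Vl bounded_clinear_Pair_left]])
  have U11l: "bounded_clinear U11"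
    unfolding U11_def by (rule bounded_clinear_comp[OF bounded_clinear_snd bounded_clinear_comp[OF Ul bounded_clinear_Pair_right]])
  have snd_T: "snd (A.T p) = T1 (snd p)" "snd (B.T q) = T1' (snd q)" for p q
    by (simp_all add: block_op_def)
  have XT: "X (T0 x) = T1' (X x)" for x
    using arg_cong[OF UT[of "(x, 0)"], of snd]
    by (simp add: X_def snd_T A.T_Pair bounded_clinearD(5)[OF A.S_clinear] bounded_clinearD(5)[OF A.E1.clinear])
  have YT: "Y (T0' x) = T1 (Y x)" for x
    using arg_cong[OF VT[of "(x, 0)"], of snd]
    by (simp add: Y_def snd_T B.T_Pair bounded_clinearD(5)[OF B.S_clinear] bounded_clinearD(5)[OF B.E1.clinear])
  have U11T: "T1' (U11 y) = X (S y) + U11 (T1 y)" for y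
  proof -
    have "U (S y, T1 y) = U (S y, 0) + U (0, T1 y)"
      using bounded_clinearD(2)[OF Ul, of "(S y, 0)" "(0, T1 y)"] by simp
    then show ?thesis
      using arg_cong[OF UT[of "(0, y)"], of snd]
      by (simp add: X_def U11_def snd_T A.T_Pair bounded_clinearD(5)[OF A.E0.clinear])
  qed
  define W where "W y = U11 (Y (S' y))" for y
  have Wl: "bounded_clinear W"
    unfolding W_def by (rule bounded_clinear_comp[OF U11l bounded_clinear_comp[OF Yl B.S_clinear]])
  have comm: "commutator T1' W y = X (S (Y (S' y)))" for y
    unfolding commutator_def W_def U11T by (simp add: YT[symmetric] B.S_intertwines)
  have TZ: "T1' (commutator T1' W y) = commutator T1' W (T1' y)" for y
    unfolding comm by (simp add: XT[symmetric] A.S_intertwines YT[symmetric] B.S_intertwines)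
  have alt: "Y (s0 \<mu>) = 0 \<or> X (t0 \<mu>) = 0" if \<mu>: "\<mu> \<in> \<Omega>" for \<mu>
  proof -
    have "T1' (commutator T1' W (s1 \<mu>)) = \<mu> *\<^sub>C commutator T1' W (s1 \<mu>)"
      unfolding TZ B.E1.eigen[OF \<mu>]
      by (rule bounded_clinearD(6)[OF bounded_clinear_commutator[OF B.E1.clinear Wl]])
    then obtain \<zeta> where \<zeta>: "commutator T1' W (s1 \<mu>) = \<zeta> *\<^sub>C s1 \<mu>"
      using B.E1.eigenvector_multiple[OF \<mu>] by blast
    have "\<zeta> = 0"
      by (rule kleinecke_shirokov_eigenvalue[OF B.E1.clinear Wl TZ \<zeta> B.E1.nonzero[OF \<mu>]])
    then have zero: "X (S (Y (S' (s1 \<mu>)))) = 0" using \<zeta> comm by simp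
    have "T1 (Y (s0 \<mu>)) = \<mu> *\<^sub>C Y (s0 \<mu>)"
      unfolding YT[symmetric] B.E0.eigen[OF \<mu>] by (rule bounded_clinearD(6)[OF Yl])
    then obtain \<theta> where \<theta>: "Y (s0 \<mu>) = \<theta> *\<^sub>C t1 \<mu>"
      using A.E1.eigenvector_multiple[OF \<mu>] by blast
    have "S' (s1 \<mu>) = - s0 \<mu>" "S (t1 \<mu>) = - t0 \<mu>" by (simp_all add: A.t0 B.t0)
    then have "\<theta> *\<^sub>C X (t0 \<mu>) = 0"
      using zero by (simp add: \<theta> bounded_clinearD[OF Xl] bounded_clinearD[OF Yl] bounded_clinearD[OF A.S_clinear])
    then show ?thesis by (auto simp: \<theta>)
  qed
  have zero_l: "bounded_clinear (\<lambda>x::'v::complex_inner. 0::'w::complex_inner)" by (simp add: bounded_clinear_def)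
  show ?thesis
  proof (cases "\<forall>\<mu>\<in>\<Omega>. X (t0 \<mu>) = 0")
    case True
    then have "X = (\<lambda>x. 0)"
      by (intro A.E0.eq_if_eq_on_sections Xl zero_l) simp
    then show ?thesis by (simp add: X_def fun_eq_iff)
  next
    case False
    define N where "N = \<Omega> \<inter> (\<lambda>\<mu>. X (t0 \<mu>)) -` (- {0})"
    have "continuous_on \<Omega> (\<lambda>\<mu>. X (t0 \<mu>))"
      using has_cderiv_isCont[OF has_cderiv_bounded_clinear[OF Xl A.E0.deriv_section]]
      by (intro continuous_at_imp_continuous_on) blast
    then have "open N" unfolding N_def by (intro continuous_open_preimage A.domain) auto
    moreover have "N \<noteq> {}" "N \<subseteq> \<Omega>" using False by (auto simp: N_def)
    moreover have "Y (s0 \<mu>) = 0" if "\<mu> \<in> N" for \<mu> using alt[of \<mu>] that by (auto simp: N_def)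
    ultimately have "{x. Y x = 0} = UNIV"
      by (intro B.E0.total_open subspace_equalizer[OF Yl zero_l] closed_equalizer[OF Yl zero_l]) auto
    then show ?thesis by (auto simp: Y_def V_def)
  qed
qed

definition diagonally_equivalent :: "('a \<Rightarrow> 'c) \<Rightarrow> ('b \<Rightarrow> 'd) \<Rightarrow> bool"
  where "diagonally_equivalent U0 U1 \<longleftrightarrow> unitary U0 \<and> unitary U1 \<and>
    (\<forall>x. U0 (T0 x) = T0' (U0 x)) \<and> (\<forall>y. U1 (T1 y) = T1' (U1 y)) \<and> (\<forall>y. U0 (S y) = S' (U1 y))"

end

text \<open>Both lower left blocks vanish, and the one of the inverse is adjoint to the upper right block of
  \<open>U\<close>.\<close>

lemma (in flag_pair) unitary_intertwiner_diagonal: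
  assumes U: "unitary U" and UT: "\<And>p. U (A.T p) = B.T (U p)"
  obtains U0 U1 where "U = block_op U0 (\<lambda>y. 0) (\<lambda>x. 0) U1"
proof -
  interpret swap: flag_pair \<Omega> T0' S' T1' s0 s1 T0 S T1 t0 t1 ..
  note Ul = bounded_clinearD[OF unitary_bounded_clinear[OF U]]
  have V: "unitary (inv U)" by (rule unitary_inv[OF U])
  have VT: "inv U (B.T q) = A.T (inv U q)" for q
    by (metis UT unitary_f_inv[OF U] unitary_inv_f[OF U])
  have VV: "inv (inv U) = U" by (rule inv_inv_eq[OF unitary_bij[OF U]])
  have both: "snd (U (x, 0)) = 0 \<and> snd (inv U (x', 0)) = 0" for x x'
    using some_block_vanishes[OF U UT] inverse_upper_triangular[OF U UT]
      swap.inverse_upper_triangular[OF V VT] unfolding VV by blast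
  have right: "fst (U (0, y)) = 0" for y
  proof -
    let ?x = "fst (U (0, y))"
    have "cinner ?x ?x = cinner (U (0, y)) (?x, 0)" by (simp add: cinner_prod_def)
    also have "\<dots> = cinner (0, y) (inv U (?x, 0))"
      by (metis unitary_cinner[OF U] unitary_f_inv[OF U])
    also have "\<dots> = 0" using both by (simp add: cinner_prod_def)
    finally show ?thesis by simp
  qed
  have "U p = block_op (\<lambda>x. fst (U (x, 0))) (\<lambda>y. 0) (\<lambda>x. 0) (\<lambda>y. snd (U (0, y))) p" for p
    using Ul(2)[of "(fst p, 0)" "(0, snd p)"] both right by (simp add: block_op_def prod_eq_iff)
  then show ?thesis by (intro that) (rule ext)
qed

context flag_pair
begin

lemma diagonal_intertwiner_iff:
  assumes "U = block_op U0 (\<lambda>y. 0) (\<lambda>x. 0) U1"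
  shows "unitary U \<and> U \<circ> A.T = B.T \<circ> U \<longleftrightarrow> diagonally_equivalent U0 U1"
proof (cases "unitary U")
  case True
  then have un: "unitary U0" "unitary U1"
    using assms unitary_block_diagonal_iff by blast+
  note U0 = bounded_clinearD[OF unitary_bounded_clinear[OF un(1)]]
  note U1 = bounded_clinearD[OF unitary_bounded_clinear[OF un(2)]]
  have U: "U (x, y) = (U0 x, U1 y)" for x y by (simp add: assms block_op_def)
  have "U \<circ> A.T = B.T \<circ> U \<longleftrightarrow> (\<forall>x y. U0 (T0 x) + U0 (S y) = T0' (U0 x) + S' (U1 y) \<and> U1 (T1 y) = T1' (U1 y))"
    by (auto simp: fun_eq_iff U A.T_Pair B.T_Pair U0)
  also have "\<dots> \<longleftrightarrow> diagonally_equivalent U0 U1"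
  proof
    assume *: "\<forall>x y. U0 (T0 x) + U0 (S y) = T0' (U0 x) + S' (U1 y) \<and> U1 (T1 y) = T1' (U1 y)"
    have "U0 (T0 x) = T0' (U0 x)" for x
      using *[rule_format, of x 0] by (simp add: U0 U1 bounded_clinearD(5)[OF A.S_clinear] bounded_clinearD(5)[OF B.S_clinear])
    moreover have "U0 (S y) = S' (U1 y)" for y
      using *[rule_format, of 0 y] by (simp add: U0 U1 bounded_clinearD(5)[OF A.E0.clinear] bounded_clinearD(5)[OF B.E0.clinear])
    ultimately show "diagonally_equivalent U0 U1" using * un by (simp add: diagonally_equivalent_def)
  qed (simp add: diagonally_equivalent_def)
  finally show ?thesis using True by simp
next
  case False
  then show ?thesis
    using assms unitary_block_diagonal_iff by (auto simp: diagonally_equivalent_def)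
qed

lemma unitarily_equivalent_iff:
  "(\<exists>U. unitary U \<and> U \<circ> A.T = B.T \<circ> U) \<longleftrightarrow> (\<exists>U0 U1. diagonally_equivalent U0 U1)"
proof
  assume "\<exists>U. unitary U \<and> U \<circ> A.T = B.T \<circ> U"
  then obtain U where U: "unitary U" "U \<circ> A.T = B.T \<circ> U" by blast
  from U(2) have "\<And>p. U (A.T p) = B.T (U p)" by (rule comp_eq_dest)
  then obtain U0 U1 where "U = block_op U0 (\<lambda>y. 0) (\<lambda>x. 0) U1"
    using unitary_intertwiner_diagonal[OF U(1)] by blast
  then show "\<exists>U0 U1. diagonally_equivalent U0 U1" using diagonal_intertwiner_iff U by blast
qed (use diagonal_intertwiner_iff in blast)

text \<open>The compatibility with \<open>S\<close> makes both blocks multiply the sections by the same function.\<close>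

lemma diagonal_equivalence_sections:
  assumes D: "diagonally_equivalent U0 U1"
  obtains c where "c holomorphic_on \<Omega>" "\<And>\<mu>. \<mu> \<in> \<Omega> \<Longrightarrow> c \<mu> \<noteq> 0"
    "\<And>\<mu>. \<mu> \<in> \<Omega> \<Longrightarrow> U0 (t0 \<mu>) = c \<mu> *\<^sub>C s0 \<mu>" "\<And>\<mu>. \<mu> \<in> \<Omega> \<Longrightarrow> U1 (t1 \<mu>) = c \<mu> *\<^sub>C s1 \<mu>"
proof -
  have U: "unitary U0" "unitary U1" and T1: "\<And>y. U1 (T1 y) = T1' (U1 y)" and S: "\<And>y. U0 (S y) = S' (U1 y)"
    using D by (simp_all add: diagonally_equivalent_def)
  obtain c where c: "c holomorphic_on \<Omega>" "\<And>\<mu>. \<mu> \<in> \<Omega> \<Longrightarrow> c \<mu> \<noteq> 0" "\<And>\<mu>. \<mu> \<in> \<Omega> \<Longrightarrow> U1 (t1 \<mu>) = c \<mu> *\<^sub>C s1 \<mu>"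
    using unitary_intertwiner_section[OF A.E1.eigen_line_bundle_axioms B.E1.eigen_line_bundle_axioms U(2) T1] by blast
  have "U0 (t0 \<mu>) = c \<mu> *\<^sub>C s0 \<mu>" if "\<mu> \<in> \<Omega>" for \<mu>
    using c(3)[OF that]
    by (simp add: A.t0 B.t0 S bounded_clinearD[OF unitary_bounded_clinear[OF U(1)]] bounded_clinearD[OF B.S_clinear])
  then show ?thesis using c that by blast
qed

lemma ratio_invariant:
  assumes D: "diagonally_equivalent U0 U1" and \<mu>: "\<mu> \<in> \<Omega>"
  shows "(norm (S (t1 \<mu>)))\<^sup>2 / (norm (t1 \<mu>))\<^sup>2 = (norm (S' (s1 \<mu>)))\<^sup>2 / (norm (s1 \<mu>))\<^sup>2"
proof -
  have U: "unitary U0" "unitary U1" using D by (simp_all add: diagonally_equivalent_def)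
  obtain c where c: "c \<mu> \<noteq> 0" "U0 (t0 \<mu>) = c \<mu> *\<^sub>C s0 \<mu>" "U1 (t1 \<mu>) = c \<mu> *\<^sub>C s1 \<mu>"
    using diagonal_equivalence_sections[OF D] \<mu> by metis
  have "norm (t0 \<mu>) = cmod (c \<mu>) * norm (s0 \<mu>)" "norm (t1 \<mu>) = cmod (c \<mu>) * norm (s1 \<mu>)"
    using unitary_norm[OF U(1), of "t0 \<mu>"] unitary_norm[OF U(2), of "t1 \<mu>"] c by (simp_all add: norm_scaleC)
  moreover have "norm (t0 \<mu>) = norm (S (t1 \<mu>))" "norm (s0 \<mu>) = norm (S' (s1 \<mu>))"
    by (simp_all add: A.t0 B.t0)
  ultimately show ?thesis using c(1) by (simp add: power_mult_distrib)
qed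

text \<open>
  A disc suffices: as \<open>\<Omega>\<close> may have holes, a holomorphic \<open>f\<close> with \<open>\<parallel>t\<^sub>0\<parallel> = |f| \<parallel>s\<^sub>0\<parallel>\<close> need not exist on all of
  \<open>\<Omega>\<close>, but the unitaries found on the disc are determined on the whole spaces. They are compatible
  with \<open>S\<close> because the same factor serves both bundles.
\<close>

lemma diagonal_equivalence_from_norms:
  assumes r: "0 < r" "ball a r \<subseteq> \<Omega>" and f: "f holomorphic_on ball a r" "\<And>z. f z \<noteq> 0"
    and n0: "\<And>z. z \<in> ball a r \<Longrightarrow> norm (t0 z) = cmod (f z) * norm (s0 z)"
    and n1: "\<And>z. z \<in> ball a r \<Longrightarrow> norm (t1 z) = cmod (f z) * norm (s1 z)"
  shows "\<exists>U0 U1. diagonally_equivalent U0 U1"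
proof -
  obtain U0 where U0: "unitary U0" "\<And>x. U0 (T0 x) = T0' (U0 x)"
    "\<And>z. z \<in> ball a (r / 2) \<Longrightarrow> U0 (t0 z) = f z *\<^sub>C s0 z"
    using local_unitary[OF A.E0.eigen_line_bundle_axioms B.E0.eigen_line_bundle_axioms r f n0] by blast
  obtain U1 where U1: "unitary U1" "\<And>y. U1 (T1 y) = T1' (U1 y)"
    "\<And>z. z \<in> ball a (r / 2) \<Longrightarrow> U1 (t1 z) = f z *\<^sub>C s1 z"
    using local_unitary[OF A.E1.eigen_line_bundle_axioms B.E1.eigen_line_bundle_axioms r f n1] by blast
  note l0 = unitary_bounded_clinear[OF U0(1)] and l1 = unitary_bounded_clinear[OF U1(1)]
  have "{y. U0 (S y) = S' (U1 y)} = UNIV"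
  proof (rule A.E1.total_open)
    show "open (ball a (r / 2))" "ball a (r / 2) \<noteq> {}" "ball a (r / 2) \<subseteq> \<Omega>"
      using r by (auto simp: subset_iff)
    show "complex_vector.subspace {y. U0 (S y) = S' (U1 y)}" "closed {y. U0 (S y) = S' (U1 y)}"
      by (rule subspace_equalizer closed_equalizer bounded_clinear_comp[OF l0 A.S_clinear]
          bounded_clinear_comp[OF B.S_clinear l1])+
    fix z assume z: "z \<in> ball a (r / 2)"
    have "S (t1 z) = - t0 z" "S' (s1 z) = - s0 z" by (simp_all add: A.t0 B.t0)
    then show "t1 z \<in> {y. U0 (S y) = S' (U1 y)}"
      using U0(3)[OF z] U1(3)[OF z] by (simp add: bounded_clinearD[OF l0] bounded_clinearD[OF B.S_clinear])
  qed
  then have "diagonally_equivalent U0 U1" using U0 U1 by (auto simp: diagonally_equivalent_def)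
  then show ?thesis by blast
qed

text \<open>Given the ratio of the norms, a factor that fits one of the two bundles fits the other.\<close>

lemma diagonal_equivalence_from_curvature:
  assumes curv: "(\<forall>\<mu>\<in>\<Omega>. curvature \<Omega> T0 \<mu> = curvature \<Omega> T0' \<mu>) \<or> (\<forall>\<mu>\<in>\<Omega>. curvature \<Omega> T1 \<mu> = curvature \<Omega> T1' \<mu>)"
    and ratio: "\<forall>\<mu>\<in>\<Omega>. (norm (S (t1 \<mu>)))\<^sup>2 / (norm (t1 \<mu>))\<^sup>2 = (norm (S' (s1 \<mu>)))\<^sup>2 / (norm (s1 \<mu>))\<^sup>2"
  shows "\<exists>U0 U1. diagonally_equivalent U0 U1"
proof -
  obtain a r where r: "0 < r" "ball a r \<subseteq> \<Omega>"
    using A.domain(1,3) by (meson ex_in_conv openE)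
  have ratio': "norm (t0 z) * norm (s1 z) = norm (s0 z) * norm (t1 z)" if "z \<in> \<Omega>" for z
  proof -
    have "(norm (t0 z) / norm (t1 z))\<^sup>2 = (norm (s0 z) / norm (s1 z))\<^sup>2"
      using ratio that by (simp add: A.t0 B.t0 power_divide)
    then have "norm (t0 z) / norm (t1 z) = norm (s0 z) / norm (s1 z)" by simp
    then show ?thesis using A.E1.nonzero[OF that] B.E1.nonzero[OF that] by (simp add: field_simps)
  qed
  show ?thesis
    using curv
  proof
    assume "\<forall>\<mu>\<in>\<Omega>. curvature \<Omega> T0 \<mu> = curvature \<Omega> T0' \<mu>"
    then have lc: "log_curvature t0 z = log_curvature s0 z" if "z \<in> ball a r" for z
      using that r(2) A.E0.curvature_eq B.E0.curvature_eq by (metis subsetD)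
    have "\<exists>f. f holomorphic_on ball a r \<and> (\<forall>z. f z \<noteq> 0) \<and>
        (\<forall>z\<in>ball a r. norm (t0 z) = cmod (f z) * norm (s0 z))"
      by (rule local_norm_quotient[of a r t0 s0])
        (use r(2) lc A.E0.holo A.E0.nonzero B.E0.holo B.E0.nonzero in blast)+
    then obtain f where f: "f holomorphic_on ball a r" "\<And>z. f z \<noteq> 0"
      "\<And>z. z \<in> ball a r \<Longrightarrow> norm (t0 z) = cmod (f z) * norm (s0 z)" by blast
    have "norm (t1 z) = cmod (f z) * norm (s1 z)" if "z \<in> ball a r" for z
    proof -
      have "z \<in> \<Omega>" using that r(2) by blast
      then show ?thesis using ratio' f(3)[OF that] B.E0.nonzero by fastforce
    qed
    then show ?thesis using f by (intro diagonal_equivalence_from_norms[OF r, where f = f]) blast+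
  next
    assume "\<forall>\<mu>\<in>\<Omega>. curvature \<Omega> T1 \<mu> = curvature \<Omega> T1' \<mu>"
    then have lc: "log_curvature t1 z = log_curvature s1 z" if "z \<in> ball a r" for z
      using that r(2) A.E1.curvature_eq B.E1.curvature_eq by (metis subsetD)
    have "\<exists>f. f holomorphic_on ball a r \<and> (\<forall>z. f z \<noteq> 0) \<and>
        (\<forall>z\<in>ball a r. norm (t1 z) = cmod (f z) * norm (s1 z))"
      by (rule local_norm_quotient[of a r t1 s1])
        (use r(2) lc A.E1.holo A.E1.nonzero B.E1.holo B.E1.nonzero in blast)+
    then obtain f where f: "f holomorphic_on ball a r" "\<And>z. f z \<noteq> 0"
      "\<And>z. z \<in> ball a r \<Longrightarrow> norm (t1 z) = cmod (f z) * norm (s1 z)" by blast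
    have "norm (t0 z) = cmod (f z) * norm (s0 z)" if "z \<in> ball a r" for z
    proof -
      have "z \<in> \<Omega>" using that r(2) by blast
      then show ?thesis using ratio' f(3)[OF that] B.E1.nonzero by fastforce
    qed
    then show ?thesis using f by (intro diagonal_equivalence_from_norms[OF r, where f = f]) blast+
  qed
qed

abbreviation "P \<mu> \<equiv> block_op (F_P \<Omega> T0 t0 \<mu>) (S_P \<Omega> T0 t0 t1 \<mu>) (cadjoint (S_P \<Omega> T0 t0 t1 \<mu>)) (\<lambda>y. 0)"

abbreviation "P' \<mu> \<equiv> block_op (F_P \<Omega> T0' s0 \<mu>) (S_P \<Omega> T0' s0 s1 \<mu>) (cadjoint (S_P \<Omega> T0' s0 s1 \<mu>)) (\<lambda>y. 0)"

lemma deriv_multiple: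
  assumes U: "unitary U0" and c: "c holomorphic_on \<Omega>" and Ut: "\<And>\<mu>. \<mu> \<in> \<Omega> \<Longrightarrow> U0 (t0 \<mu>) = c \<mu> *\<^sub>C s0 \<mu>"
    and \<mu>: "\<mu> \<in> \<Omega>"
  shows "U0 (cderiv t0 \<mu>) = deriv c \<mu> *\<^sub>C s0 \<mu> + c \<mu> *\<^sub>C cderiv s0 \<mu>"
proof -
  have "has_cderiv (\<lambda>z. c z *\<^sub>C s0 z) (deriv c \<mu> *\<^sub>C s0 \<mu> + c \<mu> *\<^sub>C cderiv s0 \<mu>) \<mu>"
    by (rule has_cderiv_scaleC[OF holomorphic_derivI[OF c A.domain(1) \<mu>] B.E0.deriv_section[OF \<mu>]])
  then have "has_cderiv (\<lambda>z. U0 (t0 z)) (deriv c \<mu> *\<^sub>C s0 \<mu> + c \<mu> *\<^sub>C cderiv s0 \<mu>) \<mu>"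
    by (rule has_cderiv_transform[OF _ A.domain(1) \<mu>]) (simp add: Ut)
  then show ?thesis
    using has_cderiv_unique has_cderiv_bounded_clinear[OF unitary_bounded_clinear[OF U] A.E0.deriv_section[OF \<mu>]]
    by blast
qed

lemma dual_vec_multiple:
  assumes U: "unitary U0" and c: "c holomorphic_on \<Omega>" and Ut: "\<And>\<mu>. \<mu> \<in> \<Omega> \<Longrightarrow> U0 (t0 \<mu>) = c \<mu> *\<^sub>C s0 \<mu>"
    and \<mu>: "\<mu> \<in> \<Omega>" and nz: "c \<mu> \<noteq> 0"
  shows "U0 (dual_vec (t0 \<mu>) (cderiv t0 \<mu>)) = (1 / cnj (c \<mu>)) *\<^sub>C dual_vec (s0 \<mu>) (cderiv s0 \<mu>)"
  by (simp add: dual_vec_unitary[OF U] Ut[OF \<mu>] deriv_multiple[OF U c Ut \<mu>] dual_vec_scale[OF nz])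

text \<open>Replacing \<open>s\<^sub>0, s\<^sub>1\<close> by \<open>c s\<^sub>0, c s\<^sub>1\<close> leaves the plane of the one-jet unchanged and divides the dual
  vector by \<open>cnj c\<close>, which cancels against the conjugate-linear occurrence of \<open>c s\<^sub>1\<close>.\<close>

lemma projection_data_intertwined:
  assumes D: "diagonally_equivalent U0 U1" and \<mu>: "\<mu> \<in> \<Omega>"
  shows "block_op U0 (\<lambda>y. 0) (\<lambda>x. 0) U1 (P \<mu> p) = P' \<mu> (block_op U0 (\<lambda>y. 0) (\<lambda>x. 0) U1 p)"
proof -
  have U: "unitary U0" "unitary U1" using D by (simp_all add: diagonally_equivalent_def)
  note l0 = bounded_clinearD[OF unitary_bounded_clinear[OF U(1)]]
    and l1 = bounded_clinearD[OF unitary_bounded_clinear[OF U(2)]]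
  obtain c where c: "c holomorphic_on \<Omega>" "\<And>\<mu>. \<mu> \<in> \<Omega> \<Longrightarrow> c \<mu> \<noteq> 0"
    and c0: "\<And>\<mu>. \<mu> \<in> \<Omega> \<Longrightarrow> U0 (t0 \<mu>) = c \<mu> *\<^sub>C s0 \<mu>" and c1: "\<And>\<mu>. \<mu> \<in> \<Omega> \<Longrightarrow> U1 (t1 \<mu>) = c \<mu> *\<^sub>C s1 \<mu>"
    using diagonal_equivalence_sections[OF D] by blast
  let ?d = "dual_vec (t0 \<mu>) (cderiv t0 \<mu>)" and ?e = "dual_vec (s0 \<mu>) (cderiv s0 \<mu>)"
  have ind: "cindependent_pair (t0 \<mu>) (cderiv t0 \<mu>)" "cindependent_pair (s0 \<mu>) (cderiv s0 \<mu>)"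
    using A.independent B.independent \<mu> by blast+
  note nz = c(2)[OF \<mu>]
  have dual: "U0 ?d = (1 / cnj (c \<mu>)) *\<^sub>C ?e" by (rule dual_vec_multiple[OF U(1) c(1) c0 \<mu> nz])
  have deriv: "U0 (cderiv t0 \<mu>) = deriv c \<mu> *\<^sub>C s0 \<mu> + c \<mu> *\<^sub>C cderiv s0 \<mu>"
    by (rule deriv_multiple[OF U(1) c(1) c0 \<mu>])
  have img: "U0 ` complex_vector.span {t0 \<mu>, cderiv t0 \<mu>} = complex_vector.span {s0 \<mu>, cderiv s0 \<mu>}"
    unfolding image_plane[OF unitary_bounded_clinear[OF U(1)]] c0[OF \<mu>] deriv
    by (rule plane_scale[OF nz])
  have F: "U0 (F_P \<Omega> T0 t0 \<mu> x) = F_P \<Omega> T0' s0 \<mu> (U0 x)" for x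
    unfolding B.E0.F_P_eq_orth_proj[OF \<mu> ind(2)]
    by (rule orth_proj_unitary[OF U(1) complex_vector.subspace_span img
          A.E0.F_P_in_plane[OF \<mu> ind(1)] A.E0.F_P_orthogonal[OF \<mu> ind(1)], symmetric])
  have S: "U0 (S_P \<Omega> T0 t0 t1 \<mu> y) = S_P \<Omega> T0' s0 s1 \<mu> (U1 y)" for y
  proof -
    have "cinner y (t1 \<mu>) = cnj (c \<mu>) * cinner (U1 y) (s1 \<mu>)"
      using unitary_cinner[OF U(2), of y "t1 \<mu>"] by (simp add: c1[OF \<mu>] cinner_simps)
    then show ?thesis
      using nz by (simp add: A.E0.S_P_eq[OF \<mu>] B.E0.S_P_eq[OF \<mu>] l0 dual scaleC_scaleC)
  qed
  have C: "U1 (cadjoint (S_P \<Omega> T0 t0 t1 \<mu>) x) = cadjoint (S_P \<Omega> T0' s0 s1 \<mu>) (U0 x)" for x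
  proof -
    have "cinner x ?d = (1 / c \<mu>) * cinner (U0 x) ?e"
      using unitary_cinner[OF U(1), of x ?d] by (simp add: dual cinner_simps)
    then show ?thesis
      using nz by (simp add: A.E0.cadjoint_S_P[OF \<mu>] B.E0.cadjoint_S_P[OF \<mu>] l1 c1[OF \<mu>] scaleC_scaleC)
  qed
  show ?thesis by (simp add: block_op_def l0 F S C)
qed

text \<open>
  Conversely, intertwining the rank-one parts forces \<open>U\<^sub>1 t\<^sub>1\<close> to be a multiple of \<open>s\<^sub>1\<close>; inside the
  plane onto which the first part projects, \<open>t\<^sub>0\<close> is orthogonal to the dual vector, so \<open>U\<^sub>0 t\<^sub>0\<close> is a
  multiple of \<open>s\<^sub>0\<close>. Comparing the dual vectors shows that both factors agree.
\<close>

lemma diagonal_equivalence_from_projection_data: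
  assumes U: "unitary U0" "unitary U1"
    and F: "\<And>\<mu> x. \<mu> \<in> \<Omega> \<Longrightarrow> U0 (F_P \<Omega> T0 t0 \<mu> x) = F_P \<Omega> T0' s0 \<mu> (U0 x)"
    and SP: "\<And>\<mu> y. \<mu> \<in> \<Omega> \<Longrightarrow> U0 (S_P \<Omega> T0 t0 t1 \<mu> y) = S_P \<Omega> T0' s0 s1 \<mu> (U1 y)"
  shows "diagonally_equivalent U0 U1"
proof -
  note l0 = unitary_bounded_clinear[OF U(1)] and l1 = unitary_bounded_clinear[OF U(2)]
  define d where "d \<mu> = dual_vec (t0 \<mu>) (cderiv t0 \<mu>)" for \<mu>
  define e where "e \<mu> = dual_vec (s0 \<mu>) (cderiv s0 \<mu>)" for \<mu>
  have "\<exists>a k. k \<noteq> 0 \<and> U0 (d \<mu>) = k *\<^sub>C e \<mu> \<and> s1 \<mu> = cnj k *\<^sub>C U1 (t1 \<mu>) \<and> U0 (t0 \<mu>) = a *\<^sub>C s0 \<mu>"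
    if \<mu>: "\<mu> \<in> \<Omega>" for \<mu>
  proof -
    have d0: "d \<mu> \<noteq> 0" and e0: "e \<mu> \<noteq> 0"
      using dual_vec_nonzero A.gram_nonzero[OF \<mu>] B.gram_nonzero[OF \<mu>] by (auto simp: d_def e_def)
    have sp: "cinner y (t1 \<mu>) *\<^sub>C U0 (d \<mu>) = cinner (U1 y) (s1 \<mu>) *\<^sub>C e \<mu>" for y
      using SP[OF \<mu>, of y]
      by (simp add: A.E0.S_P_eq[OF \<mu>] B.E0.S_P_eq[OF \<mu>] bounded_clinearD(6)[OF l0] d_def e_def)
    have N: "cinner (t1 \<mu>) (t1 \<mu>) \<noteq> 0" using A.E1.nonzero[OF \<mu>] by simp
    define k where "k = cinner (U1 (t1 \<mu>)) (s1 \<mu>) / cinner (t1 \<mu>) (t1 \<mu>)"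
    have "U0 (d \<mu>) = (1 / cinner (t1 \<mu>) (t1 \<mu>)) *\<^sub>C (cinner (t1 \<mu>) (t1 \<mu>) *\<^sub>C U0 (d \<mu>))"
      using N by (simp add: scaleC_scaleC)
    then have k: "U0 (d \<mu>) = k *\<^sub>C e \<mu>" unfolding sp by (simp add: k_def scaleC_scaleC)
    have k0: "k \<noteq> 0" using k d0 unitary_norm[OF U(1), of "d \<mu>"] by auto
    have "cinner (U1 y) (s1 \<mu>) = k * cinner (U1 y) (U1 (t1 \<mu>))" for y
      using sp[of y] e0 by (simp add: k scaleC_scaleC unitary_cinner[OF U(2)] mult.commute)
    then have "cinner (U1 y) (s1 \<mu> - cnj k *\<^sub>C U1 (t1 \<mu>)) = 0" for y by (simp add: cinner_simps)
    from this[of "inv U1 (s1 \<mu> - cnj k *\<^sub>C U1 (t1 \<mu>))"]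
    have s1: "s1 \<mu> = cnj k *\<^sub>C U1 (t1 \<mu>)" by (simp add: unitary_f_inv[OF U(2)])
    have ind: "cindependent_pair (t0 \<mu>) (cderiv t0 \<mu>)" "cindependent_pair (s0 \<mu>) (cderiv s0 \<mu>)"
      using A.independent B.independent \<mu> by blast+
    have "F_P \<Omega> T0 t0 \<mu> (t0 \<mu>) = t0 \<mu>"
      unfolding A.E0.F_P_eq_orth_proj[OF \<mu> ind(1)]
      by (rule orth_proj_eqI) (auto intro: complex_vector.span_base)
    then have "U0 (t0 \<mu>) = F_P \<Omega> T0' s0 \<mu> (U0 (t0 \<mu>))" using F[OF \<mu>, of "t0 \<mu>"] by simp
    then have "U0 (t0 \<mu>) \<in> complex_vector.span {s0 \<mu>, cderiv s0 \<mu>}"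
      using B.E0.F_P_in_plane[OF \<mu> ind(2)] by metis
    then obtain a b where ab: "U0 (t0 \<mu>) = a *\<^sub>C s0 \<mu> + b *\<^sub>C cderiv s0 \<mu>" unfolding mem_plane_iff by blast
    have "cinner (d \<mu>) (t0 \<mu>) = k * cinner (e \<mu>) (U0 (t0 \<mu>))"
      using unitary_cinner[OF U(1), of "d \<mu>" "t0 \<mu>"] by (simp add: k cinner_simps)
    then have "cinner (e \<mu>) (U0 (t0 \<mu>)) = 0"
      using k0 by (simp add: d_def cinner_dual_vec_left)
    then have "b = 0"
      using B.gram_nonzero[OF \<mu>]
      by (simp add: ab e_def cinner_simps cinner_dual_vec_left cinner_dual_vec_right)
    then show ?thesis using k k0 s1 ab by auto
  qed
  then obtain a k where k0: "\<And>\<mu>. \<mu> \<in> \<Omega> \<Longrightarrow> k \<mu> \<noteq> 0" and k: "\<And>\<mu>. \<mu> \<in> \<Omega> \<Longrightarrow> U0 (d \<mu>) = k \<mu> *\<^sub>C e \<mu>"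
    and s1: "\<And>\<mu>. \<mu> \<in> \<Omega> \<Longrightarrow> s1 \<mu> = cnj (k \<mu>) *\<^sub>C U1 (t1 \<mu>)" and a: "\<And>\<mu>. \<mu> \<in> \<Omega> \<Longrightarrow> U0 (t0 \<mu>) = a \<mu> *\<^sub>C s0 \<mu>"
    by metis
  have hol: "a holomorphic_on \<Omega>"
    by (rule holomorphic_coefficient[OF A.domain(1) _ B.E0.holo B.E0.nonzero a])
      (use has_cderiv_bounded_clinear[OF l0 A.E0.deriv_section] in blast)
  have t1: "U1 (t1 \<mu>) = a \<mu> *\<^sub>C s1 \<mu>" if \<mu>: "\<mu> \<in> \<Omega>" for \<mu>
  proof -
    have a0: "a \<mu> \<noteq> 0" using a[OF \<mu>] A.E0.nonzero[OF \<mu>] unitary_norm[OF U(1), of "t0 \<mu>"] by auto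
    have "U0 (d \<mu>) = (1 / cnj (a \<mu>)) *\<^sub>C e \<mu>"
      unfolding d_def e_def by (rule dual_vec_multiple[OF U(1) hol a \<mu> a0])
    then have "k \<mu> *\<^sub>C e \<mu> = (1 / cnj (a \<mu>)) *\<^sub>C e \<mu>" by (simp only: k[OF \<mu>])
    moreover have "e \<mu> \<noteq> 0" using dual_vec_nonzero B.gram_nonzero[OF \<mu>] by (simp add: e_def)
    ultimately have "k \<mu> = 1 / cnj (a \<mu>)" by simp
    then show ?thesis using a0 by (simp add: s1[OF \<mu>] scaleC_scaleC)
  qed
  have "(\<lambda>x. U0 (T0 x)) = (\<lambda>x. T0' (U0 x))"
    by (rule A.E0.eq_if_eq_on_sections[OF bounded_clinear_comp[OF l0 A.E0.clinear] bounded_clinear_comp[OF B.E0.clinear l0]])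
      (simp add: A.E0.eigen bounded_clinearD[OF l0] a B.E0.eigen bounded_clinearD[OF B.E0.clinear] scaleC_scaleC mult.commute)
  moreover have "(\<lambda>y. U1 (T1 y)) = (\<lambda>y. T1' (U1 y))"
    by (rule A.E1.eq_if_eq_on_sections[OF bounded_clinear_comp[OF l1 A.E1.clinear] bounded_clinear_comp[OF B.E1.clinear l1]])
      (simp add: A.E1.eigen bounded_clinearD[OF l1] t1 B.E1.eigen bounded_clinearD[OF B.E1.clinear] scaleC_scaleC mult.commute)
  moreover have "(\<lambda>y. U0 (S y)) = (\<lambda>y. S' (U1 y))"
  proof (rule A.E1.eq_if_eq_on_sections[OF bounded_clinear_comp[OF l0 A.S_clinear] bounded_clinear_comp[OF B.S_clinear l1]])
    fix \<mu> assume \<mu>: "\<mu> \<in> \<Omega>"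
    have "S (t1 \<mu>) = - t0 \<mu>" "S' (s1 \<mu>) = - s0 \<mu>" by (simp_all add: A.t0 B.t0)
    then show "U0 (S (t1 \<mu>)) = S' (U1 (t1 \<mu>))"
      using a[OF \<mu>] t1[OF \<mu>] by (simp add: bounded_clinearD[OF l0] bounded_clinearD[OF B.S_clinear])
  qed
  ultimately show ?thesis using U by (simp add: diagonally_equivalent_def fun_eq_iff)
qed

lemma projection_data_iff:
  "(\<exists>U U0 U1. unitary U \<and> U = block_op U0 (\<lambda>y. 0) (\<lambda>x. 0) U1 \<and>
      (\<forall>\<mu>\<in>\<Omega>. P \<mu> = cadjoint U \<circ> P' \<mu> \<circ> U))
    \<longleftrightarrow> (\<exists>U0 U1. diagonally_equivalent U0 U1)"
proof
  assume "\<exists>U U0 U1. unitary U \<and> U = block_op U0 (\<lambda>y. 0) (\<lambda>x. 0) U1 \<and>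
      (\<forall>\<mu>\<in>\<Omega>. P \<mu> = cadjoint U \<circ> P' \<mu> \<circ> U)"
  then obtain U U0 U1 where U: "unitary U" and blk: "U = block_op U0 (\<lambda>y. 0) (\<lambda>x. 0) U1"
    and eq: "\<And>\<mu>. \<mu> \<in> \<Omega> \<Longrightarrow> P \<mu> = cadjoint U \<circ> P' \<mu> \<circ> U" by blast
  have un: "unitary U0" "unitary U1" using U blk unitary_block_diagonal_iff by blast+
  have Ux: "U (x, y) = (U0 x, U1 y)" for x y by (simp add: blk block_op_def)
  have z: "U0 0 = 0" "U1 0 = 0" using bounded_clinearD(5)[OF unitary_bounded_clinear] un by blast+
  have int: "U (P \<mu> p) = P' \<mu> (U p)" if "\<mu> \<in> \<Omega>" for \<mu> p
    by (simp only: eq[OF that] cadjoint_unitary[OF U] comp_apply unitary_f_inv[OF U])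
  have S0: "S_P \<Omega> T0 t0 t1 \<mu> 0 = 0" "S_P \<Omega> T0' s0 s1 \<mu> 0 = 0" if "\<mu> \<in> \<Omega>" for \<mu>
    by (simp_all add: A.E0.S_P_eq[OF that] B.E0.S_P_eq[OF that])
  have F0: "F_P \<Omega> T0 t0 \<mu> 0 = 0" "F_P \<Omega> T0' s0 \<mu> 0 = 0" for \<mu>
    by (simp_all add: F_P_def rank_one_def)
  have "diagonally_equivalent U0 U1"
  proof (rule diagonal_equivalence_from_projection_data[OF un])
    fix \<mu> assume \<mu>: "\<mu> \<in> \<Omega>"
    show "U0 (F_P \<Omega> T0 t0 \<mu> x) = F_P \<Omega> T0' s0 \<mu> (U0 x)" for x
      using arg_cong[OF int[OF \<mu>, of "(x, 0)"], of fst] by (simp add: Ux z S0[OF \<mu>] block_op_def[of "F_P _ _ _ _"])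
    show "U0 (S_P \<Omega> T0 t0 t1 \<mu> y) = S_P \<Omega> T0' s0 s1 \<mu> (U1 y)" for y
      using arg_cong[OF int[OF \<mu>, of "(0, y)"], of fst] by (simp add: Ux z F0 block_op_def[of "F_P _ _ _ _"])
  qed
  then show "\<exists>U0 U1. diagonally_equivalent U0 U1" by blast
next
  assume "\<exists>U0 U1. diagonally_equivalent U0 U1"
  then obtain U0 U1 where D: "diagonally_equivalent U0 U1" by blast
  define U where "U = block_op U0 (\<lambda>y. 0) (\<lambda>x. 0) U1"
  have U: "unitary U"
    using D unfolding U_def unitary_block_diagonal_iff diagonally_equivalent_def by blast
  have "P \<mu> p = (cadjoint U \<circ> P' \<mu> \<circ> U) p" if "\<mu> \<in> \<Omega>" for \<mu> p
    using projection_data_intertwined[OF D that, of p, folded U_def]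
    by (simp only: cadjoint_unitary[OF U] comp_apply) (metis unitary_inv_f[OF U])
  then show "\<exists>U U0 U1. unitary U \<and> U = block_op U0 (\<lambda>y. 0) (\<lambda>x. 0) U1 \<and>
      (\<forall>\<mu>\<in>\<Omega>. P \<mu> = cadjoint U \<circ> P' \<mu> \<circ> U)"
    using U U_def by blast
qed

end

theorem theorem3p7:
  fixes \<Omega> :: "complex set"
    and T0 :: "'a::separable_chilbert_space \<Rightarrow> 'a"
    and T1 :: "'b::separable_chilbert_space \<Rightarrow> 'b"
    and S :: "'b \<Rightarrow> 'a"
    and T :: "'a \<times> 'b \<Rightarrow> 'a \<times> 'b"
    and T0' :: "'c::separable_chilbert_space \<Rightarrow> 'c"
    and T1' :: "'d::separable_chilbert_space \<Rightarrow> 'd"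
    and S' :: "'d \<Rightarrow> 'c"
    and T' :: "'c \<times> 'd \<Rightarrow> 'c \<times> 'd"
    and t0 :: "complex \<Rightarrow> 'a" and t1 :: "complex \<Rightarrow> 'b"
    and t0' :: "complex \<Rightarrow> 'c" and t1' :: "complex \<Rightarrow> 'd"
  assumes domain: "open \<Omega>" "connected \<Omega>" "\<Omega> \<noteq> {}" "bounded \<Omega>"
    and T: "T = block_op T0 S (\<lambda>x. 0) T1" "(T0, S, T1) \<in> FB2 \<Omega>"
    and T': "T' = block_op T0' S' (\<lambda>x. 0) T1'" "(T0', S', T1') \<in> FB2 \<Omega>"
    and t1: "nonvanishing_section \<Omega> T1 t1"
    and t1': "nonvanishing_section \<Omega> T1' t1'"
    and t0: "t0 = (\<lambda>\<mu>. - S (t1 \<mu>))" "\<forall>\<mu>\<in>\<Omega>. cindependent_pair (t0 \<mu>) (cderiv t0 \<mu>)"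
    and t0': "t0' = (\<lambda>\<mu>. - S' (t1' \<mu>))" "\<forall>\<mu>\<in>\<Omega>. cindependent_pair (t0' \<mu>) (cderiv t0' \<mu>)"
  defines "st1 \<equiv> \<exists>U :: 'a \<times> 'b \<Rightarrow> 'c \<times> 'd. unitary U \<and>
        (\<forall>\<mu>\<in>\<Omega>. U \<circ> eigen_proj T \<mu> = eigen_proj T' \<mu> \<circ> U)"
    and "st2 \<equiv> \<exists>U :: 'a \<times> 'b \<Rightarrow> 'c \<times> 'd. unitary U \<and> U \<circ> T = T' \<circ> U"
    and "st3_0 \<equiv> (\<forall>\<mu>\<in>\<Omega>. curvature \<Omega> T0 \<mu> = curvature \<Omega> T0' \<mu>) \<and>
        (\<forall>\<mu>\<in>\<Omega>. (norm (S (t1 \<mu>)))\<^sup>2 / (norm (t1 \<mu>))\<^sup>2 = (norm (S' (t1' \<mu>)))\<^sup>2 / (norm (t1' \<mu>))\<^sup>2)"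
    and "st3_1 \<equiv> (\<forall>\<mu>\<in>\<Omega>. curvature \<Omega> T1 \<mu> = curvature \<Omega> T1' \<mu>) \<and>
        (\<forall>\<mu>\<in>\<Omega>. (norm (S (t1 \<mu>)))\<^sup>2 / (norm (t1 \<mu>))\<^sup>2 = (norm (S' (t1' \<mu>)))\<^sup>2 / (norm (t1' \<mu>))\<^sup>2)"
    and "st4 \<equiv> \<exists>(U :: 'a \<times> 'b \<Rightarrow> 'c \<times> 'd) U00 U11. unitary U \<and>
        U = block_op U00 (\<lambda>y. 0) (\<lambda>x. 0) U11 \<and>
        (\<forall>\<mu>\<in>\<Omega>.
          block_op (F_P \<Omega> T0 t0 \<mu>) (S_P \<Omega> T0 t0 t1 \<mu>) (cadjoint (S_P \<Omega> T0 t0 t1 \<mu>)) (\<lambda>y. 0)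
          = cadjoint U \<circ>
            block_op (F_P \<Omega> T0' t0' \<mu>) (S_P \<Omega> T0' t0' t1' \<mu>) (cadjoint (S_P \<Omega> T0' t0' t1' \<mu>)) (\<lambda>y. 0)
            \<circ> U)"
  shows "(st1 \<longleftrightarrow> st2) \<and> (st2 \<longleftrightarrow> st3_0) \<and> (st2 \<longleftrightarrow> st3_1) \<and> (st2 \<longleftrightarrow> st4)"
proof -
  interpret flag_pair \<Omega> T0 S T1 t0 t1 T0' S' T1' t0' t1'
    using domain T T' t1 t1' t0 t0' by unfold_locales auto
  note A0 = A.E0.eigen_line_bundle_axioms and B0 = B.E0.eigen_line_bundle_axioms
    and A1 = A.E1.eigen_line_bundle_axioms and B1 = B.E1.eigen_line_bundle_axioms
  define D where "D \<longleftrightarrow> (\<exists>U0 U1. diagonally_equivalent U0 U1)"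
  have "st1 \<longleftrightarrow> st2"
    unfolding st1_def st2_def T(1) T'(1) using eigen_projections_intertwined_iff by blast
  moreover have st2: "st2 \<longleftrightarrow> D"
    unfolding st2_def T(1) T'(1) D_def by (rule unitarily_equivalent_iff)
  moreover have "st4 \<longleftrightarrow> D"
    unfolding st4_def D_def by (rule projection_data_iff)
  moreover have "D \<Longrightarrow> st3_0" "D \<Longrightarrow> st3_1"
    unfolding D_def st3_0_def st3_1_def using ratio_invariant
      curvature_unitary_invariant[OF A0 B0] curvature_unitary_invariant[OF A1 B1]
    by (auto simp: diagonally_equivalent_def)
  moreover have "st3_0 \<Longrightarrow> D" "st3_1 \<Longrightarrow> D"
    unfolding D_def st3_0_def st3_1_def using diagonal_equivalence_from_curvature by blast+
  ultimately show ?thesis by blast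
qed

end
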